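(* Let $X$ be a foldable surface with fan $\Sigma$ in $N_{\mathbb R}$. Assume that $\mathrm{Aut}(N,\Sigma)$ contains a subgroup isomorphic to $C_p$, $p\geq 2$. - If $p\in\{2,4\}$, then $X$ is obtained from $\mathbb P^1\times\mathbb P^1$ by successive $C_p$-equivariant blow-ups. - If $p=3$, then $X$ is obtained from $\mathbb P^2$ by successive $C_p$-equivariant blow-ups. - If $p=6$, then $X$ is obtained from $\mathrm{Bl}_{p_1,p_2,p_3}(\mathbb P^2)$ by successive $C_p$-equivariant blow-ups.
   Context: Let $N$ be a rank two lattice and $N_{\mathbb R}=N\otimes_{\mathbb Z}\mathbb R$. A fan in $N_{\mathbb R}$ is smooth if each cone is generated by part of a $\mathbb Z$-basis of $N$, complete if the union of its cones is $N_{\mathbb R}$. $\mathrm{Aut}(N,\Sigma)$ is the group of elements of $\mathrm{GL}_{\mathbb Z}(N)$ whose $\mathbb R$-linear extension maps $\Sigma$ bijectively to itself. $C_p$ denotes the cyclic group of order $p$; by convention a subgroup of $\mathrm{Aut}(N,\Sigma)$ called $C_2$ is the one generated by $-\mathrm{Id}$ (a group generated by a reflection is denoted $D_1$ and does not count as $C_2$). A complete smooth fan is foldable if $\mathrm{Aut}(N,\Sigma)$ contains a non-trivial cyclic subgroup in this sense, and a foldable surface is the smooth compact complex toric surface of a foldable fan. $\mathrm{Bl}_{p_1,p_2,p_3}(\mathbb P^2)$ is the blow-up of $\mathbb P^2$ at its three torus fixed points. For $G\subset\mathrm{Aut}(N,\Sigma)$, a $G$-equivariant blow-up of $X$ is a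 blow-up of $X$ along a $G$-orbit of torus fixed points (torus fixed points correspond to two-dimensional cones of $\Sigma$, which $G$ permutes; $G$ is then again a group of lattice automorphisms of the fan of the blow-up). A smooth toric surface $\tilde X$ is obtained from $X$ by successive $G$-equivariant blow-ups if there is a sequence (possibly of length zero) of $G$-equivariant blow-ups $\tilde X=X_k\to X_{k-1}\to\cdots\to X_1\to X_0=X$. *)

theory Defs
  imports "HOL-Analysis.Analysis" "HOL-Algebra.Elementary_Groups"
begin

section \<open>Lattices and fans\<close>

text \<open>
  The real vector space \<open>N\<^sub>\<real>\<close> is a Euclidean space type (only its linear structure matters) and
  the lattice \<open>N\<close> is the set of integer combinations of one of its vector space bases.  An element
  of \<open>GL\<^sub>\<int>(N)\<close> is represented by its linear extension.
\<close>

definition lattice_basis :: "'a::euclidean_space set \<Rightarrow> 'a set \<Rightarrow> bool" where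
  "lattice_basis N B \<longleftrightarrow> independent B \<and> span B = UNIV \<and>
     N = {v. \<exists>c::'a \<Rightarrow> int. v = (\<Sum>b\<in>B. of_int (c b) *\<^sub>R b)}"

definition full_lattice :: "'a::euclidean_space set \<Rightarrow> bool" where
  "full_lattice N \<longleftrightarrow> (\<exists>B. lattice_basis N B)"

definition rational_cone :: "'a::euclidean_space set \<Rightarrow> 'a set \<Rightarrow> bool" where
  "rational_cone N \<sigma> \<longleftrightarrow>
     (\<exists>S. finite S \<and> S \<subseteq> N \<and> \<sigma> = convex_cone hull S) \<and> \<sigma> \<inter> uminus ` \<sigma> = {0}"

text \<open>The library's faces of a convex set include the empty set, which is not a cone.\<close>

definition cone_face :: "'a::euclidean_space set \<Rightarrow> 'a set \<Rightarrow> bool" where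
  "cone_face \<tau> \<sigma> \<longleftrightarrow> \<tau> face_of \<sigma> \<and> \<tau> \<noteq> {}"

definition fan :: "'a::euclidean_space set \<Rightarrow> 'a set set \<Rightarrow> bool" where
  "fan N \<Sigma> \<longleftrightarrow> finite \<Sigma> \<and> (\<forall>\<sigma>\<in>\<Sigma>. rational_cone N \<sigma>) \<and>
     (\<forall>\<sigma>\<in>\<Sigma>. \<forall>\<tau>. cone_face \<tau> \<sigma> \<longrightarrow> \<tau> \<in> \<Sigma>) \<and>
     (\<forall>\<sigma>\<in>\<Sigma>. \<forall>\<tau>\<in>\<Sigma>. cone_face (\<sigma> \<inter> \<tau>) \<sigma> \<and> cone_face (\<sigma> \<inter> \<tau>) \<tau>)"

definition smooth_fan :: "'a::euclidean_space set \<Rightarrow> 'a set set \<Rightarrow> bool" where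
  "smooth_fan N \<Sigma> \<longleftrightarrow> fan N \<Sigma> \<and>
     (\<forall>\<sigma>\<in>\<Sigma>. \<exists>B S. lattice_basis N B \<and> S \<subseteq> B \<and> \<sigma> = convex_cone hull S)"

definition complete_smooth_fan :: "'a::euclidean_space set \<Rightarrow> 'a set set \<Rightarrow> bool" where
  "complete_smooth_fan N \<Sigma> \<longleftrightarrow> smooth_fan N \<Sigma> \<and> \<Union>\<Sigma> = UNIV"

definition Aut_fan :: "'a::euclidean_space set \<Rightarrow> 'a set set \<Rightarrow> ('a \<Rightarrow> 'a) monoid" where
  "Aut_fan N \<Sigma> =
     \<lparr>carrier = {g. linear g \<and> bij g \<and> g ` N = N \<and> bij_betw (\<lambda>\<sigma>. g ` \<sigma>) \<Sigma> \<Sigma>},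
      monoid.mult = (\<lambda>g h. g \<circ> h), one = id\<rparr>"

text \<open>\<open>G\<close> is a subgroup \<open>C\<^sub>p\<close> of the automorphism group, where \<open>C\<^sub>2\<close> always means \<open>{Id, -Id}\<close>.\<close>

definition cyclic_Aut_subgroup ::
  "'a::euclidean_space set \<Rightarrow> 'a set set \<Rightarrow> nat \<Rightarrow> ('a \<Rightarrow> 'a) set \<Rightarrow> bool" where
  "cyclic_Aut_subgroup N \<Sigma> p G \<longleftrightarrow> subgroup G (Aut_fan N \<Sigma>) \<and>
     (Aut_fan N \<Sigma>)\<lparr>carrier := G\<rparr> \<cong> integer_mod_group p \<and>
     (p = 2 \<longrightarrow> G = {id, uminus})"

definition foldable :: "'a::euclidean_space set \<Rightarrow> 'a set set \<Rightarrow> bool" where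
  "foldable N \<Sigma> \<longleftrightarrow> complete_smooth_fan N \<Sigma> \<and>
     (\<exists>p\<ge>2. \<exists>G. cyclic_Aut_subgroup N \<Sigma> p G)"

section \<open>Complex surfaces and blow-ups of points\<close>

text \<open>Holomorphy for maps of two variables on an open set: complex differentiability.\<close>

definition holomorphic2_on ::
  "(complex \<times> complex \<Rightarrow> complex \<times> complex) \<Rightarrow> (complex \<times> complex) set \<Rightarrow> bool" where
  "holomorphic2_on f W \<longleftrightarrow> (\<forall>z\<in>W. \<exists>D. (f has_derivative D) (at z) \<and>
     (\<forall>c a b. D (c * a, c * b) = (c * fst (D (a, b)), c * snd (D (a, b)))))"

text \<open>A surface is given by its points and an atlas of charts (domain, coordinates).\<close>

record 'p complex_surface =
  points :: "'p set"
  charts :: "('p set \<times> ('p \<Rightarrow> complex \<times> complex)) set"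

definition open_in_surface :: "'p complex_surface \<Rightarrow> 'p set \<Rightarrow> bool" where
  "open_in_surface X W \<longleftrightarrow> W \<subseteq> points X \<and> (\<forall>(U, \<phi>) \<in> charts X. open (\<phi> ` (W \<inter> U)))"

text \<open>
  Around every point of \<open>W\<close> the map is given, in some charts, by a holomorphic function \<open>h\<close> on an
  open set \<open>Q\<close> of coordinates.  In particular \<open>W\<close> is open, and the map is continuous on it.
\<close>

definition holomorphic_map_on ::
  "'p complex_surface \<Rightarrow> 'p set \<Rightarrow> 'q complex_surface \<Rightarrow> ('p \<Rightarrow> 'q) \<Rightarrow> bool" where
  "holomorphic_map_on X W Y f \<longleftrightarrow> W \<subseteq> points X \<and>
     (\<forall>a\<in>W. \<exists>(U, \<phi>) \<in> charts X. \<exists>(V, \<psi>) \<in> charts Y. \<exists>Q h.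
        a \<in> U \<and> f a \<in> V \<and> open Q \<and> \<phi> a \<in> Q \<and> Q \<subseteq> \<phi> ` (W \<inter> U) \<and> holomorphic2_on h Q \<and>
        (\<forall>b\<in>U. \<phi> b \<in> Q \<longrightarrow> f b \<in> V \<and> \<psi> (f b) = h (\<phi> b)))"

definition biholomorphic_on ::
  "'p complex_surface \<Rightarrow> 'p set \<Rightarrow> 'q complex_surface \<Rightarrow> 'q set \<Rightarrow> ('p \<Rightarrow> 'q) \<Rightarrow> bool" where
  "biholomorphic_on X W Y V f \<longleftrightarrow> bij_betw f W V \<and>
     holomorphic_map_on X W Y f \<and> holomorphic_map_on Y V X (inv_into W f)"

definition C2 :: "(complex \<times> complex) complex_surface" where
  "C2 = \<lparr>points = UNIV, charts = {(UNIV, id)}\<rparr>"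

definition complex_line :: "complex \<times> complex \<Rightarrow> (complex \<times> complex) set" where
  "complex_line w = {(c * fst w, c * snd w) | c. True}"

text \<open>
  The blow-up of the plane at the origin: pairs of a point and a line through the origin containing
  it.  On the lines spanned by \<open>(1, t)\<close> the coordinates are the first coordinate of the point and \<open>t\<close>;
  on the lines spanned by \<open>(t, 1)\<close> they are \<open>t\<close> and the second coordinate of the point.
\<close>

definition Bl0_C2 :: "((complex \<times> complex) \<times> (complex \<times> complex) set) complex_surface" where
  "Bl0_C2 =
    (let P = {(z, l). (\<exists>w. w \<noteq> (0, 0) \<and> l = complex_line w) \<and> z \<in> l} in
     \<lparr>points = P,
      charts =
       {({(z, l) \<in> P. \<exists>t. l = complex_line (1, t)},
         \<lambda>(z, l). (fst z, THE t. l = complex_line (1, t))),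
        ({(z, l) \<in> P. \<exists>t. l = complex_line (t, 1)},
         \<lambda>(z, l). (THE t. l = complex_line (t, 1), snd z))}\<rparr>)"

text \<open>
  \<open>\<pi>\<close> exhibits \<open>Y\<close> as the blow-up of \<open>X\<close> along the discrete set \<open>S\<close> of points: it is an isomorphism
  off \<open>S\<close>, and around each point of \<open>S\<close> it is, in coordinates \<open>\<phi>\<close> centred at the point, the
  restriction of \<open>fst :: Bl0_C2 \<rightarrow> C2\<close> over an open set \<open>B\<close>.
\<close>

definition blow_up_along ::
  "'p complex_surface \<Rightarrow> 'p set \<Rightarrow> 'q complex_surface \<Rightarrow> ('q \<Rightarrow> 'p) \<Rightarrow> bool" where
  "blow_up_along X S Y \<pi> \<longleftrightarrow> S \<subseteq> points X \<and>
     holomorphic_map_on Y (points Y) X \<pi> \<and>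
     biholomorphic_on Y {y \<in> points Y. \<pi> y \<notin> S} X (points X - S) \<pi> \<and>
     (\<forall>a\<in>S. \<exists>U B \<phi> \<psi>. open_in_surface X U \<and> U \<inter> S = {a} \<and> open B \<and>
        biholomorphic_on X U C2 B \<phi> \<and> \<phi> a = (0, 0) \<and>
        biholomorphic_on Y {y \<in> points Y. \<pi> y \<in> U} Bl0_C2 {q \<in> points Bl0_C2. fst q \<in> B} \<psi> \<and>
        (\<forall>y\<in>points Y. \<pi> y \<in> U \<longrightarrow> fst (\<psi> y) = \<phi> (\<pi> y)))"

section \<open>Toric surfaces\<close>

definition dual_lattice :: "'a::euclidean_space set \<Rightarrow> ('a \<Rightarrow> real) set" where
  "dual_lattice N = {m. linear m \<and> (\<forall>v\<in>N. m v \<in> \<int>)}"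

definition cone_semigroup :: "'a::euclidean_space set \<Rightarrow> 'a set \<Rightarrow> ('a \<Rightarrow> real) set" where
  "cone_semigroup N \<sigma> = {m \<in> dual_lattice N. \<forall>v\<in>\<sigma>. m v \<ge> 0}"

text \<open>
  A point of the affine toric variety of \<open>\<sigma>\<close> is a monoid homomorphism from \<open>cone_semigroup N \<sigma>\<close> to
  the multiplicative monoid of the complex numbers.  It lies in the torus orbit of \<open>\<sigma>\<close> if it vanishes
  exactly at the characters which are not identically zero on \<open>\<sigma>\<close>.
  Homomorphisms are extended by 0 outside their domain.
\<close>

definition orbit_of_cone ::
  "'a::euclidean_space set \<Rightarrow> 'a set \<Rightarrow> (('a \<Rightarrow> real) \<Rightarrow> complex) set" where
  "orbit_of_cone N \<sigma> = {x. x (\<lambda>v. 0) = 1 \<and>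
     (\<forall>m\<in>cone_semigroup N \<sigma>. \<forall>n\<in>cone_semigroup N \<sigma>. x (\<lambda>v. m v + n v) = x m * x n) \<and>
     (\<forall>m\<in>cone_semigroup N \<sigma>. x m \<noteq> 0 \<longleftrightarrow> (\<forall>v\<in>\<sigma>. m v = 0)) \<and>
     (\<forall>m. m \<notin> cone_semigroup N \<sigma> \<longrightarrow> x m = 0)}"

text \<open>
  The toric surface of a smooth complete fan is the disjoint union of its torus orbits, and a point is
  tagged with the cone \<open>\<tau>\<close> of its orbit.  The affine chart of \<open>\<sigma>\<close> is the union of the orbits of the
  faces of \<open>\<sigma>\<close>; for \<open>\<sigma>\<close> spanned by a lattice basis \<open>{u, v}\<close> with dual basis \<open>{m, n}\<close>, its coordinates
  are the characters \<open>m\<close> and \<open>n\<close>.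
\<close>

type_synonym 'a toric_point = "'a set \<times> (('a \<Rightarrow> real) \<Rightarrow> complex)"

definition toric_surface ::
  "'a::euclidean_space set \<Rightarrow> 'a set set \<Rightarrow> 'a toric_point complex_surface" where
  "toric_surface N \<Sigma> =
    (let P = {(\<tau>, x). \<tau> \<in> \<Sigma> \<and> x \<in> orbit_of_cone N \<tau>} in
     \<lparr>points = P,
      charts = {({(\<tau>, x) \<in> P. cone_face \<tau> (convex_cone hull {u, v})}, \<lambda>(\<tau>, x). (x m, x n)) | u v m n.
        u \<noteq> v \<and> lattice_basis N {u, v} \<and> convex_cone hull {u, v} \<in> \<Sigma> \<and>
        m \<in> dual_lattice N \<and> n \<in> dual_lattice N \<and>
        m u = 1 \<and> m v = 0 \<and> n u = 0 \<and> n v = 1}\<rparr>)"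

definition torus :: "'a::euclidean_space set \<Rightarrow> (('a \<Rightarrow> real) \<Rightarrow> complex) set" where
  "torus N = {t. (\<forall>m\<in>dual_lattice N. t m \<noteq> 0) \<and>
     (\<forall>m\<in>dual_lattice N. \<forall>n\<in>dual_lattice N. t (\<lambda>v. m v + n v) = t m * t n)}"

definition torus_act ::
  "(('a::euclidean_space \<Rightarrow> real) \<Rightarrow> complex) \<Rightarrow> 'a toric_point \<Rightarrow> 'a toric_point" where
  "torus_act t = (\<lambda>(\<tau>, x). (\<tau>, \<lambda>m. t m * x m))"

definition torus_fixed_points :: "'a::euclidean_space set \<Rightarrow> 'a set set \<Rightarrow> 'a toric_point set" where
  "torus_fixed_points N \<Sigma> =
     {a \<in> points (toric_surface N \<Sigma>). \<forall>t\<in>torus N. torus_act t a = a}"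

text \<open>
  The toric morphism to the surface of the fan \<open>\<Sigma>\<close> induced by a lattice map \<open>g\<close>: the orbit of \<open>\<tau>\<close> is
  mapped to the orbit of the smallest cone of \<open>\<Sigma>\<close> containing the image of \<open>\<tau>\<close>, by pulling back
  characters.  It is meaningful if \<open>g\<close> maps every cone of the source fan into some cone of \<open>\<Sigma>\<close>.
\<close>

definition toric_morphism ::
  "'a::euclidean_space set \<Rightarrow> 'a set set \<Rightarrow> ('a \<Rightarrow> 'a) \<Rightarrow> 'a toric_point \<Rightarrow> 'a toric_point" where
  "toric_morphism N \<Sigma> g = (\<lambda>(\<tau>, x).
     let \<rho> = \<Inter>{\<sigma> \<in> \<Sigma>. g ` \<tau> \<subseteq> \<sigma>}
     in (\<rho>, \<lambda>m. if m \<in> cone_semigroup N \<rho> then x (m \<circ> g) else 0))"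

text \<open>
  The surface of \<open>\<Sigma>'\<close> is the blow-up of the surface of \<open>\<Sigma>\<close> along \<open>S\<close>, where the blow-down map is the
  toric morphism induced by the identity of \<open>N\<close>.
\<close>

definition toric_blow_up ::
  "'a::euclidean_space set \<Rightarrow> 'a set set \<Rightarrow> 'a toric_point set \<Rightarrow> 'a set set \<Rightarrow> bool" where
  "toric_blow_up N \<Sigma> S \<Sigma>' \<longleftrightarrow> complete_smooth_fan N \<Sigma> \<and> complete_smooth_fan N \<Sigma>' \<and>
     (\<forall>\<tau>\<in>\<Sigma>'. \<exists>\<sigma>\<in>\<Sigma>. \<tau> \<subseteq> \<sigma>) \<and>
     blow_up_along (toric_surface N \<Sigma>) S (toric_surface N \<Sigma>') (toric_morphism N \<Sigma> id)"

definition equivariant_blow_up ::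
  "'a::euclidean_space set \<Rightarrow> ('a \<Rightarrow> 'a) set \<Rightarrow> 'a set set \<Rightarrow> 'a set set \<Rightarrow> bool" where
  "equivariant_blow_up N G \<Sigma> \<Sigma>' \<longleftrightarrow> subgroup G (Aut_fan N \<Sigma>) \<and>
     (\<exists>a\<in>torus_fixed_points N \<Sigma>. toric_blow_up N \<Sigma> {toric_morphism N \<Sigma> g a | g. g \<in> G} \<Sigma>')"

definition successive_equivariant_blow_ups ::
  "'a::euclidean_space set \<Rightarrow> ('a \<Rightarrow> 'a) set \<Rightarrow> 'a set set \<Rightarrow> 'a set set \<Rightarrow> bool" where
  "successive_equivariant_blow_ups N G \<Sigma>\<^sub>0 \<Sigma> \<longleftrightarrow> (equivariant_blow_up N G)\<^sup>*\<^sup>* \<Sigma>\<^sub>0 \<Sigma>"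

section \<open>The minimal models\<close>

text \<open>An isomorphism of toric surfaces is a lattice isomorphism matching the fans.\<close>

definition toric_isomorphic ::
  "'a::euclidean_space set \<Rightarrow> 'a set set \<Rightarrow> 'b::euclidean_space set \<Rightarrow> 'b set set \<Rightarrow> bool" where
  "toric_isomorphic N \<Sigma> N' \<Sigma>' \<longleftrightarrow>
     (\<exists>T. linear T \<and> bij T \<and> T ` N = N' \<and> (\<lambda>\<sigma>. T ` \<sigma>) ` \<Sigma> = \<Sigma>')"

definition P1_fan :: "real set set" where
  "P1_fan = {{0}, {0..}, {..0}}"

definition is_P1xP1 :: "'a::euclidean_space set \<Rightarrow> 'a set set \<Rightarrow> bool" where
  "is_P1xP1 N \<Sigma> \<longleftrightarrow>
     toric_isomorphic N \<Sigma> (\<int> \<times> \<int>) {\<sigma> \<times> \<tau> | \<sigma> \<tau>. \<sigma> \<in> P1_fan \<and> \<tau> \<in> P1_fan}"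

definition P2_fan :: "(real \<times> real) set set" where
  "P2_fan = {convex_cone hull S | S. S \<subset> {(1, 0), (0, 1), (-1, -1)}}"

definition is_P2 :: "'a::euclidean_space set \<Rightarrow> 'a set set \<Rightarrow> bool" where
  "is_P2 N \<Sigma> \<longleftrightarrow> toric_isomorphic N \<Sigma> (\<int> \<times> \<int>) P2_fan"

definition is_Bl3_P2 :: "'a::euclidean_space set \<Rightarrow> 'a set set \<Rightarrow> bool" where
  "is_Bl3_P2 N \<Sigma> \<longleftrightarrow>
     (\<exists>\<Sigma>'. is_P2 N \<Sigma>' \<and> toric_blow_up N \<Sigma>' (torus_fixed_points N \<Sigma>') \<Sigma>)"

end

theory Submission
  imports Defs
begin

text \<open>
  A complete smooth fan in the plane is encoded by its finite set \<open>E\<close> of maximal cones, each given by the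
  lattice basis spanning it.  Every ray generator \<open>u\<close> has exactly two neighbours \<open>v\<close>, \<open>v'\<close> and
  \<open>v + v' = a u\<close> for an integer \<open>a\<close>.  If \<open>u\<close> is a longest ray generator, strict convexity of the norm
  forces \<open>a\<close> to be \<open>1\<close>, \<open>0\<close> or \<open>-1\<close>.  For \<open>a = 1\<close> the ray can be contracted, together with its orbit under
  the group as long as no two rays of the orbit are adjacent; the symmetry excludes the other
  possibilities or forces the fan to be one of the minimal models, so one concludes by induction on
  the number of rays.

  That contracting rays is inverse to a blow-up of points is checked in the affine charts, where the
  blow-down map is \<open>(a, b) \<mapsto> (ab, b)\<close>.
\<close>

section \<open>Cones over subsets of a lattice basis\<close>

text \<open>The norm is that of the ambient Euclidean space and is unrelated to the lattice and to
  the group, so the other rays in the orbit of a longest ray \<open>u\<close> need not be longest.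
  The obstacle is equivariance: adjacent rays cannot be contracted together. If \<open>u\<close> is
  adjacent to some \<open>h u\<close>, invariance of the edges forces its two neighbours to be g u
  and g^-1 u or, in order six, possibly g^2 u and g^4 u, and a = 1 requires their sum to be
  \<open>u\<close>. By the quadratic relation of the generator the sum is 0 in order four, and -u in
  order three and in the second possibility for order six. Only u = g u + g^-1 u in order six is
  consistent, and then the orbit of \<open>u\<close> closes up to a hexagon. In the other cases, -Id
  excludes a = -1, because -v = u + v' would be a ray inside a cone, and turns a = 0 into four
  quadrants; an element of order three excludes a = 0 and turns a = -1 into the triangle u, g u, g^2
  u.\<close>

abbreviation pos :: "'a::real_vector set \<Rightarrow> 'a set" where
  "pos S \<equiv> convex_cone hull S"

text \<open>A lattice basis is carried along with its dual basis. Membership in a cone or in the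
  lattice then becomes a sign or integrality condition on two real numbers, and most planar
  arguments become linear arithmetic.\<close>

definition dual_pair ::
  "'a::euclidean_space set \<Rightarrow> 'a \<Rightarrow> 'a \<Rightarrow> ('a \<Rightarrow> real) \<Rightarrow> ('a \<Rightarrow> real) \<Rightarrow> bool" where
  "dual_pair N u v m n \<longleftrightarrow> linear m \<and> linear n \<and> m u = 1 \<and> m v = 0 \<and> n u = 0 \<and> n v = 1 \<and>
     (\<forall>x. x = m x *\<^sub>R u + n x *\<^sub>R v) \<and> (\<forall>x. x \<in> N \<longleftrightarrow> m x \<in> \<int> \<and> n x \<in> \<int>)"

lemma dual_pairD:
  assumes "dual_pair N u v m n"
  shows "linear m" "linear n" "m u = 1" "m v = 0" "n u = 0" "n v = 1"
    "x = m x *\<^sub>R u + n x *\<^sub>R v" "x \<in> N \<longleftrightarrow> m x \<in> \<int> \<and> n x \<in> \<int>" "u \<noteq> v"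
  using assms unfolding dual_pair_def by blast+ (metis assms dual_pair_def zero_neq_one)

lemma dual_pair_sym: "dual_pair N u v m n \<Longrightarrow> dual_pair N v u n m"
  unfolding dual_pair_def by (metis add.commute)

lemma dual_pair_unique:
  assumes "dual_pair N u v m n" and "x = a *\<^sub>R u + b *\<^sub>R v"
  shows "m x = a" "n x = b"
  using assms(2) dual_pairD(1-6)[OF assms(1)] by (simp_all add: linear_add linear_cmul)

lemma dual_pair_eqI:
  assumes "dual_pair N u v m n" and "m x = m y" "n x = n y"
  shows "x = y"
  using dual_pairD(7)[OF assms(1), of x] dual_pairD(7)[OF assms(1), of y] assms(2,3) by simp

lemma dual_pair_lattice_basis:
  assumes "dual_pair N u v m n"
  shows "lattice_basis N {u, v}"
proof -
  note d = dual_pairD[OF assms]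
  have "independent {u, v}"
    unfolding dependent_finite[OF finite.insertI[OF finite.insertI[OF finite.emptyI]]]
  proof
    assume "\<exists>c. (\<exists>w\<in>{u, v}. c w \<noteq> 0) \<and> (\<Sum>w\<in>{u, v}. c w *\<^sub>R w) = 0"
    then obtain c where c: "c u \<noteq> 0 \<or> c v \<noteq> 0" "(\<Sum>w\<in>{u, v}. c w *\<^sub>R w) = 0" by auto
    hence "0 = c u *\<^sub>R u + c v *\<^sub>R v" using d(9) by simp
    from dual_pair_unique[OF assms this] show False using d(1,2) c(1) by (simp add: linear_0)
  qed
  moreover have "x \<in> span {u, v}" for x
    by (subst d(7)[of x]) (intro span_add span_scale span_base; simp)
  moreover have "N = {x. \<exists>c::'a \<Rightarrow> int. x = (\<Sum>b\<in>{u,v}. of_int (c b) *\<^sub>R b)}"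
  proof (intro equalityI subsetI CollectI)
    fix x assume "x \<in> N"
    then obtain i j where ij: "m x = of_int i" "n x = of_int j" using d(8) by (auto elim!: Ints_cases)
    show "\<exists>c::'a \<Rightarrow> int. x = (\<Sum>b\<in>{u,v}. of_int (c b) *\<^sub>R b)"
      using d(7)[of x] d(9) ij by (intro exI[of _ "\<lambda>b. if b = u then i else j"]) simp
  next
    fix x assume "x \<in> {x. \<exists>c::'a \<Rightarrow> int. x = (\<Sum>b\<in>{u,v}. of_int (c b) *\<^sub>R b)}"
    then obtain c :: "'a \<Rightarrow> int" where "x = of_int (c u) *\<^sub>R u + of_int (c v) *\<^sub>R v" using d(9) by auto
    from dual_pair_unique[OF assms this] show "x \<in> N" using d(8) by simp
  qed
  ultimately show ?thesis unfolding lattice_basis_def by auto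
qed

lemma lattice_basis_dual_pair:
  assumes "lattice_basis N {u, v}" and "u \<noteq> v"
  obtains m n where "dual_pair N u v m n"
proof -
  have i: "independent {u, v}" and s: "span {u, v} = UNIV"
    and N: "N = {x. \<exists>c::'a \<Rightarrow> int. x = (\<Sum>b\<in>{u,v}. of_int (c b) *\<^sub>R b)}"
    using assms(1) unfolding lattice_basis_def by auto
  obtain m :: "'a \<Rightarrow> real" where m: "linear m" "m u = 1" "m v = 0"
    using linear_independent_extend[OF i, of "\<lambda>x. if x = u then 1 else 0"] assms(2) by auto
  obtain n :: "'a \<Rightarrow> real" where n: "linear n" "n u = 0" "n v = 1"
    using linear_independent_extend[OF i, of "\<lambda>x. if x = v then 1 else 0"] assms(2) by auto
  have "linear (\<lambda>x. m x *\<^sub>R u + n x *\<^sub>R v)"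
    using m(1) n(1) by (auto intro!: linearI simp: linear_add linear_cmul algebra_simps)
  hence e: "x = m x *\<^sub>R u + n x *\<^sub>R v" for x
    by (rule linear_eq_on_span[OF linear_ident, of _ "{u, v}"]) (use s m n in auto)
  have "x \<in> N \<longleftrightarrow> m x \<in> \<int> \<and> n x \<in> \<int>" for x
  proof
    assume "x \<in> N"
    then obtain c :: "'a \<Rightarrow> int" where "x = of_int (c u) *\<^sub>R u + of_int (c v) *\<^sub>R v" using N assms(2) by auto
    thus "m x \<in> \<int> \<and> n x \<in> \<int>" using m n by (simp add: linear_add linear_cmul)
  next
    assume "m x \<in> \<int> \<and> n x \<in> \<int>"
    then obtain i j where ij: "m x = of_int i" "n x = of_int j" by (auto elim!: Ints_cases)
    show "x \<in> N" unfolding N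
      using e[of x] assms(2) ij by (intro CollectI exI[of _ "\<lambda>b. if b = u then i else j"]) simp
  qed
  thus thesis using that e m n unfolding dual_pair_def by blast
qed

lemma dual_pair_dual_lattice:
  assumes "dual_pair N u v m n"
  shows "m \<in> dual_lattice N" "n \<in> dual_lattice N" "u \<in> N" "v \<in> N"
  using assms unfolding dual_pair_def dual_lattice_def by auto

lemma card_lattice_basis:
  fixes B :: "'a::euclidean_space set"
  assumes "lattice_basis N B"
  shows "card B = DIM('a)" and "finite B"
  using assms basis_card_eq_dim[of B UNIV] independent_imp_finite[of B]
  unfolding lattice_basis_def by auto

lemma lattice_basis_pair:
  fixes B :: "'a::euclidean_space set"
  assumes "DIM('a) = 2" and "lattice_basis N B"
  obtains u v m n where "B = {u, v}" "dual_pair N u v m n"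
  using card_lattice_basis[OF assms(2)] assms lattice_basis_dual_pair by (metis card_2_iff)

text \<open>The change of basis is triangular with determinant \<open>s\<close>, and s * s = 1 makes
  its inverse integral as well. The instances used are subdivision (s = 1, a = 1), its inverse (s =
  1, a = -1), reflection (s = -1, a = 0) and the third ray of a triangle (s = -1, a = -1).\<close>

lemma dual_pair_change:
  assumes d: "dual_pair N u v m n" and s: "s \<in> {1, -1::real}" and a: "a \<in> \<int>"
  shows "dual_pair N u (a *\<^sub>R u + s *\<^sub>R v) (\<lambda>x. m x - s * a * n x) (\<lambda>x. s * n x)"
proof -
  note D = dual_pairD[OF d]
  have ss: "s * s = 1" using s by auto
  have sZ: "s \<in> \<int>" using s by auto
  have "x = (m x - s * a * n x) *\<^sub>R u + (s * n x) *\<^sub>R (a *\<^sub>R u + s *\<^sub>R v)" for x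
    using D(7)[of x] ss by (simp add: algebra_simps scaleR_left_diff_distrib) (metis mult.assoc mult.commute mult_1)
  moreover have "m x - s * a * n x \<in> \<int> \<and> s * n x \<in> \<int> \<longleftrightarrow> x \<in> N" for x
  proof
    assume h: "m x - s * a * n x \<in> \<int> \<and> s * n x \<in> \<int>"
    hence "s * (s * n x) \<in> \<int>" using sZ by (auto intro: Ints_mult[OF sZ, of "s * n x"])
    hence n: "n x \<in> \<int>" using ss by (metis mult.assoc mult_1)
    have "(m x - s * a * n x) + s * a * n x \<in> \<int>" using h n sZ a by (intro Ints_add Ints_mult) auto
    thus "x \<in> N" using n D(8) by simp
  next
    assume "x \<in> N" thus "m x - s * a * n x \<in> \<int> \<and> s * n x \<in> \<int>" using D(8)[of x] sZ a by auto
  qed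
  moreover have "linear (\<lambda>x. m x - s * a * n x)" "linear (\<lambda>x. s * n x)"
    using D(1,2) by (auto intro!: linearI simp: linear_add linear_cmul algebra_simps)
  moreover have "m (a *\<^sub>R u + s *\<^sub>R v) = a" "n (a *\<^sub>R u + s *\<^sub>R v) = s"
    using dual_pair_unique[OF d refl] by simp_all
  moreover have "a - s * a * s = 0" using ss by (metis diff_self mult.commute mult.assoc mult_1_right)
  ultimately show ?thesis unfolding dual_pair_def using D(3-6) ss by simp
qed

lemma dual_pair_image:
  assumes d: "dual_pair N u v m n" and "linear g" "bij g" "g ` N = N"
  shows "dual_pair N (g u) (g v) (m \<circ> inv_into UNIV g) (n \<circ> inv_into UNIV g)"
proof -
  note D = dual_pairD[OF d]
  have gi: "g (inv_into UNIV g x) = x" "inv_into UNIV g (g x) = x" for x using assms(3) by (auto simp: bij_def surj_f_inv_f)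
  have li: "linear (inv_into UNIV g)"
  proof (rule linearI)
    show "inv_into UNIV g (x + y) = inv_into UNIV g x + inv_into UNIV g y" for x y
      using gi(1)[of x] gi(1)[of y] gi(2)[of "inv_into UNIV g x + inv_into UNIV g y"]
      by (simp add: linear_add[OF assms(2)])
    show "inv_into UNIV g (c *\<^sub>R x) = c *\<^sub>R inv_into UNIV g x" for c x
      using gi(1)[of x] gi(2)[of "c *\<^sub>R inv_into UNIV g x"] by (simp add: linear_cmul[OF assms(2)])
  qed
  have e: "x = m (inv_into UNIV g x) *\<^sub>R g u + n (inv_into UNIV g x) *\<^sub>R g v" for x
    using arg_cong[OF D(7)[of "inv_into UNIV g x"], of g] assms(2) gi(1)[of x]
    by (simp add: linear_add linear_cmul)
  have "x \<in> N \<longleftrightarrow> inv_into UNIV g x \<in> N" for x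
    using gi assms(4) by (metis image_iff)
  hence iN: "x \<in> N \<longleftrightarrow> m (inv_into UNIV g x) \<in> \<int> \<and> n (inv_into UNIV g x) \<in> \<int>" for x
    using D(8) by blast
  have "linear (m \<circ> inv_into UNIV g)" "linear (n \<circ> inv_into UNIV g)"
    using li D(1,2) by (auto intro: linear_compose)
  thus ?thesis unfolding dual_pair_def o_def
    by (intro conjI allI e iN) (simp_all add: gi D(3-6))
qed

section \<open>Cones and their faces in the coordinates of a basis\<close>

lemma pos_dual_pair:
  assumes d: "dual_pair N u v m n" and "S \<subseteq> {u, v}"
  shows "pos S = {x. (if u \<in> S then m x \<ge> 0 else m x = 0) \<and> (if v \<in> S then n x \<ge> 0 else n x = 0)}"
    (is "_ = ?R")
proof
  note D = dual_pairD[OF d]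
  have "convex_cone ?R"
    unfolding convex_cone_iff using D(1,2) by (auto simp: linear_0 linear_add linear_cmul)
  moreover have "S \<subseteq> ?R" using assms(2) D(3-6) by auto
  ultimately show "pos S \<subseteq> ?R" by (intro hull_minimal)
next
  note D = dual_pairD[OF d]
  show "?R \<subseteq> pos S"
  proof
    fix x assume x: "x \<in> ?R"
    have "m x *\<^sub>R u \<in> pos S"
      using x by (cases "u \<in> S") (auto intro: convex_cone_hull_mul hull_inc simp: convex_cone_hull_contains_0)
    moreover have "n x *\<^sub>R v \<in> pos S"
      using x by (cases "v \<in> S") (auto intro: convex_cone_hull_mul hull_inc simp: convex_cone_hull_contains_0)
    ultimately show "x \<in> pos S" by (subst D(7)[of x]) (rule convex_cone_hull_add)
  qed
qed

lemma mem_pos_pair: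
  assumes d: "dual_pair N u v m n"
  shows "x \<in> pos {u, v} \<longleftrightarrow> m x \<ge> 0 \<and> n x \<ge> 0" "x \<in> pos {u} \<longleftrightarrow> m x \<ge> 0 \<and> n x = 0"
    "x \<in> pos {v} \<longleftrightarrow> m x = 0 \<and> n x \<ge> 0"
  using pos_dual_pair[OF d, of "{u, v}"] pos_dual_pair[OF d, of "{u}"] pos_dual_pair[OF d, of "{v}"]
    dual_pairD(9)[OF d] by auto

lemma mem_pos_generator:
  assumes "dual_pair N u v m n" and "S \<subseteq> {u, v}"
  shows "u \<in> pos S \<longleftrightarrow> u \<in> S" "v \<in> pos S \<longleftrightarrow> v \<in> S"
  using pos_dual_pair[OF assms] dual_pairD(1-6)[OF assms(1)] by auto

lemma pos_Int:
  assumes d: "dual_pair N u v m n" and "S \<subseteq> {u, v}" "T \<subseteq> {u, v}"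
  shows "pos S \<inter> pos T = pos (S \<inter> T)"
proof -
  have "S \<inter> T \<subseteq> {u, v}" using assms by auto
  from pos_dual_pair[OF d this] pos_dual_pair[OF d assms(2)] pos_dual_pair[OF d assms(3)]
  show ?thesis by auto
qed

text \<open>Faces in the library are merely convex, so a nonempty one must first be shown to be a
  cone: x is the midpoint of 0 and 2 x, hence both lie in the face, and all positive multiples
  follow. A point with a nonzero coordinate is a sum containing a positive multiple of that
  generator, so the generator lies in the face. Conversely, a convex combination of nonnegative
  coordinates with positive weights vanishes only if both coordinates do.\<close>

lemma pos_face_iff:
  assumes d: "dual_pair N u v m n" and S: "S \<subseteq> {u, v}"
  shows "cone_face \<tau> (pos S) \<longleftrightarrow> (\<exists>T\<subseteq>S. \<tau> = pos T)"
proof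
  note D = dual_pairD[OF d]
  assume "cone_face \<tau> (pos S)"
  hence F: "\<tau> face_of pos S" and ne: "\<tau> \<noteq> {}" unfolding cone_face_def by auto
  have sub: "\<tau> \<subseteq> pos S" using F by (rule face_of_imp_subset)
  have cvx: "convex \<tau>" using F face_of_imp_convex by blast
  have seg: "a \<in> \<tau> \<and> b \<in> \<tau>" if "a \<in> pos S" "b \<in> pos S" "(1/2) *\<^sub>R a + (1/2) *\<^sub>R b \<in> \<tau>" for a b
  proof (cases "a = b")
    case True thus ?thesis using that(3) by (simp flip: scaleR_left_distrib)
  next
    case False
    hence "(1/2) *\<^sub>R a + (1/2) *\<^sub>R b \<in> open_segment a b" unfolding in_segment by (auto intro!: exI[of _ "1/2"])
    thus ?thesis using F that unfolding face_of_def by blast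
  qed
  have dbl: "2 *\<^sub>R x \<in> \<tau> \<and> 0 \<in> \<tau>" if "x \<in> \<tau>" for x
    using seg[of "2 *\<^sub>R x" 0] that sub by (auto simp: convex_cone_hull_mul convex_cone_hull_contains_0)
  have z: "0 \<in> \<tau>" using ne dbl by auto
  have pw: "(2^k) *\<^sub>R x \<in> \<tau>" if "x \<in> \<tau>" for x and k :: nat
  proof (induction k)
    case (Suc k) thus ?case using dbl[of "2^k *\<^sub>R x"] by simp
  qed (use that in simp)
  \<comment> \<open>Repeated doubling passes beyond \<open>w\<close> on its ray, and convexity with
    0 comes back to it.\<close>
  have scal: "w \<in> \<tau>" if "c *\<^sub>R w \<in> \<tau>" "c > 0" for c w
  proof -
    obtain k :: nat where k: "1 / c < 2 ^ k" using real_arch_pow[of 2 "1/c"] by auto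
    hence g: "1 < 2 ^ k * c" using that(2) by (simp add: field_simps)
    have "(2^k * c) *\<^sub>R w \<in> \<tau>" using pw[OF that(1), of k] by simp
    hence "(1 - 1 / (2^k * c)) *\<^sub>R 0 + (1 / (2^k * c)) *\<^sub>R ((2^k * c) *\<^sub>R w) \<in> \<tau>"
      using g by (intro convexD[OF cvx z]) auto
    thus "w \<in> \<tau>" using that(2) by simp
  qed
  have spl: "w \<in> \<tau>" if "x \<in> \<tau>" "x = c *\<^sub>R w + y" "c > 0" "w \<in> pos S" "y \<in> pos S" for x w y c
  proof -
    have "(2 * c) *\<^sub>R w \<in> \<tau>"
      using seg[of "(2 * c) *\<^sub>R w" "2 *\<^sub>R y"] that by (auto simp: convex_cone_hull_mul)
    thus "w \<in> \<tau>" using scal that(3) by force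
  qed
  have "\<tau> = pos (S \<inter> \<tau>)"
  proof
    have ST: "S \<inter> \<tau> \<subseteq> {u, v}" using S by auto
    show "\<tau> \<subseteq> pos (S \<inter> \<tau>)"
    proof
      fix x assume x: "x \<in> \<tau>"
      hence xs: "x \<in> pos S" using sub by auto
      have "u \<in> \<tau>" if "m x \<noteq> 0"
      proof (rule spl[OF x D(7)])
        show "0 < m x" "u \<in> pos S" "n x *\<^sub>R v \<in> pos S"
          using xs that unfolding pos_dual_pair[OF d S] using D(1-6) by (auto simp: linear_cmul linear_0 split: if_splits)
      qed
      moreover have "v \<in> \<tau>" if "n x \<noteq> 0"
      proof (rule spl[OF x])
        show "x = n x *\<^sub>R v + m x *\<^sub>R u" using D(7)[of x] by (simp add: add.commute)
        show "0 < n x" "v \<in> pos S" "m x *\<^sub>R u \<in> pos S"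
          using xs that unfolding pos_dual_pair[OF d S] using D(1-6) by (auto simp: linear_cmul linear_0 split: if_splits)
      qed
      ultimately show "x \<in> pos (S \<inter> \<tau>)"
        using xs unfolding pos_dual_pair[OF d S] pos_dual_pair[OF d ST] by (auto split: if_splits)
    qed
    have "convex_cone \<tau>"
    proof -
      have sc: "c *\<^sub>R x \<in> \<tau>" if "x \<in> \<tau>" "0 \<le> c" for c x
      proof (cases "c = 0")
        case False
        thus ?thesis using scal[of "1 / c" "c *\<^sub>R x"] that by simp
      qed (use z in simp)
      have "x + y \<in> \<tau>" if "x \<in> \<tau>" "y \<in> \<tau>" for x y
        using convexD[OF cvx sc[OF that(1), of 2] sc[OF that(2), of 2], of "1/2" "1/2"] by simp
      thus ?thesis unfolding convex_cone_iff using z sc by auto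
    qed
    thus "pos (S \<inter> \<tau>) \<subseteq> \<tau>" by (intro hull_minimal) auto
  qed
  thus "\<exists>T\<subseteq>S. \<tau> = pos T" by blast
next
  note D = dual_pairD[OF d]
  assume "\<exists>T\<subseteq>S. \<tau> = pos T"
  then obtain T where T: "T \<subseteq> S" "\<tau> = pos T" by auto
  have T2: "T \<subseteq> {u, v}" using T S by auto
  have aux: "a = 0 \<and> b = 0" if "(1 - t) * a + t * b = 0" "0 < t" "t < 1" "a \<ge> 0" "b \<ge> 0" for a b t :: real
  proof -
    have "(1 - t) * a \<ge> 0" "t * b \<ge> 0" using that by auto
    hence "(1 - t) * a = 0" "t * b = 0" using that(1) by linarith+
    thus ?thesis using that by simp
  qed
  have "pos T face_of pos S"
    unfolding face_of_def
  proof (intro conjI ballI impI)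
    show "pos T \<subseteq> pos S" using T(1) by (rule hull_mono)
    show "convex (pos T)" by (rule convex_convex_cone_hull)
    fix a b x assume ab: "a \<in> pos S" "b \<in> pos S" "x \<in> pos T" "x \<in> open_segment a b"
    then obtain t where t: "0 < t" "t < 1" "x = (1 - t) *\<^sub>R a + t *\<^sub>R b" by (auto simp: in_segment)
    have l: "m x = (1 - t) * m a + t * m b" "n x = (1 - t) * n a + t * n b"
      using t(3) D(1,2) by (simp_all add: linear_add linear_cmul)
    have ge: "m a \<ge> 0" "m b \<ge> 0" "n a \<ge> 0" "n b \<ge> 0"
      using ab(1,2) unfolding pos_dual_pair[OF d S] by (auto split: if_splits)
    have "m a = 0 \<and> m b = 0" if "u \<notin> T"
      using aux[of t "m a" "m b"] l(1) t ge ab(3) that unfolding pos_dual_pair[OF d T2] by auto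
    moreover have "n a = 0 \<and> n b = 0" if "v \<notin> T"
      using aux[of t "n a" "n b"] l(2) t ge ab(3) that unfolding pos_dual_pair[OF d T2] by auto
    ultimately show "a \<in> pos T" "b \<in> pos T"
      unfolding pos_dual_pair[OF d T2] using ge by auto
  qed
  thus "cone_face \<tau> (pos S)" unfolding cone_face_def T(2) using convex_cone_hull_nonempty by blast
qed

text \<open>A cone determines its primitive generators. Expanding a generator \<open>u\<close> in
  the second basis and applying \<open>m\<close> writes 1 as a sum of two integer products. One of
  them exceeds 1/2, and since the other is nonnegative on the common cone, its two factors are
  nonnegative integers with product 1. This identifies \<open>u\<close> with a vector of the second
  basis.\<close>

lemma pos_eq_imp_eq:
  assumes d: "dual_pair N u v m n" and d': "dual_pair N u' v' m' n'"
    and S: "S \<subseteq> {u, v}" and T: "T \<subseteq> {u', v'}" and eq: "pos S = pos T"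
  shows "S = T"
proof -
  have nat1: "x = 1 \<and> y = 1" if "x \<in> \<int>" "y \<in> \<int>" "x \<ge> 0" "y \<ge> 0" "x * y > 1/2" "x * y \<le> 1" for x y :: real
  proof -
    note xy = that
    obtain i j where ij: "x = of_int i" "y = of_int j" using xy(1,2) by (auto elim!: Ints_cases)
    have "real_of_int (i * j) \<le> 1" "real_of_int (i * j) > 0" using xy(5,6) unfolding ij by auto
    hence "i * j = 1" by linarith
    moreover have "i \<ge> 0" "j \<ge> 0" using xy ij by auto
    ultimately have "i = 1 \<and> j = 1" using zmult_eq_1_iff[of i j] by auto
    thus ?thesis using ij by simp
  qed
  have main: "u \<in> T" if u: "u \<in> S" and d: "dual_pair N u v m n" and d': "dual_pair N u' v' m' n'"
    and S: "S \<subseteq> {u, v}" and T: "T \<subseteq> {u', v'}" and eq: "pos S = pos T"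
  for u v m n u' v' m' n' S T
  proof -
    note D = dual_pairD[OF d] and D' = dual_pairD[OF d']
    \<comment> \<open>The second basis is called \<open>p\<close>, \<open>q\<close> here, so that
      the claim applies to both orders of \<open>u'\<close>, \<open>v'\<close>.\<close>
    have *: "p = u \<and> p \<in> T"
      if p: "dual_pair N p q i j" and T: "T \<subseteq> {p, q}" and gt: "i u * m p > 1/2" for p q i j
    proof -
      note P = dual_pairD[OF p]
      have uT: "u \<in> pos T" using eq u by (metis hull_inc)
      have i: "i u \<ge> 0" "i u \<in> \<int>" "j u \<ge> 0" using uT P(8)[of u] dual_pair_dual_lattice[OF d]
        unfolding pos_dual_pair[OF p T] by (auto split: if_splits)
      have "i u \<noteq> 0" using gt by auto
      hence pT: "p \<in> T" using uT unfolding pos_dual_pair[OF p T] by (auto split: if_splits)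
      hence "p \<in> pos S" using eq by (metis hull_inc)
      hence mp: "m p \<ge> 0" "m p \<in> \<int>" "n p \<ge> 0" using D(8)[of p] dual_pair_dual_lattice[OF p]
        unfolding pos_dual_pair[OF d S] by (auto split: if_splits)
      have rest: "q \<in> pos S" if "j u \<noteq> 0"
      proof -
        have "q \<in> T" using that uT unfolding pos_dual_pair[OF p T] by (auto split: if_splits)
        thus ?thesis using eq by (metis hull_inc)
      qed
      hence q: "j u * m q \<ge> 0" "j u * n q \<ge> 0"
        using i(3) unfolding pos_dual_pair[OF d S] by (cases "j u = 0"; simp split: if_splits)+
      have e: "1 = i u * m p + j u * m q" "0 = i u * n p + j u * n q"
        using D(1-5) arg_cong[OF P(7)[of u], of m] arg_cong[OF P(7)[of u], of n]
      by (simp_all add: linear_add linear_cmul)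
      have "i u = 1 \<and> m p = 1" using nat1[of "i u" "m p"] i mp gt q e by auto
      moreover from this have "n p = 0" using e(2) q mp by simp
      ultimately have "p = u" using D(7)[of p] by simp
      thus ?thesis using pT by simp
    qed
    have "1 = m' u * m u' + n' u * m v'"
      using D(1,3) arg_cong[OF D'(7)[of u], of m] by (simp add: linear_add linear_cmul)
    \<comment> \<open>Equality at 1/2 is excluded next, because the products are integers.\<close>
    hence "m' u * m u' > 1/2 \<or> n' u * m v' > 1/2 \<or> (m' u * m u' = 1/2 \<and> n' u * m v' = 1/2)" by linarith
    moreover have "\<not> (m' u * m u' = 1/2)"
    proof
      assume h: "m' u * m u' = 1/2"
      have "m' u * m u' \<in> \<int>"
        using D'(8)[of u] D(8)[of u'] dual_pair_dual_lattice[OF d] dual_pair_dual_lattice[OF d'] by auto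
      then obtain k :: int where "1 / 2 = (of_int k :: real)" unfolding h by (auto elim: Ints_cases)
      hence "1 = 2 * k" by linarith
      thus False by presburger
    qed
    moreover have "T \<subseteq> {v', u'}" using T by auto
    ultimately show ?thesis using *[OF d' T] *[OF dual_pair_sym[OF d']] by blast
  qed
  have S': "S \<subseteq> {v, u}" and T': "T \<subseteq> {v', u'}" using S T by auto
  show ?thesis
  proof (intro equalityI subsetI)
    fix x assume x: "x \<in> S"
    show "x \<in> T"
      using main[OF _ d d' S T eq] main[OF _ dual_pair_sym[OF d] d' S' T eq] x S by blast
  next
    fix x assume x: "x \<in> T"
    show "x \<in> S"
      using main[OF _ d' d T S eq[symmetric]] main[OF _ dual_pair_sym[OF d'] d T' S eq[symmetric]] x T
      by blast
  qed
qed

section \<open>Complete smooth fans as sets of lattice bases\<close>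

definition maximal_bases :: "'a::euclidean_space set \<Rightarrow> 'a set set \<Rightarrow> 'a set set" where
  "maximal_bases N \<Sigma> = {e. lattice_basis N e \<and> pos e \<in> \<Sigma>}"

text \<open>Only the two-dimensional cones are recorded. Demanding the intersection property of them
  is enough for all their faces, see \<open>complete_bases_pos_Int\<close>.\<close>

definition complete_bases :: "'a::euclidean_space set \<Rightarrow> 'a set set \<Rightarrow> bool" where
  "complete_bases N E \<longleftrightarrow> finite E \<and> (\<forall>e\<in>E. lattice_basis N e) \<and>
     (\<forall>e\<in>E. \<forall>f\<in>E. pos e \<inter> pos f = pos (e \<inter> f)) \<and> (\<Union>e\<in>E. pos e) = UNIV"

definition fan_of :: "'a::euclidean_space set set \<Rightarrow> 'a set set" where
  "fan_of E = {pos S | S e. e \<in> E \<and> S \<subseteq> e}"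

lemma fan_ofI: "e \<in> E \<Longrightarrow> S \<subseteq> e \<Longrightarrow> pos S \<in> fan_of E"
  unfolding fan_of_def by blast

lemma fan_ofE:
  assumes "\<sigma> \<in> fan_of E"
  obtains e S where "e \<in> E" "S \<subseteq> e" "\<sigma> = pos S"
  using assms unfolding fan_of_def by blast

locale lattice_plane =
  fixes N :: "'a::euclidean_space set"
  assumes dim2: "DIM('a) = 2"
begin

lemma lattice_basis_pos_face_iff:
  assumes "lattice_basis N B" "S \<subseteq> B"
  shows "cone_face \<tau> (pos S) \<longleftrightarrow> (\<exists>T\<subseteq>S. \<tau> = pos T)"
proof -
  obtain u v m n where B: "B = {u, v}" and d: "dual_pair N u v m n"
    using lattice_basis_pair[OF dim2 assms(1)] .
  show ?thesis by (rule pos_face_iff[OF d assms(2)[unfolded B]])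
qed

lemma lattice_basis_pos_inj:
  assumes "lattice_basis N B" "S \<subseteq> B" "lattice_basis N B'" "T \<subseteq> B'" "pos S = pos T"
  shows "S = T"
proof -
  obtain u v m n where B: "B = {u, v}" and d: "dual_pair N u v m n"
    using lattice_basis_pair[OF dim2 assms(1)] .
  obtain u' v' m' n' where B': "B' = {u', v'}" and d': "dual_pair N u' v' m' n'"
    using lattice_basis_pair[OF dim2 assms(3)] .
  show ?thesis by (rule pos_eq_imp_eq[OF d d' assms(2)[unfolded B] assms(4)[unfolded B'] assms(5)])
qed

lemma lattice_basis_mem_pos:
  assumes "lattice_basis N B" "S \<subseteq> B" "u \<in> B"
  shows "u \<in> pos S \<longleftrightarrow> u \<in> S"
proof -
  obtain u v m n where B: "B = {u, v}" and d: "dual_pair N u v m n"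
    using lattice_basis_pair[OF dim2 assms(1)] .
  show ?thesis using mem_pos_generator[OF d assms(2)[unfolded B]] assms(3) B by auto
qed

lemma lattice_basis_pos_Int:
  assumes "lattice_basis N B" "S \<subseteq> B" "T \<subseteq> B"
  shows "pos S \<inter> pos T = pos (S \<inter> T)"
proof -
  obtain u v m n where B: "B = {u, v}" and d: "dual_pair N u v m n"
    using lattice_basis_pair[OF dim2 assms(1)] .
  show ?thesis by (rule pos_Int[OF d assms(2,3)[unfolded B]])
qed

lemma lattice_basis_subset_eq:
  assumes "lattice_basis N B" "lattice_basis N B'" "B \<subseteq> B'"
  shows "B = B'"
  using card_lattice_basis[OF assms(1)] card_lattice_basis[OF assms(2)] assms(3) card_subset_eq by metis

lemma lattice_basis_rational_cone:
  assumes "lattice_basis N B" "S \<subseteq> B"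
  shows "rational_cone N (pos S)"
proof -
  obtain u v m n where B: "B = {u, v}" and d: "dual_pair N u v m n"
    using lattice_basis_pair[OF dim2 assms(1)] .
  have "S \<subseteq> N" "finite S"
    using dual_pair_dual_lattice[OF d] B assms(2) finite_subset[of S "{u, v}"] by auto
  moreover have "x = 0" if "x \<in> pos S" "- x \<in> pos S" for x
  proof (rule dual_pair_eqI[OF d])
    show "m x = m 0" "n x = n 0"
      using that dual_pairD(1,2)[OF d] assms(2) unfolding B
      by (auto simp: pos_dual_pair[OF d] linear_neg linear_0 split: if_splits)
  qed
  ultimately show ?thesis unfolding rational_cone_def
    by (auto simp: convex_cone_hull_contains_0 intro!: image_eqI[of 0 uminus 0])
qed

lemma complete_basesD:
  assumes "complete_bases N E"
  shows "finite E" "e \<in> E \<Longrightarrow> lattice_basis N e"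
    "e \<in> E \<Longrightarrow> f \<in> E \<Longrightarrow> pos e \<inter> pos f = pos (e \<inter> f)" "\<exists>e\<in>E. x \<in> pos e"
  using assms unfolding complete_bases_def by auto

text \<open>A common point already lies in the common face of the two maximal cones. Inside one
  basis, intersecting cones is intersecting their generating sets.\<close>

lemma complete_bases_pos_Int:
  assumes "complete_bases N E" "e \<in> E" "f \<in> E" "S \<subseteq> e" "T \<subseteq> f"
  shows "pos S \<inter> pos T = pos (S \<inter> T)"
proof
  note E = complete_basesD[OF assms(1)]
  show "pos (S \<inter> T) \<subseteq> pos S \<inter> pos T" by (simp add: hull_mono)
  show "pos S \<inter> pos T \<subseteq> pos (S \<inter> T)"
  proof
    fix x assume x: "x \<in> pos S \<inter> pos T"
    have "pos S \<subseteq> pos e" "pos T \<subseteq> pos f" using assms(4,5) by (auto intro!: hull_mono)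
    hence ef: "x \<in> pos (e \<inter> f)" using x E(3)[OF assms(2,3)] by blast
    have "x \<in> pos (S \<inter> (e \<inter> f))" "x \<in> pos (T \<inter> (e \<inter> f))"
      using lattice_basis_pos_Int[OF E(2)[OF assms(2)] assms(4), of "e \<inter> f"]
        lattice_basis_pos_Int[OF E(2)[OF assms(3)] assms(5), of "e \<inter> f"] x ef by auto
    moreover have "S \<inter> (e \<inter> f) \<inter> (T \<inter> (e \<inter> f)) = S \<inter> T" using assms(4,5) by auto
    ultimately show "x \<in> pos (S \<inter> T)"
      using lattice_basis_pos_Int[OF E(2)[OF assms(2)], of "S \<inter> (e \<inter> f)" "T \<inter> (e \<inter> f)"] by auto
  qed
qed

lemma complete_smooth_fan_fan_of:
  assumes "complete_bases N E"
  shows "complete_smooth_fan N (fan_of E)"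
proof -
  note E = complete_basesD[OF assms]
  have "fan_of E = (\<Union>e\<in>E. (\<lambda>S. pos S) ` Pow e)" unfolding fan_of_def by auto
  hence fin: "finite (fan_of E)" using E(1) card_lattice_basis(2)[OF E(2)] by auto
  have "fan N (fan_of E)"
    unfolding fan_def
  proof (intro conjI ballI allI impI fin)
    fix \<sigma> assume "\<sigma> \<in> fan_of E"
    then obtain e S where \<sigma>: "e \<in> E" "S \<subseteq> e" "\<sigma> = pos S" by (rule fan_ofE)
    note face = lattice_basis_pos_face_iff[OF E(2)[OF \<sigma>(1)] \<sigma>(2)]
    show "rational_cone N \<sigma>" using lattice_basis_rational_cone[OF E(2)] \<sigma> by auto
    show "\<tau> \<in> fan_of E" if c: "cone_face \<tau> \<sigma>" for \<tau>
    proof -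
      obtain T where "T \<subseteq> S" "\<tau> = pos T" using c face \<sigma>(3) by auto
      thus ?thesis using fan_ofI[OF \<sigma>(1), of T] \<sigma>(2) by auto
    qed
    fix \<tau> assume "\<tau> \<in> fan_of E"
    then obtain f T where \<tau>: "f \<in> E" "T \<subseteq> f" "\<tau> = pos T" by (rule fan_ofE)
    have "\<sigma> \<inter> \<tau> = pos (S \<inter> T)"
      using complete_bases_pos_Int[OF assms \<sigma>(1) \<tau>(1) \<sigma>(2) \<tau>(2)] \<sigma>(3) \<tau>(3) by simp
    thus "cone_face (\<sigma> \<inter> \<tau>) \<sigma>" "cone_face (\<sigma> \<inter> \<tau>) \<tau>"
      using face lattice_basis_pos_face_iff[OF E(2)[OF \<tau>(1)] \<tau>(2)] \<sigma>(3) \<tau>(3) by auto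
  qed
  moreover have "\<exists>B S. lattice_basis N B \<and> S \<subseteq> B \<and> \<sigma> = pos S" if "\<sigma> \<in> fan_of E" for \<sigma>
    using fan_ofE[OF that] E(2) by metis
  moreover have "\<Union>(fan_of E) = UNIV"
    using E(4) fan_ofI[OF _ subset_refl] by blast
  ultimately show ?thesis unfolding complete_smooth_fan_def smooth_fan_def by blast
qed

text \<open>The encoding loses nothing, because a cone determines the part of a basis that spans
  it.\<close>

lemma maximal_bases_fan_of:
  assumes "complete_bases N E"
  shows "maximal_bases N (fan_of E) = E"
proof
  note E = complete_basesD[OF assms]
  show "E \<subseteq> maximal_bases N (fan_of E)" unfolding maximal_bases_def fan_of_def using E(2) by auto
  show "maximal_bases N (fan_of E) \<subseteq> E"
  proof
    fix e assume "e \<in> maximal_bases N (fan_of E)"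
    then obtain f S where f: "lattice_basis N e" "f \<in> E" "S \<subseteq> f" "pos e = pos S"
      unfolding maximal_bases_def by (auto elim: fan_ofE)
    hence "e = S" using lattice_basis_pos_inj[OF f(1) subset_refl E(2)[OF f(2)]] by auto
    thus "e \<in> E" using lattice_basis_subset_eq[OF f(1) E(2)] f by auto
  qed
qed

text \<open>Completeness concerns all cones, but the two-dimensional ones alone must be shown to
  cover the plane. Their union is closed, and its complement is covered by finitely many
  lower-dimensional cones. So the complement is open and negligible, hence empty.\<close>

lemma complete_bases_maximal_bases:
  assumes "complete_smooth_fan N \<Sigma>"
  shows "complete_bases N (maximal_bases N \<Sigma>)" and "fan_of (maximal_bases N \<Sigma>) = \<Sigma>"
proof -
  define E where "E = maximal_bases N \<Sigma>"
  have fin\<Sigma>: "finite \<Sigma>" and face: "\<And>\<sigma> \<tau>. \<sigma> \<in> \<Sigma> \<Longrightarrow> cone_face \<tau> \<sigma> \<Longrightarrow> \<tau> \<in> \<Sigma>"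
    and int: "\<And>\<sigma> \<tau>. \<sigma> \<in> \<Sigma> \<Longrightarrow> \<tau> \<in> \<Sigma> \<Longrightarrow> cone_face (\<sigma> \<inter> \<tau>) \<sigma> \<and> cone_face (\<sigma> \<inter> \<tau>) \<tau>"
    and sm: "\<And>\<sigma>. \<sigma> \<in> \<Sigma> \<Longrightarrow> \<exists>B S. lattice_basis N B \<and> S \<subseteq> B \<and> \<sigma> = pos S"
    and cov: "\<Union>\<Sigma> = UNIV"
    using assms unfolding complete_smooth_fan_def smooth_fan_def fan_def by blast+
  have lb: "lattice_basis N e" and e\<Sigma>: "pos e \<in> \<Sigma>" if "e \<in> E" for e
    using that unfolding E_def maximal_bases_def by auto
  have "inj_on (\<lambda>e. pos e) E" using lattice_basis_pos_inj lb by (intro inj_onI) blast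
  moreover have "(\<lambda>e. pos e) ` E \<subseteq> \<Sigma>" using e\<Sigma> by auto
  ultimately have finE: "finite E" using fin\<Sigma> inj_on_finite by blast
  define F where "F = (\<Union>e\<in>E. pos e)"
  have "closed F" unfolding F_def
    using finE lb card_lattice_basis(2) closed_convex_cone_hull by (intro closed_UN) auto
  hence "open (- F)" by auto
  moreover have "negligible (- F)"
  proof (rule negligible_subset)
    show "negligible (\<Union>{\<sigma> \<in> \<Sigma>. dim \<sigma> < DIM('a)})"
      using fin\<Sigma> by (intro negligible_Union) (auto intro: negligible_lowdim)
    show "- F \<subseteq> \<Union>{\<sigma> \<in> \<Sigma>. dim \<sigma> < DIM('a)}"
    proof
      fix x assume x: "x \<in> - F"
      obtain \<sigma> where \<sigma>: "\<sigma> \<in> \<Sigma>" "x \<in> \<sigma>" using cov by blast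
      obtain B S where B: "lattice_basis N B" "S \<subseteq> B" "\<sigma> = pos S" using sm[OF \<sigma>(1)] by blast
      have "S \<noteq> B" using x \<sigma> B unfolding F_def E_def maximal_bases_def by auto
      hence "card S < card B" using B(2) card_lattice_basis(2)[OF B(1)] psubset_card_mono by blast
      moreover have "finite S" using B(2) card_lattice_basis(2)[OF B(1)] finite_subset by blast
      moreover have "pos S \<subseteq> span S" by (simp add: convex_cone_span hull_minimal span_superset)
      ultimately have "dim \<sigma> < DIM('a)"
        using dim_le_card[of "pos S" S] card_lattice_basis(1)[OF B(1)] B(3) by simp
      thus "x \<in> \<Union>{\<sigma> \<in> \<Sigma>. dim \<sigma> < DIM('a)}" using \<sigma> by blast
    qed
  qed
  ultimately have FU: "F = UNIV" using open_not_negligible by blast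
  have pInt: "pos e \<inter> pos f = pos (e \<inter> f)" if ef: "e \<in> E" "f \<in> E" for e f
  proof
    show "pos (e \<inter> f) \<subseteq> pos e \<inter> pos f" by (simp add: hull_mono)
    have "cone_face (pos e \<inter> pos f) (pos e)" "cone_face (pos e \<inter> pos f) (pos f)"
      using int[OF e\<Sigma> e\<Sigma>] ef by auto
    then obtain S T where ST: "S \<subseteq> e" "pos e \<inter> pos f = pos S" "T \<subseteq> f" "pos e \<inter> pos f = pos T"
      unfolding lattice_basis_pos_face_iff[OF lb[OF ef(1)] subset_refl]
        lattice_basis_pos_face_iff[OF lb[OF ef(2)] subset_refl] by auto
    have "S = T" by (rule lattice_basis_pos_inj[OF lb[OF ef(1)] ST(1) lb[OF ef(2)] ST(3)]) (use ST in simp)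
    hence "S \<subseteq> e \<inter> f" using ST by simp
    thus "pos e \<inter> pos f \<subseteq> pos (e \<inter> f)" unfolding ST(2) by (rule hull_mono)
  qed
  have "complete_bases N E" unfolding complete_bases_def using finE lb pInt FU F_def by blast
  thus "complete_bases N (maximal_bases N \<Sigma>)" unfolding E_def .
  have "fan_of E = \<Sigma>"
  proof
    show "fan_of E \<subseteq> \<Sigma>"
    proof
      fix \<sigma> assume "\<sigma> \<in> fan_of E"
      then obtain e S where e: "e \<in> E" "S \<subseteq> e" "\<sigma> = pos S" by (rule fan_ofE)
      hence "cone_face \<sigma> (pos e)" using lattice_basis_pos_face_iff[OF lb[OF e(1)] subset_refl] by auto
      thus "\<sigma> \<in> \<Sigma>" using face[OF e\<Sigma>[OF e(1)]] by simp
    qed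
    show "\<Sigma> \<subseteq> fan_of E"
    proof
      fix \<sigma> assume s: "\<sigma> \<in> \<Sigma>"
      obtain B S where B: "lattice_basis N B" "S \<subseteq> B" "\<sigma> = pos S" using sm[OF s] by blast
      \<comment> \<open>A point in the relative interior of the cone: the face of
        \<open>\<sigma>\<close> cut out by a maximal cone containing \<open>x\<close> must be all of
        \<open>\<sigma>\<close>.\<close>
      define x where "x = \<Sum>S"
      obtain e where e: "e \<in> E" "x \<in> pos e" using FU unfolding F_def by blast
      obtain u v m n where uv: "B = {u, v}" and d: "dual_pair N u v m n"
        using lattice_basis_pair[OF dim2 B(1)] .
      have S: "S = {} \<or> S = {u} \<or> S = {v} \<or> S = {u, v}" using B(2) uv by auto
      have S2: "S \<subseteq> {u, v}" using B(2) uv by simp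
      have mx: "m x = (if u \<in> S then 1 else 0)" "n x = (if v \<in> S then 1 else 0)"
        using S dual_pairD(1-6,9)[OF d] unfolding x_def by (auto simp: linear_add linear_0)
      hence x\<sigma>: "x \<in> pos S" unfolding pos_dual_pair[OF d S2] by simp
      have "cone_face (\<sigma> \<inter> pos e) \<sigma>" and fe: "cone_face (\<sigma> \<inter> pos e) (pos e)" using int[OF s e\<Sigma>[OF e(1)]] by simp_all
      then obtain T where T: "T \<subseteq> S" "\<sigma> \<inter> pos e = pos T"
        using lattice_basis_pos_face_iff[OF B(1,2)] B(3) by auto
      have "x \<in> pos T" using T(2) x\<sigma> e(2) B(3) by auto
      hence "(u \<in> S \<longrightarrow> u \<in> T) \<and> (v \<in> S \<longrightarrow> v \<in> T)"
        unfolding pos_dual_pair[OF d subset_trans[OF T(1) S2]] using mx by (simp split: if_splits)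
      hence "S = T" using T(1) S2 by blast
      hence "cone_face \<sigma> (pos e)" using fe T B(3) by simp
      thus "\<sigma> \<in> fan_of E"
        using fan_ofI[OF e(1)] lattice_basis_pos_face_iff[OF lb[OF e(1)] subset_refl] by auto
    qed
  qed
  thus "fan_of (maximal_bases N \<Sigma>) = \<Sigma>" unfolding E_def .
qed

end

section \<open>Neighbouring rays and contraction of rays\<close>

text \<open>Geometrically, the torus-invariant curve of the ray \<open>d\<close> has
  self-intersection -1.\<close>

definition blow_down_pair :: "'a::euclidean_space set set \<Rightarrow> 'a \<Rightarrow> 'a \<Rightarrow> 'a \<Rightarrow> bool" where
  "blow_down_pair E d v v' \<longleftrightarrow> {d, v} \<in> E \<and> {d, v'} \<in> E \<and> d = v + v' \<and>
     (\<forall>w. {d, w} \<in> E \<longrightarrow> w = v \<or> w = v')"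

text \<open>The neighbours must stay outside \<open>D\<close>: the exceptional curves are then
  disjoint, and the merged cones do not interfere with each other.\<close>

definition contractible_rays :: "'a::euclidean_space set set \<Rightarrow> 'a set \<Rightarrow> bool" where
  "contractible_rays E D \<longleftrightarrow> (\<forall>d\<in>D. \<exists>v v'. blow_down_pair E d v v' \<and> v \<notin> D \<and> v' \<notin> D)"

definition contracted :: "'a::euclidean_space set set \<Rightarrow> 'a set \<Rightarrow> 'a set set" where
  "contracted E D = {e \<in> E. e \<inter> D = {}} \<union> {{v, v'} | d v v'. d \<in> D \<and> blow_down_pair E d v v'}"

context lattice_plane
begin

lemma complete_bases_dual_pair:
  assumes "complete_bases N E" "{u, v} \<in> E"
  obtains m n where "dual_pair N u v m n"
proof -
  note lb = complete_basesD(2)[OF assms]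
  have "u \<noteq> v" using card_lattice_basis[OF lb] dim2 by auto
  thus thesis using lattice_basis_dual_pair[OF lb] that by blast
qed

lemma complete_bases_edge:
  assumes "complete_bases N E" "e \<in> E" "u \<in> e"
  obtains v where "e = {u, v}" "u \<noteq> v"
  using lattice_basis_pair[OF dim2 complete_basesD(2)[OF assms(1,2)]] dual_pairD(9) assms(3)
  by (metis insertE insert_commute singletonD)

text \<open>The intersection property puts \<open>u\<close> into the cone over the common
  generators, and a basis vector lies in a face only if it is one of its generators. Later
  contradictions arise by exhibiting a ray inside a cone that it does not generate.\<close>

lemma ray_mem_pos:
  assumes "complete_bases N E" "e \<in> E" "u \<in> \<Union>E" "u \<in> pos e"
  shows "u \<in> e"
proof -
  note E = complete_basesD[OF assms(1)]
  obtain f where f: "f \<in> E" "u \<in> f" using assms(3) by blast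
  have "u \<in> pos f" using f(2) by (rule hull_inc)
  hence "u \<in> pos (f \<inter> e)" using E(3)[OF f(1) assms(2)] assms(4) by blast
  thus ?thesis using lattice_basis_mem_pos[OF E(2)[OF f(1)], of "f \<inter> e" u] f(2) by simp
qed

text \<open>Both bases contain \<open>u\<close>, so the change of basis is triangular; its diagonal
  entry and that of its inverse are integers with product 1.\<close>

lemma dual_pair_coordinate_unit:
  assumes d: "dual_pair N u v m n" and d': "dual_pair N u v' m' n'"
  shows "n v' = 1 \<or> n v' = - 1"
proof -
  have "n' v' = n v' * n' v"
    using arg_cong[OF dual_pairD(7)[OF d, of v'], of n'] dual_pairD(2,5)[OF d']
    by (simp add: linear_add linear_cmul)
  hence 1: "n v' * n' v = 1" using dual_pairD(6)[OF d'] by simp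
  have "n v' \<in> \<int>" "n' v \<in> \<int>"
    using dual_pairD(8)[OF d, of v'] dual_pairD(8)[OF d', of v] dual_pair_dual_lattice[OF d]
      dual_pair_dual_lattice[OF d'] by auto
  then obtain i j where ij: "n v' = of_int i" "n' v = of_int j" by (auto elim!: Ints_cases)
  have "i * j = 1" using 1 unfolding ij by (simp flip: of_int_mult)
  thus ?thesis using ij zmult_eq_1_iff[of i j] by auto
qed

text \<open>On the same side of the line through \<open>u\<close>, the vectors \<open>v\<close> and
  \<open>v'\<close> differ by a multiple of \<open>u\<close>. Depending on its sign one of them lies
  in the cone of the other, contrary to the intersection property.\<close>

lemma neighbour_unique:
  assumes E: "complete_bases N E" and e: "{u, v} \<in> E" "{u, v'} \<in> E"
    and d: "dual_pair N u v m n" and gt: "n v' > 0"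
  shows "v' = v"
proof (rule ccontr)
  assume ne: "v' \<noteq> v"
  obtain m' n' where d': "dual_pair N u v' m' n'" using complete_bases_dual_pair[OF E e(2)] .
  note D = dual_pairD[OF d] and D' = dual_pairD[OF d']
  have n1: "n v' = 1" using dual_pair_coordinate_unit[OF d d'] gt by auto
  have "{u, v} \<inter> {u, v'} = {u}" using ne D(9) D'(9) by auto
  hence int: "pos {u, v} \<inter> pos {u, v'} = pos {u}" using complete_basesD(3)[OF E e] by (simp only:)
  have "v' = m v' *\<^sub>R u + v" using D(7)[of v'] n1 by simp
  hence "v = (- m v') *\<^sub>R u + 1 *\<^sub>R v'" by (metis add_diff_cancel_left' scaleR_minus_left scaleR_one uminus_add_conv_diff)
  note dv = dual_pair_unique[OF d' this]
  show False
  proof (cases "m v' \<ge> 0")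
    case True
    hence "v' \<in> pos {u, v}" using mem_pos_pair(1)[OF d] n1 by simp
    moreover have "v' \<in> pos {u, v'}" by (rule hull_inc) simp
    ultimately have "v' \<in> pos {u}" using int by blast
    thus False using mem_pos_pair(2)[OF d] n1 by simp
  next
    case False
    hence "v \<in> pos {u, v'}" using mem_pos_pair(1)[OF d'] dv by simp
    moreover have "v \<in> pos {u, v}" by (rule hull_inc) simp
    ultimately have "v \<in> pos {u}" using int by blast
    thus False using mem_pos_pair(2)[OF d] D(6) by simp
  qed
qed

text \<open>The cones not containing \<open>u\<close> form a closed set missing \<open>u\<close>. A
  small step from \<open>u\<close> in the direction \<open>w\<close> therefore ends in a cone
  containing \<open>u\<close>, whose other generator lies on the side of \<open>w\<close>.\<close>

lemma neighbour_exists: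
  assumes E: "complete_bases N E" and u: "u \<in> \<Union>E" and d: "dual_pair N u w m n"
  obtains v where "{u, v} \<in> E" "n v > 0"
proof -
  note EE = complete_basesD[OF E] and D = dual_pairD[OF d]
  define K where "K = (\<Union>e\<in>{e\<in>E. u \<notin> pos e}. pos e)"
  have "closed K" unfolding K_def
    using EE(1) card_lattice_basis(2)[OF EE(2)] closed_convex_cone_hull by (intro closed_UN) auto
  hence "open (- K)" by (rule open_Compl)
  moreover have "u \<in> - K" unfolding K_def by auto
  moreover have "((\<lambda>t. u + t *\<^sub>R w) \<longlongrightarrow> u) (at_right 0)" by (auto intro!: tendsto_eq_intros)
  ultimately have "eventually (\<lambda>t. u + t *\<^sub>R w \<in> - K) (at_right 0)" by (intro topological_tendstoD)
  hence "eventually (\<lambda>t. u + t *\<^sub>R w \<in> - K \<and> t > 0) (at_right 0)"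
    using eventually_at_right_less by (rule eventually_conj)
  then obtain t :: real where t: "u + t *\<^sub>R w \<in> - K" "t > 0"
    using eventually_happens trivial_limit_at_right_real by blast
  obtain e where e: "e \<in> E" "u + t *\<^sub>R w \<in> pos e" using EE(4) by blast
  hence "u \<in> pos e" using t(1) unfolding K_def by blast
  hence "u \<in> e" using ray_mem_pos[OF E e(1) u] by simp
  then obtain v where v: "e = {u, v}" using complete_bases_edge[OF E e(1)] by blast
  obtain m' n' where d': "dual_pair N u v m' n'" using complete_bases_dual_pair[OF E] e(1) v by metis
  let ?y = "u + t *\<^sub>R w"
  have "n ?y = t" using D by (simp add: linear_add linear_cmul)
  moreover have "n ?y = n' ?y * n v"
    using arg_cong[OF dual_pairD(7)[OF d', of ?y], of n] D(2,5) by (simp add: linear_add linear_cmul)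
  moreover have "n' ?y \<ge> 0" using e(2) mem_pos_pair(1)[OF d'] v by simp
  ultimately have "n v > 0" using t(2) by (metis mult_nonneg_nonpos not_less)
  thus thesis using that e(1) v by blast
qed

text \<open>There is one neighbour on each side of the line through \<open>u\<close>; the second is
  found by reflecting the basis. Their coordinates transverse to \<open>u\<close> are 1 and -1 and
  cancel in the sum. The integer \<open>a\<close> is minus the self-intersection of the curve of
  \<open>u\<close>.\<close>

lemma neighbours:
  assumes E: "complete_bases N E" and u: "u \<in> \<Union>E"
  obtains v v' m n a where "dual_pair N u v m n" "{u, v} \<in> E" "{u, v'} \<in> E" "a \<in> \<int>"
    "v + v' = a *\<^sub>R u" "v \<noteq> v'" "\<And>w. {u, w} \<in> E \<Longrightarrow> w = v \<or> w = v'"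
proof -
  obtain e where "e \<in> E" "u \<in> e" using u by blast
  then obtain v where uv: "{u, v} \<in> E" using complete_bases_edge[OF E] by metis
  obtain m n where d: "dual_pair N u v m n" using complete_bases_dual_pair[OF E uv] .
  have d1: "dual_pair N u (- v) m (\<lambda>x. - n x)" using dual_pair_change[OF d, of "-1" 0] by simp
  obtain v' where uv': "{u, v'} \<in> E" "n v' < 0" using neighbour_exists[OF E u d1] by auto
  obtain m' n' where d': "dual_pair N u v' m' n'" using complete_bases_dual_pair[OF E uv'(1)] .
  have n1: "n v' = - 1" using dual_pair_coordinate_unit[OF d d'] uv'(2) by auto
  have eq: "v + v' = m v' *\<^sub>R u" using dual_pairD(7)[OF d, of v'] n1 by (simp add: algebra_simps)
  have Z: "m v' \<in> \<int>" using dual_pairD(8)[OF d] dual_pair_dual_lattice[OF d'] by blast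
  have d2: "dual_pair N u v' (\<lambda>x. m x + m v' * n x) (\<lambda>x. - n x)"
    using dual_pair_change[OF d, of "-1" "m v'"] Z dual_pairD(7)[OF d, of v'] n1 by simp
  have "w = v \<or> w = v'" if w: "{u, w} \<in> E" for w
  proof -
    obtain m'' n'' where "dual_pair N u w m'' n''" using complete_bases_dual_pair[OF E w] .
    hence "n w = 1 \<or> n w = - 1" using dual_pair_coordinate_unit[OF d] by blast
    thus ?thesis
      using neighbour_unique[OF E uv w d] neighbour_unique[OF E uv'(1) w d2] by auto
  qed
  moreover have "v \<noteq> v'" using n1 dual_pairD(6)[OF d] by auto
  ultimately show thesis using that d uv uv'(1) Z eq by blast
qed

text \<open>The sum of the two generators is interior to its cone and lies in no other maximal cone,
  so none can be omitted. This is how a fan is recognised as one of the minimal models.\<close>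

lemma complete_bases_cover_eq:
  assumes E: "complete_bases N E" and E': "E' \<subseteq> E" and cov: "\<And>x. \<exists>e\<in>E'. x \<in> pos e"
  shows "E' = E"
proof (intro equalityI E' subsetI)
  note EE = complete_basesD[OF E]
  fix f assume f: "f \<in> E"
  obtain u v m n where uv: "f = {u, v}" and d: "dual_pair N u v m n"
    using lattice_basis_pair[OF dim2 EE(2)[OF f]] .
  note D = dual_pairD[OF d]
  obtain e where e: "e \<in> E'" "u + v \<in> pos e" using cov by blast
  have m: "m (u + v) = 1" "n (u + v) = 1" using D by (simp_all add: linear_add)
  have "u + v \<in> pos f" using mem_pos_pair(1)[OF d] m uv by simp
  hence "u + v \<in> pos (f \<inter> e)" using EE(3)[OF f, of e] e E' by blast
  hence "f \<inter> e = f" unfolding uv pos_dual_pair[OF d Int_lower1] using m by (auto split: if_splits)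
  hence "f = e" using lattice_basis_subset_eq EE(2) f e(1) E' by (metis inf_le2 subsetD)
  thus "f \<in> E'" using e by simp
qed

end

section \<open>The fan left after contracting rays with no two adjacent\<close>

locale contraction = lattice_plane N for N :: "'a::euclidean_space set" +
  fixes E :: "'a set set" and D :: "'a set"
  assumes E: "complete_bases N E" and D: "contractible_rays E D"
begin

lemma blow_down_pair_dual_pair:
  assumes "blow_down_pair E d v v'"
  obtains m n where "dual_pair N v v' m n"
proof -
  have e: "{v, d} \<in> E" "d = v + v'" using assms unfolding blow_down_pair_def by (auto simp: insert_commute)
  obtain m n where d: "dual_pair N v d m n" using complete_bases_dual_pair[OF E e(1)] .
  show thesis using that dual_pair_change[OF d, of 1 "-1"] e(2) by simp
qed

lemma blow_down_pair_edges:
  assumes "blow_down_pair E d v v'" "e \<in> E" "d \<in> e"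
  shows "e = {d, v} \<or> e = {d, v'}"
  using complete_bases_edge[OF E assms(2,3)] assms(1,2) unfolding blow_down_pair_def by metis

lemma blow_down_pair_unique:
  assumes "blow_down_pair E d v v'" "blow_down_pair E d w w'"
  shows "{v, v'} = {w, w'}"
proof -
  obtain m n where "dual_pair N v v' m n" using blow_down_pair_dual_pair[OF assms(1)] .
  hence "v \<noteq> v'" by (rule dual_pairD)
  moreover obtain m n where "dual_pair N w w' m n" using blow_down_pair_dual_pair[OF assms(2)] .
  hence "w \<noteq> w'" by (rule dual_pairD)
  ultimately show ?thesis using assms unfolding blow_down_pair_def by blast
qed

lemma blow_down_pair_notin:
  assumes "blow_down_pair E d v v'" "d \<in> D"
  shows "v \<notin> D" "v' \<notin> D"
proof -
  obtain w w' where "blow_down_pair E d w w'" "w \<notin> D" "w' \<notin> D"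
    using D assms(2) unfolding contractible_rays_def by blast
  moreover from this have "{v, v'} = {w, w'}" using blow_down_pair_unique[OF assms(1)] by simp
  ultimately have "v \<notin> D \<and> v' \<notin> D" by (metis insertCI insertE singletonD)
  thus "v \<notin> D" "v' \<notin> D" by simp_all
qed

lemma blow_down_pair_sym: "blow_down_pair E d v v' \<Longrightarrow> blow_down_pair E d v' v"
  unfolding blow_down_pair_def by (auto simp: add.commute)

lemma blow_down_edge:
  assumes "e \<in> E" "e \<inter> D \<noteq> {}"
  obtains d v v' where "d \<in> D" "blow_down_pair E d v v'" "e = {v, d}"
proof -
  obtain d where d: "d \<in> D" "d \<in> e" using assms(2) by blast
  then obtain w w' where b: "blow_down_pair E d w w'" using D unfolding contractible_rays_def by blast
  have "e = {w, d} \<or> e = {w', d}" using blow_down_pair_edges[OF b assms(1) d(2)] by (auto simp: insert_commute)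
  thus thesis using that d(1) b blow_down_pair_sym[OF b] by blast
qed

text \<open>The ray through the sum divides the cone according to which of the two coordinates is
  larger.\<close>

lemma pos_blow_down_pair:
  assumes b: "blow_down_pair E d v v'"
  shows "pos {v, v'} = pos {d, v} \<union> pos {d, v'}"
proof -
  obtain m n where c: "dual_pair N v v' m n" using blow_down_pair_dual_pair[OF b] .
  have d: "d = v + v'" using b unfolding blow_down_pair_def by simp
  have "dual_pair N v d (\<lambda>x. m x - n x) n" using dual_pair_change[OF c, of 1 1] d by simp
  moreover have "dual_pair N v' d (\<lambda>x. n x - m x) m"
    using dual_pair_change[OF dual_pair_sym[OF c], of 1 1] d by (simp add: add.commute)
  ultimately show ?thesis
    using mem_pos_pair(1)[OF c] mem_pos_pair(1)[of N v d] mem_pos_pair(1)[of N v' d]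
    by (auto simp: insert_commute)
qed

text \<open>A cone without the generator \<open>d\<close> does not contain the point d = v + v', so
  it cannot have both \<open>v\<close> and \<open>v'\<close> as generators. Its intersections with
  the two halves of the merged cone are thus at most one nontrivial ray, and their union is a
  cone.\<close>

lemma blow_down_pair_Int:
  assumes b: "blow_down_pair E d v v'" and e: "e \<in> E" "d \<notin> e"
  shows "pos {v, v'} \<inter> pos e = pos ({v, v'} \<inter> e)" "\<not> {v, v'} \<subseteq> e"
proof -
  have be: "{d, v} \<in> E" "{d, v'} \<in> E" "d = v + v'" using b unfolding blow_down_pair_def by auto
  have "d \<notin> pos e" using ray_mem_pos[OF E e(1), of d] e(2) be(1) by blast
  thus n: "\<not> {v, v'} \<subseteq> e" using be(3) by (auto intro: convex_cone_hull_add hull_inc)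
  have "pos {v, v'} \<inter> pos e = pos ({d, v} \<inter> e) \<union> pos ({d, v'} \<inter> e)"
    unfolding pos_blow_down_pair[OF b] using complete_basesD(3)[OF E] be e(1) by blast
  also have "\<dots> = pos ({v} \<inter> e) \<union> pos ({v'} \<inter> e)" using e(2) by simp
  also have "\<dots> = pos ({v, v'} \<inter> e)"
  proof (cases "v \<in> e")
    case True
    thus ?thesis using n by (auto simp: convex_cone_hull_contains_0)
  next
    case False
    thus ?thesis by (cases "v' \<in> e") (auto simp: convex_cone_hull_contains_0)
  qed
  finally show "pos {v, v'} \<inter> pos e = pos ({v, v'} \<inter> e)" .
qed

lemma contractedE:
  assumes "f \<in> contracted E D"
  obtains "f \<in> E" "f \<inter> D = {}"
    | d v v' where "d \<in> D" "blow_down_pair E d v v'" "f = {v, v'}"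
  using assms unfolding contracted_def by blast

text \<open>Only the intersections of two merged cones are new. One of them is split into its
  halves, which are cones of \<open>E\<close>, and \<open>blow_down_pair_Int\<close> applies to each
  half.\<close>

lemma complete_bases_contracted: "complete_bases N (contracted E D)"
proof -
  note EE = complete_basesD[OF E]
  have finU: "finite (\<Union>E)" using EE(1) card_lattice_basis(2)[OF EE(2)] by blast
  have fin: "finite (contracted E D)"
  proof (rule finite_subset)
    show "contracted E D \<subseteq> Pow (\<Union>E)"
      unfolding contracted_def blow_down_pair_def by blast
  qed (use finU in simp)
  have lb: "lattice_basis N f" if f: "f \<in> contracted E D" for f
    using f
  proof (cases rule: contractedE)
    case (2 d v v')
    thus ?thesis using blow_down_pair_dual_pair[OF 2(2)] dual_pair_lattice_basis by metis
  qed (use EE(2) in simp)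
  have bb: "pos {v, v'} \<inter> pos {w, w'} = pos ({v, v'} \<inter> {w, w'})"
    if b: "d \<in> D" "blow_down_pair E d v v'" "c \<in> D" "blow_down_pair E c w w'" for d v v' c w w'
  proof (cases "c = d")
    case True thus ?thesis using blow_down_pair_unique[OF b(2)] b(4) by simp
  next
    case False
    have nd: "v \<notin> D" "v' \<notin> D" "w \<notin> D" "w' \<notin> D" using blow_down_pair_notin b by blast+
    have be: "{c, w} \<in> E" "{c, w'} \<in> E" "c = w + w'" "d = v + v'" using b unfolding blow_down_pair_def by auto
    have dn: "d \<notin> {c, w}" "d \<notin> {c, w'}" using False nd b(1) by auto
    have "pos {v, v'} \<inter> pos {w, w'} = pos ({v, v'} \<inter> {c, w}) \<union> pos ({v, v'} \<inter> {c, w'})"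
      unfolding pos_blow_down_pair[OF b(4)]
      using blow_down_pair_Int(1)[OF b(2) be(1) dn(1)] blow_down_pair_Int(1)[OF b(2) be(2) dn(2)] by blast
    also have "{v, v'} \<inter> {c, w} = {v, v'} \<inter> {w}" using nd b(3) by auto
    also have "{v, v'} \<inter> {c, w'} = {v, v'} \<inter> {w'}" using nd b(3) by auto
    \<comment> \<open>Two rays form a cone only if one of them is trivial. If \<open>w\<close> and
      \<open>w'\<close> both belonged to the other pair, the sums \<open>c\<close> and
      \<open>d\<close> would coincide.\<close>
    also have "pos ({v, v'} \<inter> {w}) \<union> pos ({v, v'} \<inter> {w'}) = pos ({v, v'} \<inter> {w, w'})"
    proof (cases "w \<in> {v, v'} \<and> w' \<in> {v, v'}")
      case True
      obtain m n where "dual_pair N w w' m n" using blow_down_pair_dual_pair[OF b(4)] .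
      hence "w \<noteq> w'" by (rule dual_pairD)
      hence "c = d" using be(3,4) True by (auto simp: add.commute)
      thus ?thesis using False by simp
    next
      case F: False
      show ?thesis
      proof (cases "w \<in> {v, v'}")
        case True thus ?thesis using F by (auto simp: convex_cone_hull_contains_0)
      next
        case False thus ?thesis by (cases "w' \<in> {v, v'}") (auto simp: convex_cone_hull_contains_0)
      qed
    qed
    finally show ?thesis .
  qed
  have int: "pos f \<inter> pos g = pos (f \<inter> g)" if fg: "f \<in> contracted E D" "g \<in> contracted E D" for f g
    using fg(1)
  proof (cases rule: contractedE)
    case 1
    show ?thesis using fg(2)
    proof (cases rule: contractedE)
      case (2 d v v')
      hence "d \<notin> f" using 1 by blast
      thus ?thesis using blow_down_pair_Int(1)[OF 2(2) 1(1)] 2(3) by (simp add: Int_commute)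
    qed (use EE(3) 1 in simp)
  next
    case f: (2 d v v')
    show ?thesis using fg(2)
    proof (cases rule: contractedE)
      case 1
      hence "d \<notin> g" using f by blast
      thus ?thesis using blow_down_pair_Int(1)[OF f(2) 1(1)] f(3) by simp
    next
      case (2 c w w')
      thus ?thesis using bb[OF f(1,2) 2(1,2)] f(3) by simp
    qed
  qed
  have "\<exists>f\<in>contracted E D. x \<in> pos f" for x
  proof -
    obtain e where e: "e \<in> E" "x \<in> pos e" using EE(4) by blast
    show ?thesis
    proof (cases "e \<inter> D = {}")
      case True thus ?thesis using e unfolding contracted_def by blast
    next
      case False
      then obtain d v v' where d: "d \<in> D" and b: "blow_down_pair E d v v'" "e = {v, d}"
        using blow_down_edge[OF e(1)] by blast
      have "x \<in> pos {v, v'}" using e(2) unfolding pos_blow_down_pair[OF b(1)] b(2) by (simp add: insert_commute)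
      thus ?thesis using d b(1) unfolding contracted_def by blast
    qed
  qed
  thus ?thesis unfolding complete_bases_def using fin lb int by blast
qed

lemma Union_contracted: "\<Union>(contracted E D) \<subseteq> \<Union>E - D"
proof
  fix x assume "x \<in> \<Union>(contracted E D)"
  then obtain f where f: "f \<in> contracted E D" "x \<in> f" by blast
  from f(1) show "x \<in> \<Union>E - D"
  proof (cases rule: contractedE)
    case (2 d v v')
    thus ?thesis using blow_down_pair_notin[OF 2(2,1)] f(2) unfolding blow_down_pair_def by blast
  qed (use f(2) in blast)
qed

text \<open>Faces avoiding \<open>D\<close> survive: without \<open>d\<close>, a face of the cone
  over \<open>v\<close> and \<open>d\<close> is a face of the merged cone.\<close>

lemma contracted_subset:
  assumes "S \<subseteq> e" "e \<in> E" "S \<inter> D = {}"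
  obtains f where "f \<in> contracted E D" "S \<subseteq> f"
proof (cases "e \<inter> D = {}")
  case True thus thesis using that assms unfolding contracted_def by blast
next
  case False
  then obtain d v v' where d: "d \<in> D" and b: "blow_down_pair E d v v'" "e = {v, d}"
    using blow_down_edge[OF assms(2)] by blast
  hence "S \<subseteq> {v, v'}" using assms(1,3) by blast
  thus thesis using that[of "{v, v'}"] d b(1) unfolding contracted_def by blast
qed

end

section \<open>Parametrized complex surfaces\<close>

text \<open>Charts are handled through their inverses. All those needed have the whole coordinate
  plane as domain, so no domain conditions have to be carried along.\<close>

definition parametrization :: "'p complex_surface \<Rightarrow> (complex \<times> complex \<Rightarrow> 'p) \<Rightarrow> bool" where
  "parametrization X \<kappa> \<longleftrightarrow> range \<kappa> \<subseteq> points X \<and> (\<exists>\<phi>. (range \<kappa>, \<phi>) \<in> charts X \<and> (\<forall>z. \<phi> (\<kappa> z) = z))"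

lemma parametrization_inj: "parametrization X \<kappa> \<Longrightarrow> inj \<kappa>"
  unfolding parametrization_def by (metis injI)

definition holomorphic_near ::
  "'p complex_surface \<Rightarrow> 'p set \<Rightarrow> 'q complex_surface \<Rightarrow> ('p \<Rightarrow> 'q) \<Rightarrow> 'p \<Rightarrow> bool" where
  "holomorphic_near X W Y f a \<longleftrightarrow> (\<exists>\<kappa> \<mu> Q h z. parametrization X \<kappa> \<and> parametrization Y \<mu> \<and> open Q \<and>
     holomorphic2_on h Q \<and> z \<in> Q \<and> a = \<kappa> z \<and> (\<forall>z\<in>Q. \<kappa> z \<in> W \<and> f (\<kappa> z) = \<mu> (h z)))"

lemma holomorphic_nearI:
  assumes "parametrization X \<kappa>" "parametrization Y \<mu>" "open Q" "holomorphic2_on h Q" "z \<in> Q" "a = \<kappa> z"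
    and "\<And>z. z \<in> Q \<Longrightarrow> \<kappa> z \<in> W \<and> f (\<kappa> z) = \<mu> (h z)"
  shows "holomorphic_near X W Y f a"
  unfolding holomorphic_near_def using assms by blast

lemma holomorphic_map_onI:
  assumes "W \<subseteq> points X" and "\<And>a. a \<in> W \<Longrightarrow> holomorphic_near X W Y f a"
  shows "holomorphic_map_on X W Y f"
  unfolding holomorphic_map_on_def
proof (intro conjI ballI assms(1))
  fix a assume "a \<in> W"
  then obtain \<kappa> \<mu> Q h z where k: "parametrization X \<kappa>" "parametrization Y \<mu>" "open Q"
    "holomorphic2_on h Q" "z \<in> Q" "a = \<kappa> z" "\<And>z. z \<in> Q \<Longrightarrow> \<kappa> z \<in> W \<and> f (\<kappa> z) = \<mu> (h z)"
    using assms(2) unfolding holomorphic_near_def by blast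
  obtain \<phi> where \<phi>: "(range \<kappa>, \<phi>) \<in> charts X" "\<And>z. \<phi> (\<kappa> z) = z"
    using k(1) unfolding parametrization_def by blast
  obtain \<psi> where \<psi>: "(range \<mu>, \<psi>) \<in> charts Y" "\<And>z. \<psi> (\<mu> z) = z"
    using k(2) unfolding parametrization_def by blast
  have "Q \<subseteq> \<phi> ` (W \<inter> range \<kappa>)"
  proof
    fix w assume "w \<in> Q"
    thus "w \<in> \<phi> ` (W \<inter> range \<kappa>)" using k(7)[of w] \<phi>(2)[of w] by (intro image_eqI[of _ _ "\<kappa> w"]) auto
  qed
  thus "\<exists>(U, \<phi>)\<in>charts X. \<exists>(V, \<psi>)\<in>charts Y. \<exists>Q h. a \<in> U \<and> f a \<in> V \<and> open Q \<and> \<phi> a \<in> Q \<and>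
      Q \<subseteq> \<phi> ` (W \<inter> U) \<and> holomorphic2_on h Q \<and> (\<forall>b\<in>U. \<phi> b \<in> Q \<longrightarrow> f b \<in> V \<and> \<psi> (f b) = h (\<phi> b))"
    using k(3-7) \<phi>(2) \<psi>(2)
    by (intro bexI[OF _ \<phi>(1)] bexI[OF _ \<psi>(1)] case_prodI exI[of _ Q] exI[of _ h]) auto
qed

section \<open>Holomorphic maps of coordinate planes and gluing of charts\<close>

lemma holomorphic2_onI:
  assumes "\<And>z. z \<in> W \<Longrightarrow> (f has_derivative D z) (at z)"
    and "\<And>z c a b. z \<in> W \<Longrightarrow> D z (c * a, c * b) = (c * fst (D z (a, b)), c * snd (D z (a, b)))"
  shows "holomorphic2_on f W"
  unfolding holomorphic2_on_def using assms by blast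

lemma holomorphic2_on_id: "holomorphic2_on (\<lambda>z. z) W"
  by (rule holomorphic2_onI[of _ _ "\<lambda>z h. h"]) (auto intro: has_derivative_ident)

lemma holomorphic2_on_swap: "holomorphic2_on prod.swap W"
  unfolding prod.swap_def
  by (rule holomorphic2_onI[of _ _ "\<lambda>z h. (snd h, fst h)"]) (auto intro!: derivative_eq_intros)

lemma holomorphic2_on_mult: "holomorphic2_on (\<lambda>z. (fst z * snd z, snd z)) W"
  by (rule holomorphic2_onI[of _ _ "\<lambda>z h. (fst z * snd h + fst h * snd z, snd h)"])
    (auto intro!: derivative_eq_intros simp: algebra_simps)

text \<open>The inverse of the preceding map off the exceptional curve, whose equation in this chart
  is snd z = 0.\<close>

lemma holomorphic2_on_divide: "holomorphic2_on (\<lambda>z. (fst z / snd z, snd z)) {z. snd z \<noteq> 0}"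
  by (rule holomorphic2_onI[of _ _ "\<lambda>z h. ((fst h * snd z - fst z * snd h) / (snd z * snd z), snd h)"])
    (auto intro!: derivative_eq_intros simp: field_simps)

lemma parametrization_C2: "parametrization C2 (\<lambda>z. z)"
  unfolding parametrization_def C2_def by auto

lemma biholomorphic_on_parametrization:
  assumes k: "parametrization X \<kappa>" and \<phi>: "\<And>z. \<phi> (\<kappa> z) = z"
  shows "biholomorphic_on X (range \<kappa>) C2 UNIV \<phi>"
  unfolding biholomorphic_on_def
proof (intro conjI)
  have W: "range \<kappa> \<subseteq> points X" using k unfolding parametrization_def by blast
  have i: "inj_on \<phi> (range \<kappa>)" using \<phi> by (auto intro!: inj_onI)
  moreover have "\<phi> ` range \<kappa> = UNIV"
    by (metis \<phi> UNIV_eq_I image_eqI rangeI)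
  ultimately show "bij_betw \<phi> (range \<kappa>) UNIV" unfolding bij_betw_def by blast
  show "holomorphic_map_on X (range \<kappa>) C2 \<phi>"
  proof (rule holomorphic_map_onI[OF W], elim rangeE)
    show "holomorphic_near X (range \<kappa>) C2 \<phi> a" if "a = \<kappa> z" for a z
      by (rule holomorphic_nearI[OF k parametrization_C2 open_UNIV holomorphic2_on_id UNIV_I that]) (simp add: \<phi>)
  qed
  have "inv_into (range \<kappa>) \<phi> z = \<kappa> z" for z using i \<phi> by (intro inv_into_f_eq) auto
  thus "holomorphic_map_on C2 UNIV X (inv_into (range \<kappa>) \<phi>)"
    by (intro holomorphic_map_onI
        holomorphic_nearI[OF parametrization_C2 k open_UNIV holomorphic2_on_id UNIV_I refl]) (auto simp: C2_def)
qed

text \<open>The coordinates of the second pair are exchanged because those of \<open>Bl0_C2\<close> are the first coordinate of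
  the point and \<open>t\<close> in one chart, but \<open>t\<close> and the second coordinate of the point in the other.\<close>

lemma biholomorphic_on_glue:
  assumes k: "parametrization X \<kappa>\<^sub>1" "parametrization X \<kappa>\<^sub>2" and l: "parametrization Y \<mu>\<^sub>1" "parametrization Y \<mu>\<^sub>2"
    and glue: "\<And>z w. \<kappa>\<^sub>1 z = \<kappa>\<^sub>2 w \<longleftrightarrow> \<mu>\<^sub>1 z = \<mu>\<^sub>2 (prod.swap w)"
  obtains \<psi> where "biholomorphic_on X (range \<kappa>\<^sub>1 \<union> range \<kappa>\<^sub>2) Y (range \<mu>\<^sub>1 \<union> range \<mu>\<^sub>2) \<psi>"
    "\<And>z. \<psi> (\<kappa>\<^sub>1 z) = \<mu>\<^sub>1 z" "\<And>z. \<psi> (\<kappa>\<^sub>2 z) = \<mu>\<^sub>2 (prod.swap z)"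
proof -
  \<comment> \<open>On the overlap the first formula has priority; the gluing hypothesis makes the
    second one agree with it there.\<close>
  define \<psi> where "\<psi> y = (if y \<in> range \<kappa>\<^sub>1 then \<mu>\<^sub>1 (inv_into UNIV \<kappa>\<^sub>1 y) else \<mu>\<^sub>2 (prod.swap (inv_into UNIV \<kappa>\<^sub>2 y)))" for y
  note inj = parametrization_inj[OF k(1)] parametrization_inj[OF k(2)]
    parametrization_inj[OF l(1)] parametrization_inj[OF l(2)]
  have 1: "\<psi> (\<kappa>\<^sub>1 z) = \<mu>\<^sub>1 z" for z unfolding \<psi>_def using inj(1) by simp
  have 2: "\<psi> (\<kappa>\<^sub>2 z) = \<mu>\<^sub>2 (prod.swap z)" for z
  proof (cases "\<kappa>\<^sub>2 z \<in> range \<kappa>\<^sub>1")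
    case True
    then obtain w where "\<kappa>\<^sub>2 z = \<kappa>\<^sub>1 w" by blast
    thus ?thesis using 1[of w] glue[of w z] by simp
  qed (simp add: \<psi>_def inj(2))
  let ?A = "range \<kappa>\<^sub>1 \<union> range \<kappa>\<^sub>2" and ?B = "range \<mu>\<^sub>1 \<union> range \<mu>\<^sub>2"
  note \<psi>12 = 1 2
  have i: "inj_on \<psi> ?A"
  proof (rule inj_onI)
    fix x y assume "x \<in> ?A" "y \<in> ?A" and eq: "\<psi> x = \<psi> y"
    then consider z w where "x = \<kappa>\<^sub>1 z" "y = \<kappa>\<^sub>1 w" | z w where "x = \<kappa>\<^sub>1 z" "y = \<kappa>\<^sub>2 w"
      | z w where "x = \<kappa>\<^sub>2 w" "y = \<kappa>\<^sub>1 z" | z w where "x = \<kappa>\<^sub>2 z" "y = \<kappa>\<^sub>2 w"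
      by blast
    thus "x = y"
    proof cases
      case 1
      thus ?thesis using eq inj_eq[OF inj(3)] \<psi>12 by simp
    next
      case (2 z w)
      thus ?thesis using eq glue[of z w] \<psi>12 by simp
    next
      case (3 z w)
      hence "\<kappa>\<^sub>1 z = \<kappa>\<^sub>2 w" using eq glue[of z w] \<psi>12 by simp
      thus ?thesis using 3 by simp
    next
      case (4 z w)
      hence "prod.swap (prod.swap z) = prod.swap (prod.swap w)" using eq inj_eq[OF inj(4)] \<psi>12 by simp
      hence "z = w" by (simp only: swap_swap)
      thus ?thesis using 4 by simp
    qed
  qed
  have im: "\<psi> ` ?A = ?B"
  proof (intro equalityI subsetI)
    fix q assume "q \<in> ?B"
    then obtain z where "q = \<mu>\<^sub>1 z \<or> q = \<mu>\<^sub>2 (prod.swap (prod.swap z))" by (auto simp: prod.swap_def)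
    thus "q \<in> \<psi> ` ?A" using 1 2 by (metis UnI1 UnI2 image_eqI rangeI)
  qed (auto simp: 1 2)
  have WX: "?A \<subseteq> points X" and WY: "?B \<subseteq> points Y" using k l unfolding parametrization_def by auto
  have inv: "inv_into ?A \<psi> (\<mu>\<^sub>1 z) = \<kappa>\<^sub>1 z" "inv_into ?A \<psi> (\<mu>\<^sub>2 z) = \<kappa>\<^sub>2 (prod.swap z)" for z
    by (intro inv_into_f_eq[OF i]; simp add: 1 2)+
  have "biholomorphic_on X ?A Y ?B \<psi>"
    unfolding biholomorphic_on_def
  proof (intro conjI)
    show "bij_betw \<psi> ?A ?B" using i im unfolding bij_betw_def by blast
    show "holomorphic_map_on X ?A Y \<psi>"
    proof (rule holomorphic_map_onI[OF WX], elim UnE rangeE)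
      fix a z assume a: "a = \<kappa>\<^sub>1 z"
      show "holomorphic_near X ?A Y \<psi> a"
        by (intro holomorphic_nearI[of _ \<kappa>\<^sub>1 _ \<mu>\<^sub>1 UNIV "\<lambda>z. z" z])
          (use a k l 1 holomorphic2_on_id in auto)
    next
      fix a z assume a: "a = \<kappa>\<^sub>2 z"
      show "holomorphic_near X ?A Y \<psi> a"
        by (intro holomorphic_nearI[of _ \<kappa>\<^sub>2 _ \<mu>\<^sub>2 UNIV prod.swap z])
          (use a k l 2 holomorphic2_on_swap in auto)
    qed
    show "holomorphic_map_on Y ?B X (inv_into ?A \<psi>)"
    proof (rule holomorphic_map_onI[OF WY], elim UnE rangeE)
      fix a z assume a: "a = \<mu>\<^sub>1 z"
      show "holomorphic_near Y ?B X (inv_into ?A \<psi>) a"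
        by (intro holomorphic_nearI[of _ \<mu>\<^sub>1 _ \<kappa>\<^sub>1 UNIV "\<lambda>z. z" z])
          (use a k l inv holomorphic2_on_id in auto)
    next
      fix a z assume a: "a = \<mu>\<^sub>2 z"
      show "holomorphic_near Y ?B X (inv_into ?A \<psi>) a"
        by (intro holomorphic_nearI[of _ \<mu>\<^sub>2 _ \<kappa>\<^sub>2 UNIV prod.swap z])
          (use a k l inv holomorphic2_on_swap in auto)
    qed
  qed
  thus thesis using that 1 2 by blast
qed

section \<open>The two charts of the blow-up of the plane at the origin\<close>

definition bl0_chart1 :: "complex \<times> complex \<Rightarrow> (complex \<times> complex) \<times> (complex \<times> complex) set" where
  "bl0_chart1 z = ((fst z, fst z * snd z), complex_line (1, snd z))"

definition bl0_chart2 :: "complex \<times> complex \<Rightarrow> (complex \<times> complex) \<times> (complex \<times> complex) set" where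
  "bl0_chart2 z = ((fst z * snd z, snd z), complex_line (fst z, 1))"

lemma complex_line_scale:
  assumes "c \<noteq> 0"
  shows "complex_line (c * a, c * b) = complex_line (a, b)"
proof (intro equalityI subsetI)
  fix x assume "x \<in> complex_line (c * a, c * b)"
  then obtain d where "x = (d * (c * a), d * (c * b))" unfolding complex_line_def by auto
  hence "x = ((d * c) * a, (d * c) * b)" by (simp add: mult.assoc)
  thus "x \<in> complex_line (a, b)" unfolding complex_line_def fst_conv snd_conv by blast
next
  fix x assume "x \<in> complex_line (a, b)"
  then obtain d where "x = (d * a, d * b)" unfolding complex_line_def by auto
  hence "x = ((d / c) * (c * a), (d / c) * (c * b))" using assms by simp
  thus "x \<in> complex_line (c * a, c * b)" unfolding complex_line_def fst_conv snd_conv by blast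
qed

lemma complex_line_1_eq: "complex_line (1, s) = complex_line (1, t) \<longleftrightarrow> s = t"
  "complex_line (s, 1) = complex_line (t, 1) \<longleftrightarrow> s = t"
  "complex_line (s, 1) = complex_line (1, t) \<longleftrightarrow> s * t = 1"
proof -
  have mem: "w \<in> complex_line w'" if "complex_line w = complex_line w'" for w w'
  proof -
    have "w = (1 * fst w, 1 * snd w)" by simp
    hence "w \<in> complex_line w" unfolding complex_line_def by blast
    thus ?thesis using that by simp
  qed
  show "complex_line (1, s) = complex_line (1, t) \<longleftrightarrow> s = t"
    using mem[of "(1, s)" "(1, t)"] by (auto simp: complex_line_def)
  show "complex_line (s, 1) = complex_line (t, 1) \<longleftrightarrow> s = t"
    using mem[of "(s, 1)" "(t, 1)"] by (auto simp: complex_line_def)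
  show "complex_line (s, 1) = complex_line (1, t) \<longleftrightarrow> s * t = 1"
  proof
    assume "complex_line (s, 1) = complex_line (1, t)"
    from mem[OF this] show "s * t = 1" by (auto simp: complex_line_def)
  next
    assume st: "s * t = 1"
    hence "s \<noteq> 0" by auto
    from complex_line_scale[OF this, of 1 t] show "complex_line (s, 1) = complex_line (1, t)" using st by simp
  qed
qed

lemma range_bl0_chart1:
  "range bl0_chart1 = {(z, l). ((\<exists>w. w \<noteq> (0, 0) \<and> l = complex_line w) \<and> z \<in> l) \<and> (\<exists>t. l = complex_line (1, t))}"
    (is "_ = ?R")
proof (intro equalityI subsetI)
  fix q assume "q \<in> ?R"
  then obtain z t where q: "q = (z, complex_line (1, t))" "z \<in> complex_line (1, t)" by auto
  then obtain c where "z = (c, c * t)" unfolding complex_line_def by auto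
  thus "q \<in> range bl0_chart1" using q unfolding bl0_chart1_def by (intro image_eqI[of _ _ "(c, t)"]) auto
next
  fix q assume "q \<in> range bl0_chart1"
  then obtain c t where q: "q = ((c, c * t), complex_line (1, t))" unfolding bl0_chart1_def by auto
  have "(c, c * t) \<in> complex_line (1, t)" unfolding complex_line_def by auto
  moreover have "(1::complex, t) \<noteq> (0, 0)" by simp
  ultimately show "q \<in> ?R" unfolding q by blast
qed

lemma range_bl0_chart2:
  "range bl0_chart2 = {(z, l). ((\<exists>w. w \<noteq> (0, 0) \<and> l = complex_line w) \<and> z \<in> l) \<and> (\<exists>t. l = complex_line (t, 1))}"
    (is "_ = ?R")
proof (intro equalityI subsetI)
  fix q assume "q \<in> ?R"
  then obtain z t where q: "q = (z, complex_line (t, 1))" "z \<in> complex_line (t, 1)" by auto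
  then obtain c where "z = (t * c, c)" unfolding complex_line_def by (auto simp: mult.commute)
  thus "q \<in> range bl0_chart2" using q unfolding bl0_chart2_def by (intro image_eqI[of _ _ "(t, c)"]) auto
next
  fix q assume "q \<in> range bl0_chart2"
  then obtain c t where q: "q = ((t * c, c), complex_line (t, 1))" unfolding bl0_chart2_def by auto
  have "(t * c, c) \<in> complex_line (t, 1)" unfolding complex_line_def by (auto simp: mult.commute)
  moreover have "(t, 1::complex) \<noteq> (0, 0)" by simp
  ultimately show "q \<in> ?R" unfolding q by blast
qed

lemma points_Bl0_C2: "points Bl0_C2 = range bl0_chart1 \<union> range bl0_chart2"
proof -
  have "(\<exists>t. complex_line w = complex_line (1, t)) \<or> (\<exists>t. complex_line w = complex_line (t, 1))"
    if "w \<noteq> (0, 0)" for w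
  proof (cases "fst w = 0")
    case True
    hence "complex_line w = complex_line (0, 1)"
      using complex_line_scale[of "snd w" 0 1] that by (cases w) auto
    thus ?thesis by blast
  next
    case False
    hence "complex_line w = complex_line (1, snd w / fst w)"
      using complex_line_scale[of "fst w" 1 "snd w / fst w"] by (cases w) auto
    thus ?thesis by blast
  qed
  thus ?thesis unfolding Bl0_C2_def Let_def range_bl0_chart1 range_bl0_chart2 by auto
qed

lemma parametrization_bl0_chart1: "parametrization Bl0_C2 bl0_chart1"
proof -
  have "(range bl0_chart1, \<lambda>(z, l). (fst z, THE t. l = complex_line (1, t))) \<in> charts Bl0_C2"
    unfolding range_bl0_chart1 Bl0_C2_def Let_def by auto
  moreover have "(case bl0_chart1 z of (z, l) \<Rightarrow> (fst z, THE t. l = complex_line (1, t))) = z" for z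
    unfolding bl0_chart1_def by (simp add: complex_line_1_eq)
  ultimately show ?thesis unfolding parametrization_def using points_Bl0_C2 by blast
qed

lemma parametrization_bl0_chart2: "parametrization Bl0_C2 bl0_chart2"
proof -
  have "(range bl0_chart2, \<lambda>(z, l). (THE t. l = complex_line (t, 1), snd z)) \<in> charts Bl0_C2"
    unfolding range_bl0_chart2 Bl0_C2_def Let_def by auto
  moreover have "(case bl0_chart2 z of (z, l) \<Rightarrow> (THE t. l = complex_line (t, 1), snd z)) = z" for z
    unfolding bl0_chart2_def by (simp add: complex_line_1_eq)
  ultimately show ?thesis unfolding parametrization_def using points_Bl0_C2 by blast
qed

text \<open>For b nonzero the last equation follows from the other two. On the exceptional curve,
  where b = c = 0, it is the only condition left.\<close>

lemma bl0_chart_eq: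
  "bl0_chart2 (a, b) = bl0_chart1 (c, t) \<longleftrightarrow> a * b = c \<and> b = c * t \<and> a * t = 1"
  unfolding bl0_chart1_def bl0_chart2_def by (simp add: complex_line_1_eq)

section \<open>Affine charts of toric surfaces\<close>

text \<open>The orbit of a two-dimensional cone is a single point: only the zero character vanishes
  on the whole cone, so every other character of its semigroup takes the value 0 there.\<close>

definition fixed_point :: "'a::euclidean_space set \<Rightarrow> 'a toric_point" where
  "fixed_point e = (pos e, \<lambda>k. if k = (\<lambda>w. 0) then 1 else 0)"

text \<open>The inverse of the affine chart of the cone spanned by \<open>u\<close> and \<open>v\<close>; note that \<open>0 powi i = 0\<close> also for
  negative \<open>i\<close>.\<close>

definition toric_param ::
  "'a::euclidean_space set \<Rightarrow> 'a \<Rightarrow> 'a \<Rightarrow> complex \<times> complex \<Rightarrow> 'a toric_point" where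
  "toric_param N u v = (\<lambda>(a, b). (pos ((if a = 0 then {u} else {}) \<union> (if b = 0 then {v} else {})),
     \<lambda>k. if k \<in> dual_lattice N then a powi \<lfloor>k u\<rfloor> * b powi \<lfloor>k v\<rfloor> else 0))"

section \<open>Characters of a cone and their values at a point\<close>

lemma linear_nonneg_pos_iff:
  assumes "linear k"
  shows "(\<forall>w\<in>pos S. k w \<ge> (0::real)) \<longleftrightarrow> (\<forall>w\<in>S. k w \<ge> 0)"
proof
  assume "\<forall>w\<in>S. k w \<ge> 0"
  hence "S \<subseteq> {w. k w \<ge> 0}" by auto
  moreover have "convex_cone {w. k w \<ge> 0}"
    unfolding convex_cone_iff using assms by (auto simp: linear_0 linear_add linear_cmul)
  ultimately have "pos S \<subseteq> {w. k w \<ge> 0}" by (intro hull_minimal)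
  thus "\<forall>w\<in>pos S. k w \<ge> 0" by auto
qed (auto intro: hull_inc)

lemma linear_zero_pos_iff:
  assumes "linear k"
  shows "(\<forall>w\<in>pos S. k w = (0::real)) \<longleftrightarrow> (\<forall>w\<in>S. k w = 0)"
proof
  assume "\<forall>w\<in>S. k w = 0"
  hence "S \<subseteq> {w. k w = 0}" by auto
  moreover have "convex_cone {w. k w = 0}"
    unfolding convex_cone_iff using assms by (auto simp: linear_0 linear_add linear_cmul)
  ultimately have "pos S \<subseteq> {w. k w = 0}" by (intro hull_minimal)
  thus "\<forall>w\<in>pos S. k w = 0" by auto
qed (auto intro: hull_inc)

lemma dual_latticeD: "k \<in> dual_lattice N \<Longrightarrow> linear k" "k \<in> dual_lattice N \<Longrightarrow> w \<in> N \<Longrightarrow> k w \<in> \<int>"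
  unfolding dual_lattice_def by auto

lemma zero_dual_lattice: "(\<lambda>w. 0) \<in> dual_lattice N"
  unfolding dual_lattice_def by (auto intro: linear_zero)

lemma dual_lattice_add: "k \<in> dual_lattice N \<Longrightarrow> l \<in> dual_lattice N \<Longrightarrow> (\<lambda>w. k w + l w) \<in> dual_lattice N"
  unfolding dual_lattice_def by (auto intro: linear_compose_add)

lemma dual_lattice_diff: "k \<in> dual_lattice N \<Longrightarrow> l \<in> dual_lattice N \<Longrightarrow> (\<lambda>w. k w - l w) \<in> dual_lattice N"
  unfolding dual_lattice_def by (auto intro: linear_compose_sub)

lemma dual_lattice_scale: "k \<in> dual_lattice N \<Longrightarrow> (\<lambda>w. of_int i * k w) \<in> dual_lattice N"
  unfolding dual_lattice_def by (auto intro!: linearI simp: linear_add linear_cmul algebra_simps)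

lemma cone_semigroup_pos:
  "k \<in> cone_semigroup N (pos S) \<longleftrightarrow> k \<in> dual_lattice N \<and> (\<forall>w\<in>S. k w \<ge> 0)"
  unfolding cone_semigroup_def using linear_nonneg_pos_iff dual_latticeD(1) by auto

lemma orbit_of_cone_pos:
  "x \<in> orbit_of_cone N (pos S) \<longleftrightarrow> x (\<lambda>v. 0) = 1 \<and>
     (\<forall>m\<in>cone_semigroup N (pos S). \<forall>n\<in>cone_semigroup N (pos S). x (\<lambda>v. m v + n v) = x m * x n) \<and>
     (\<forall>m\<in>cone_semigroup N (pos S). x m \<noteq> 0 \<longleftrightarrow> (\<forall>v\<in>S. m v = 0)) \<and>
     (\<forall>m. m \<notin> cone_semigroup N (pos S) \<longrightarrow> x m = 0)"
proof -
  have "(\<forall>v\<in>pos S. m v = 0) \<longleftrightarrow> (\<forall>v\<in>S. m v = 0)" if "m \<in> cone_semigroup N (pos S)" for m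
    using linear_zero_pos_iff[of m S] that dual_latticeD(1) unfolding cone_semigroup_def by blast
  thus ?thesis unfolding orbit_of_cone_def by simp
qed

lemma orbit_mult:
  assumes "x \<in> orbit_of_cone N \<sigma>" "m \<in> cone_semigroup N \<sigma>" "n \<in> cone_semigroup N \<sigma>"
  shows "x (\<lambda>v. m v + n v) = x m * x n"
  using assms unfolding orbit_of_cone_def by blast

lemma dual_lattice_expand:
  assumes "dual_pair N u v m n" "k \<in> dual_lattice N"
  shows "k = (\<lambda>w. of_int \<lfloor>k u\<rfloor> * m w + of_int \<lfloor>k v\<rfloor> * n w)" "of_int \<lfloor>k u\<rfloor> = k u" "of_int \<lfloor>k v\<rfloor> = k v"
proof -
  have "k u \<in> \<int>" "k v \<in> \<int>" using dual_latticeD(2)[OF assms(2)] dual_pair_dual_lattice[OF assms(1)] by auto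
  thus e: "of_int \<lfloor>k u\<rfloor> = k u" "of_int \<lfloor>k v\<rfloor> = k v" by (simp_all add: of_int_floor)
  show "k = (\<lambda>w. of_int \<lfloor>k u\<rfloor> * m w + of_int \<lfloor>k v\<rfloor> * n w)"
  proof
    fix w
    have "k w = k (m w *\<^sub>R u + n w *\<^sub>R v)" using dual_pairD(7)[OF assms(1), of w] by simp
    thus "k w = of_int \<lfloor>k u\<rfloor> * m w + of_int \<lfloor>k v\<rfloor> * n w"
      unfolding e using dual_latticeD(1)[OF assms(2)] by (simp add: linear_add linear_cmul mult.commute)
  qed
qed

text \<open>The hypothesis is needed because of the convention \<open>0 powi i = 0\<close> for
  negative \<open>i\<close>: with exponents 1 and -1 the law fails at 0.\<close>

lemma powi_add: "(a = 0 \<Longrightarrow> i \<ge> 0 \<and> j \<ge> 0) \<Longrightarrow> a powi (i + j) = a powi i * (a powi j :: complex)"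
  by (cases "a = 0") (auto simp: power_int_add power_int_0_left_if)

text \<open>A negative multiple stays in the semigroup only if \<open>m\<close> vanishes on
  \<open>S\<close>. Then \<open>x m\<close> is nonzero, and applying \<open>x\<close> to the sum of
  opposite multiples of \<open>m\<close> shows that the value at the negative one is the inverse
  power.\<close>

lemma orbit_power_int:
  assumes x: "x \<in> orbit_of_cone N (pos S)" and m: "m \<in> cone_semigroup N (pos S)"
    and i: "i < 0 \<Longrightarrow> \<forall>w\<in>S. m w = 0"
  shows "x (\<lambda>w. of_int i * m w) = x m powi i"
proof -
  note X = x[unfolded orbit_of_cone_pos]
  have sc: "(\<lambda>w. of_int j * m w) \<in> cone_semigroup N (pos S)" if "j \<ge> 0 \<or> (\<forall>w\<in>S. m w = 0)" for j :: int
    using m that unfolding cone_semigroup_pos by (auto intro: dual_lattice_scale)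
  have nn: "x (\<lambda>w. of_int (int k) * m w) = x m ^ k" for k
  proof (induction k)
    case (Suc k)
    have "(\<lambda>w. of_int (int (Suc k)) * m w) = (\<lambda>w. m w + of_int (int k) * m w)"
      by (simp add: algebra_simps)
    thus ?case using X m sc[of "int k"] Suc by simp
  qed (use X in simp)
  show ?thesis
  proof (cases "i \<ge> 0")
    case True thus ?thesis using nn[of "nat i"] by (simp add: power_int_def)
  next
    case False
    hence z: "\<forall>w\<in>S. m w = 0" using i by simp
    hence nz: "x m \<noteq> 0" using X m by blast
    have "x (\<lambda>w. of_int (int (nat (- i))) * m w + of_int i * m w)
        = x (\<lambda>w. of_int (int (nat (- i))) * m w) * x (\<lambda>w. of_int i * m w)"
      by (rule orbit_mult[OF x]) (intro sc disjI2 z)+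
    also have "(\<lambda>w. of_int (int (nat (- i))) * m w + of_int i * m w) = (\<lambda>w. 0)"
      using False by (auto simp: algebra_simps)
    finally have "x m ^ nat (- i) * x (\<lambda>w. of_int i * m w) = 1"
      unfolding nn using X by simp
    thus ?thesis using False nz by (simp add: power_int_def field_simps)
  qed
qed

lemma toric_param_swap: "toric_param N u v (a, b) = toric_param N v u (b, a)"
  unfolding toric_param_def by (auto simp: Un_commute mult.commute)

lemma fixed_point_toric_param:
  assumes "dual_pair N u v m n"
  shows "fixed_point {u, v} = toric_param N u v (0, 0)"
proof -
  have "k = (\<lambda>w. 0) \<longleftrightarrow> \<lfloor>k u\<rfloor> = 0 \<and> \<lfloor>k v\<rfloor> = 0" if "k \<in> dual_lattice N" for k
    using dual_lattice_expand[OF assms that] by auto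
  thus ?thesis unfolding fixed_point_def toric_param_def
    by (auto simp: power_int_0_left_if zero_dual_lattice insert_commute)
qed

lemma toric_param_orbit:
  assumes d: "dual_pair N u v m n"
  shows "snd (toric_param N u v z) \<in> orbit_of_cone N (fst (toric_param N u v z))"
proof (cases z)
  case (Pair a b)
  define S where "S = (if a = 0 then {u} else {}) \<union> (if b = 0 then {v} else {})"
  define x where "x k = (if k \<in> dual_lattice N then a powi \<lfloor>k u\<rfloor> * b powi \<lfloor>k v\<rfloor> else 0)" for k
  have e: "of_int \<lfloor>k u\<rfloor> = k u" "of_int \<lfloor>k v\<rfloor> = k v" if "k \<in> dual_lattice N" for k
    using dual_lattice_expand(2,3)[OF d that] .
  have "x \<in> orbit_of_cone N (pos S)"
    unfolding orbit_of_cone_pos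
  proof (intro conjI ballI allI impI)
    show "x (\<lambda>v. 0) = 1" unfolding x_def using zero_dual_lattice by simp
  next
    fix k l assume kl: "k \<in> cone_semigroup N (pos S)" "l \<in> cone_semigroup N (pos S)"
    hence K: "k \<in> dual_lattice N" "l \<in> dual_lattice N" "(\<lambda>v. k v + l v) \<in> dual_lattice N"
      unfolding cone_semigroup_pos by (auto intro: dual_lattice_add)
    have "of_int \<lfloor>k u + l u\<rfloor> = k u + l u" "of_int \<lfloor>k v + l v\<rfloor> = k v + l v" using e[OF K(3)] .
    hence "\<lfloor>k u + l u\<rfloor> = \<lfloor>k u\<rfloor> + \<lfloor>l u\<rfloor>" "\<lfloor>k v + l v\<rfloor> = \<lfloor>k v\<rfloor> + \<lfloor>l v\<rfloor>"
      using e[OF K(1)] e[OF K(2)] by linarith+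
    \<comment> \<open>If the base is 0, the generator belongs to \<open>S\<close>, and membership in
      the semigroup makes both exponents nonnegative.\<close>
    moreover have "a powi (\<lfloor>k u\<rfloor> + \<lfloor>l u\<rfloor>) = a powi \<lfloor>k u\<rfloor> * a powi \<lfloor>l u\<rfloor>"
      using kl unfolding cone_semigroup_pos S_def by (intro powi_add) auto
    moreover have "b powi (\<lfloor>k v\<rfloor> + \<lfloor>l v\<rfloor>) = b powi \<lfloor>k v\<rfloor> * b powi \<lfloor>l v\<rfloor>"
      using kl unfolding cone_semigroup_pos S_def by (intro powi_add) auto
    ultimately show "x (\<lambda>v. k v + l v) = x k * x l" unfolding x_def using K by simp
  next
    fix k assume "k \<in> cone_semigroup N (pos S)"
    hence k: "k \<in> dual_lattice N" unfolding cone_semigroup_pos by simp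
    have "\<lfloor>k u\<rfloor> = 0 \<longleftrightarrow> k u = 0" "\<lfloor>k v\<rfloor> = 0 \<longleftrightarrow> k v = 0"
      using e(1)[OF k] e(2)[OF k] by (metis floor_zero of_int_0)+
    thus "x k \<noteq> 0 \<longleftrightarrow> (\<forall>w\<in>S. k w = 0)" unfolding x_def S_def using k by auto
  next
    fix k assume k: "k \<notin> cone_semigroup N (pos S)"
    show "x k = 0"
    proof (cases "k \<in> dual_lattice N")
      case True
      then obtain w where "w \<in> S" "k w < 0" using k unfolding cone_semigroup_pos by auto
      moreover from this have "\<lfloor>k w\<rfloor> \<noteq> 0" by linarith
      ultimately show ?thesis using True unfolding x_def S_def by (auto split: if_splits)
    qed (simp add: x_def)
  qed
  thus ?thesis unfolding Pair toric_param_def by (simp add: S_def x_def[abs_def])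
qed

lemma toric_param_coords:
  assumes d: "dual_pair N u v m n"
  shows "(case toric_param N u v z of (\<tau>, x) \<Rightarrow> (x m, x n)) = z"
  unfolding toric_param_def using dual_pairD(3-6)[OF d] dual_pair_dual_lattice[OF d] by (auto split: prod.split)

text \<open>The values at \<open>m\<close> and \<open>n\<close> determine the point: their zeros
  recover \<open>S\<close>, and every character of the cone is an integer combination of
  \<open>m\<close> and \<open>n\<close> whose negative coefficients occur only where the coordinate
  is nonzero.\<close>

lemma toric_param_surj:
  assumes d: "dual_pair N u v m n" and S: "S \<subseteq> {u, v}" and x: "x \<in> orbit_of_cone N (pos S)"
  shows "toric_param N u v (x m, x n) = (pos S, x)"
proof -
  note X = x[unfolded orbit_of_cone_pos] and D = dual_pairD[OF d] and L = dual_pair_dual_lattice[OF d]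
  have mn: "m \<in> cone_semigroup N (pos S)" "n \<in> cone_semigroup N (pos S)"
    unfolding cone_semigroup_pos using L S D(3-6) by auto
  have z: "x m = 0 \<longleftrightarrow> u \<in> S" "x n = 0 \<longleftrightarrow> v \<in> S"
    using X mn S D(3-6) by auto
  have SS: "(if x m = 0 then {u} else {}) \<union> (if x n = 0 then {v} else {}) = S"
    unfolding z using S by auto
  have "(if k \<in> dual_lattice N then x m powi \<lfloor>k u\<rfloor> * x n powi \<lfloor>k v\<rfloor> else 0) = x k" for k
  proof (cases "k \<in> cone_semigroup N (pos S)")
    case True
    hence k: "k \<in> dual_lattice N" "\<forall>w\<in>S. k w \<ge> 0" unfolding cone_semigroup_pos by auto
    note ke = dual_lattice_expand[OF d k(1)]
    let ?i = "\<lfloor>k u\<rfloor>" and ?j = "\<lfloor>k v\<rfloor>"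
    have ij: "u \<in> S \<Longrightarrow> ?i \<ge> 0" "v \<in> S \<Longrightarrow> ?j \<ge> 0" using k(2) by auto
    have "(\<lambda>w. of_int ?i * m w) \<in> cone_semigroup N (pos S)" "(\<lambda>w. of_int ?j * n w) \<in> cone_semigroup N (pos S)"
      unfolding cone_semigroup_pos using L S D(3-6) ij by (auto intro: dual_lattice_scale)
    hence "x (\<lambda>w. of_int ?i * m w + of_int ?j * n w) = x (\<lambda>w. of_int ?i * m w) * x (\<lambda>w. of_int ?j * n w)"
      by (rule orbit_mult[OF x])
    hence "x k = x (\<lambda>w. of_int ?i * m w) * x (\<lambda>w. of_int ?j * n w)" using ke(1) by simp
    moreover have "x (\<lambda>w. of_int ?i * m w) = x m powi ?i"
      by (rule orbit_power_int[OF x mn(1)]) (use ij S D(3-6) in force)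
    moreover have "x (\<lambda>w. of_int ?j * n w) = x n powi ?j"
      by (rule orbit_power_int[OF x mn(2)]) (use ij S D(3-6) in force)
    ultimately show ?thesis using k(1) by simp
  next
    case False
    show ?thesis
    proof (cases "k \<in> dual_lattice N")
      case True
      then obtain w where w: "w \<in> S" "k w < 0" using False unfolding cone_semigroup_pos by auto
      hence "w = u \<and> x m = 0 \<or> w = v \<and> x n = 0" using S z by auto
      moreover have "\<lfloor>k w\<rfloor> \<noteq> 0" using w(2) by linarith
      moreover have "x k = 0" using X False by blast
      ultimately show ?thesis by auto
    qed (use X False in simp)
  qed
  thus ?thesis unfolding toric_param_def using SS by auto
qed

section \<open>Affine charts of the surface of a fan given by its maximal cones\<close>

context lattice_plane
begin

lemma points_toric_surface:
  "(\<tau>, x) \<in> points (toric_surface N (fan_of E)) \<longleftrightarrow> \<tau> \<in> fan_of E \<and> x \<in> orbit_of_cone N \<tau>"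
  unfolding toric_surface_def Let_def by simp

lemma toric_surface_chart:
  assumes "dual_pair N u v m n" and "{u, v} \<in> E"
  shows "(range (toric_param N u v), \<lambda>(\<tau>, x). (x m, x n)) \<in> charts (toric_surface N (fan_of E))"
    and "range (toric_param N u v) = {(\<tau>, x) \<in> points (toric_surface N (fan_of E)). cone_face \<tau> (pos {u, v})}"
proof -
  note d = assms(1)
  let ?X = "toric_surface N (fan_of E)"
  show r: "range (toric_param N u v) = {(\<tau>, x) \<in> points ?X. cone_face \<tau> (pos {u, v})}"
  proof (intro equalityI subsetI)
    fix y assume "y \<in> range (toric_param N u v)"
    then obtain a b where y: "y = toric_param N u v (a, b)" by auto
    let ?S = "(if a = 0 then {u} else {}) \<union> (if b = 0 then {v} else {})"
    have f: "fst y = pos ?S" unfolding y toric_param_def by simp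
    have S: "?S \<subseteq> {u, v}" by auto
    have "fst y \<in> fan_of E" unfolding f by (rule fan_ofI[OF assms(2) S])
    moreover have "cone_face (fst y) (pos {u, v})" unfolding f pos_face_iff[OF d subset_refl] using S by blast
    moreover have "snd y \<in> orbit_of_cone N (fst y)" unfolding y by (rule toric_param_orbit[OF d])
    ultimately show "y \<in> {(\<tau>, x) \<in> points ?X. cone_face \<tau> (pos {u, v})}"
      by (cases y) (simp add: points_toric_surface)
  next
    fix y assume "y \<in> {(\<tau>, x) \<in> points ?X. cone_face \<tau> (pos {u, v})}"
    then obtain \<tau> x where y: "y = (\<tau>, x)" "x \<in> orbit_of_cone N \<tau>" "cone_face \<tau> (pos {u, v})"
      by (cases y) (simp add: points_toric_surface)
    then obtain S where S: "S \<subseteq> {u, v}" "\<tau> = pos S" unfolding pos_face_iff[OF d subset_refl] by blast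
    show "y \<in> range (toric_param N u v)"
      using toric_param_surj[OF d S(1)] y S(2) by (metis rangeI)
  qed
  have pE: "pos {u, v} \<in> fan_of E" using fan_ofI[OF assms(2)] by simp
  have P: "points ?X = {(\<tau>, x). \<tau> \<in> fan_of E \<and> x \<in> orbit_of_cone N \<tau>}"
    unfolding toric_surface_def Let_def by simp
  show "(range (toric_param N u v), \<lambda>(\<tau>, x). (x m, x n)) \<in> charts ?X"
    unfolding r P unfolding toric_surface_def Let_def
    using dual_pairD(3-6,9)[OF d] dual_pair_dual_lattice[OF d] dual_pair_lattice_basis[OF d] pE
    by auto
qed

lemma parametrization_toric_param:
  assumes "dual_pair N u v m n" and "{u, v} \<in> E"
  shows "parametrization (toric_surface N (fan_of E)) (toric_param N u v)"
  unfolding parametrization_def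
proof (intro conjI exI allI)
  show "range (toric_param N u v) \<subseteq> points (toric_surface N (fan_of E))"
    unfolding toric_surface_chart(2)[OF assms] by auto
  show "(range (toric_param N u v), \<lambda>(\<tau>, x). (x m, x n)) \<in> charts (toric_surface N (fan_of E))"
    by (rule toric_surface_chart(1)[OF assms])
  show "(case toric_param N u v z of (\<tau>, x) \<Rightarrow> (x m, x n)) = z" for z
    by (rule toric_param_coords[OF assms(1)])
qed

text \<open>The dual basis is unique, so the characters used by an arbitrary chart of the atlas are
  the coordinate functionals, and the chart is inverse to some \<open>toric_param\<close>.\<close>

lemma toric_surface_chartE:
  assumes E: "complete_bases N E" and c: "(U, \<phi>) \<in> charts (toric_surface N (fan_of E))"
  obtains u v m n where "dual_pair N u v m n" "{u, v} \<in> E" "U = range (toric_param N u v)"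
    "\<phi> = (\<lambda>(\<tau>, x). (x m, x n))"
proof -
  have P: "points (toric_surface N (fan_of E)) = {(\<tau>, x). \<tau> \<in> fan_of E \<and> x \<in> orbit_of_cone N \<tau>}"
    unfolding toric_surface_def Let_def by simp
  from c obtain u v m n where h: "u \<noteq> v" "lattice_basis N {u, v}" "pos {u, v} \<in> fan_of E"
    "m \<in> dual_lattice N" "n \<in> dual_lattice N" "m u = 1" "m v = 0" "n u = 0" "n v = 1"
    "U = {(\<tau>, x) \<in> points (toric_surface N (fan_of E)). cone_face \<tau> (pos {u, v})}"
    "\<phi> = (\<lambda>(\<tau>, x). (x m, x n))"
    unfolding P unfolding toric_surface_def Let_def by auto
  obtain m' n' where d: "dual_pair N u v m' n'" using lattice_basis_dual_pair[OF h(2,1)] .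
  have "m = m'" using dual_lattice_expand(1)[OF d h(4)] h by simp
  moreover have "n = n'" using dual_lattice_expand(1)[OF d h(5)] h by simp
  moreover have uv: "{u, v} \<in> E"
    using maximal_bases_fan_of[OF E] h(2,3) unfolding maximal_bases_def by blast
  ultimately show thesis using that[of u v m n] d h(10,11) toric_surface_chart(2)[OF d uv] by simp
qed

lemma toric_point_param:
  assumes E: "complete_bases N E" and y: "y \<in> points (toric_surface N (fan_of E))"
  obtains S u v m n z where "{u, v} \<in> E" "dual_pair N u v m n" "S \<subseteq> {u, v}" "fst y = pos S"
    "y = toric_param N u v z"
proof -
  obtain \<tau> x where yx: "y = (\<tau>, x)" "\<tau> \<in> fan_of E" "x \<in> orbit_of_cone N \<tau>"
    using y by (cases y) (simp add: points_toric_surface)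
  obtain e S where e: "e \<in> E" "S \<subseteq> e" "\<tau> = pos S" using fan_ofE[OF yx(2)] .
  obtain u v m n where uv: "e = {u, v}" and d: "dual_pair N u v m n"
    using lattice_basis_pair[OF dim2 complete_basesD(2)[OF E e(1)]] .
  have "y = toric_param N u v (x m, x n)"
    using toric_param_surj[OF d e(2)[unfolded uv]] yx e(3) by simp
  moreover have "fst y = pos S" using yx(1) e(3) by simp
  ultimately show thesis using that[OF e(1)[unfolded uv] d e(2)[unfolded uv]] by blast
qed

text \<open>Seen in another chart, an affine chart is the plane with some coordinate axes, or the
  origin, removed. Which of them are removed depends on whether the corresponding face is shared
  (\<open>F\<close>). Since \<open>F\<close> passes to subsets, each condition either says nothing
  or removes a closed set.\<close>

lemma open_toric_chart:
  assumes E: "complete_bases N E" and uv: "{u, v} \<in> E" and d: "dual_pair N u v m n"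
  shows "open_in_surface (toric_surface N (fan_of E)) (range (toric_param N u v))"
  unfolding open_in_surface_def
proof (intro conjI)
  let ?X = "toric_surface N (fan_of E)"
  show "range (toric_param N u v) \<subseteq> points ?X"
    using parametrization_toric_param[OF d uv] unfolding parametrization_def by blast
  have op: "open {z::complex \<times> complex. (fst z = 0 \<longrightarrow> P) \<and> (snd z = 0 \<longrightarrow> Q) \<and> (z = (0, 0) \<longrightarrow> R)}" for P Q R
  proof -
    have orP: "open {z. A z \<or> P}" if "open {z. A z}" for A :: "complex \<times> complex \<Rightarrow> bool" and P
      using that by (cases P) simp_all
    have "open {z::complex \<times> complex. fst z \<noteq> 0}" "open {z::complex \<times> complex. snd z \<noteq> 0}"
      "open {z::complex \<times> complex. z \<noteq> (0, 0)}"
      by (intro open_Collect_neq continuous_intros)+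
    hence "open {z::complex \<times> complex. fst z \<noteq> 0 \<or> P}" "open {z::complex \<times> complex. snd z \<noteq> 0 \<or> Q}"
      "open {z::complex \<times> complex. z \<noteq> (0, 0) \<or> R}"
      by (simp_all only: orP)
    hence "open ({z::complex \<times> complex. fst z \<noteq> 0 \<or> P} \<inter> {z. snd z \<noteq> 0 \<or> Q} \<inter> {z. z \<noteq> (0, 0) \<or> R})"
      by (intro open_Int)
    moreover have "{z::complex \<times> complex. (fst z = 0 \<longrightarrow> P) \<and> (snd z = 0 \<longrightarrow> Q) \<and> (z = (0, 0) \<longrightarrow> R)}
      = {z::complex \<times> complex. fst z \<noteq> 0 \<or> P} \<inter> {z. snd z \<noteq> 0 \<or> Q} \<inter> {z. z \<noteq> (0, 0) \<or> R}" by blast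
    ultimately show ?thesis by simp
  qed
  show "\<forall>(U', \<phi>')\<in>charts ?X. open (\<phi>' ` (range (toric_param N u v) \<inter> U'))"
  proof (rule ballI, rule case_prodI2)
    fix c U' \<phi>' assume "c \<in> charts ?X" "c = (U', \<phi>')"
    hence "(U', \<phi>') \<in> charts ?X" by simp
    then obtain u' v' m' n' where c: "dual_pair N u' v' m' n'" "{u', v'} \<in> E" "U' = range (toric_param N u' v')"
      "\<phi>' = (\<lambda>(\<tau>, x). (x m', x n'))" by (rule toric_surface_chartE[OF E])
    define F where "F S \<longleftrightarrow> cone_face (pos S) (pos {u, v})" for S
    have F0: "F {}" unfolding F_def pos_face_iff[OF d subset_refl] by blast
    have Fm: "F T" if "F S" "T \<subseteq> S" "S \<subseteq> {u', v'}" for S T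
    proof -
      obtain S' where S': "S' \<subseteq> {u, v}" "pos S = pos S'"
        using \<open>F S\<close> unfolding F_def pos_face_iff[OF d subset_refl] by blast
      have "S = S'" by (rule pos_eq_imp_eq[OF c(1) d that(3) S'])
      thus ?thesis using that(2) S'(1) unfolding F_def pos_face_iff[OF d subset_refl] by blast
    qed
    have "\<phi>' ` (range (toric_param N u v) \<inter> U') = {z. fst (toric_param N u' v' z) \<in> {\<tau>. cone_face \<tau> (pos {u, v})}}"
    proof (intro equalityI subsetI)
      fix z assume "z \<in> \<phi>' ` (range (toric_param N u v) \<inter> U')"
      then obtain y where y: "z = \<phi>' y" "y \<in> range (toric_param N u v) \<inter> range (toric_param N u' v')"
        unfolding c(3) by (rule imageE)
      from IntD2[OF y(2)] obtain w where yw: "y = toric_param N u' v' w" by (elim rangeE)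
      note w = IntD1[OF y(2), unfolded yw] y(1)[unfolded yw]
      have "z = w" using w(2) toric_param_coords[OF c(1)] c(4) by simp
      thus "z \<in> {z. fst (toric_param N u' v' z) \<in> {\<tau>. cone_face \<tau> (pos {u, v})}}"
        using w(1) toric_surface_chart(2)[OF d uv] by auto
    next
      fix z assume z: "z \<in> {z. fst (toric_param N u' v' z) \<in> {\<tau>. cone_face \<tau> (pos {u, v})}}"
      have "toric_param N u' v' z \<in> points ?X"
        using parametrization_toric_param[OF c(1,2)] unfolding parametrization_def by blast
      hence "toric_param N u' v' z \<in> range (toric_param N u v)"
        unfolding toric_surface_chart(2)[OF d uv] using z by auto
      moreover have "z = \<phi>' (toric_param N u' v' z)" using toric_param_coords[OF c(1)] c(4) by simp
      ultimately show "z \<in> \<phi>' ` (range (toric_param N u v) \<inter> U')" unfolding c(3) by blast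
    qed
    also have "\<dots> = {z. F ((if fst z = 0 then {u'} else {}) \<union> (if snd z = 0 then {v'} else {}))}"
      unfolding F_def toric_param_def by (auto simp: case_prod_beta)
    also have "\<dots> = {z. (fst z = 0 \<longrightarrow> F {u'}) \<and> (snd z = 0 \<longrightarrow> F {v'}) \<and> (z = (0, 0) \<longrightarrow> F {u', v'})}"
      using F0 Fm[of "{u', v'}" "{u'}"] Fm[of "{u', v'}" "{v'}"] by (auto simp: insert_commute split: if_splits)
    finally show "open (\<phi>' ` (range (toric_param N u v) \<inter> U'))" using op by simp
  qed
qed

end

section \<open>Contraction of rays as a blow-up\<close>

lemma full_orbit:
  assumes d: "dual_pair N u v m n" and x: "x \<in> orbit_of_cone N (pos {u, v})"
  shows "(pos {u, v}, x) = fixed_point {u, v}"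
proof -
  have "m \<in> cone_semigroup N (pos {u, v})" "n \<in> cone_semigroup N (pos {u, v})"
    unfolding cone_semigroup_pos using dual_pair_dual_lattice[OF d] dual_pairD(3-6)[OF d] by auto
  hence "x m = 0" "x n = 0" using x[unfolded orbit_of_cone_pos] dual_pairD(3-6)[OF d] by auto
  thus ?thesis using toric_param_surj[OF d subset_refl x] fixed_point_toric_param[OF d] by simp
qed

text \<open>Additivity of characters collects the exponent k v on both a and b. The restriction on b
  is essential, since exponents may be negative and powers of 0 do not add.\<close>

lemma toric_param_blow_up:
  assumes d: "dual_pair N v v' m n" and b: "b \<noteq> 0"
  shows "toric_param N v (v + v') (a, b) = toric_param N v v' (a * b, b)"
proof -
  have "a powi \<lfloor>k v\<rfloor> * b powi \<lfloor>k (v + v')\<rfloor> = (a * b) powi \<lfloor>k v\<rfloor> * b powi \<lfloor>k v'\<rfloor>"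
    if k: "k \<in> dual_lattice N" for k
  proof -
    have "k (v + v') = k v + k v'" using dual_latticeD(1)[OF k] by (simp add: linear_add)
    hence "\<lfloor>k (v + v')\<rfloor> = \<lfloor>k v\<rfloor> + \<lfloor>k v'\<rfloor>"
      using dual_lattice_expand(2,3)[OF d k] by linarith
    thus ?thesis using b by (simp add: power_int_add power_int_mult_distrib)
  qed
  thus ?thesis unfolding toric_param_def using b by (auto simp: fun_eq_iff)
qed

text \<open>On the exceptional curve only characters vanishing at v + v' have nonzero values. Such a
  character takes opposite values at \<open>v\<close> and \<open>v'\<close>, so the two coordinates
  of a common point are inverse to each other.\<close>

lemma toric_param_exceptional_eq:
  assumes d: "dual_pair N v v' m n"
  shows "toric_param N v (v + v') (a, 0) = toric_param N v' (v + v') (a', 0) \<longleftrightarrow> a * a' = 1"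
proof
  have d1: "dual_pair N v (v + v') (\<lambda>x. m x - n x) n" using dual_pair_change[OF d, of 1 1] by simp
  have d2: "dual_pair N v' (v + v') (\<lambda>x. n x - m x) m"
    using dual_pair_change[OF dual_pair_sym[OF d], of 1 1] by (simp add: add.commute)
  note D = dual_pairD[OF d]
  have fl: "\<lfloor>k (v + v')\<rfloor> = \<lfloor>k v\<rfloor> + \<lfloor>k v'\<rfloor>" if k: "k \<in> dual_lattice N" for k
  proof -
    have "k (v + v') = k v + k v'" using dual_latticeD(1)[OF k] by (simp add: linear_add)
    thus ?thesis using dual_lattice_expand(2,3)[OF d k] by linarith
  qed
  {
    assume eq: "toric_param N v (v + v') (a, 0) = toric_param N v' (v + v') (a', 0)"
    \<comment> \<open>This character has values 1 at \<open>v\<close>, -1 at \<open>v'\<close> and 0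
      at the sum, so it reads off the coordinate along the exceptional curve.\<close>
    let ?k = "\<lambda>x. m x - n x"
    have k: "?k \<in> dual_lattice N" using dual_pair_dual_lattice[OF d] by (intro dual_lattice_diff)
    have "snd (toric_param N v (v + v') (a, 0)) ?k = snd (toric_param N v' (v + v') (a', 0)) ?k" using eq by simp
    hence "a = a' powi (-1)"
      unfolding toric_param_def using k D(1-6) by (simp add: linear_add floor_minus)
    hence e: "a = inverse a'" by (simp add: power_int_minus)
    \<comment> \<open>As \<open>inverse 0 = 0\<close>, the equation obtained so far allows a = a' =
      0. These two points lie in the orbits of different cones.\<close>
    have "a' \<noteq> 0"
    proof
      assume a': "a' = 0"
      hence "a = 0" using e by simp
      hence "pos {v, v + v'} = pos {v', v + v'}" using eq a' unfolding toric_param_def by simp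
      hence "{v, v + v'} = {v', v + v'}" by (rule pos_eq_imp_eq[OF d1 d2 subset_refl subset_refl])
      thus False using dual_pairD(9)[OF d1] D(9) by (auto simp: doubleton_eq_iff)
    qed
    thus "a * a' = 1" using e by simp
  }
  {
    assume aa: "a * a' = 1"
    hence nz: "a \<noteq> 0" "a' \<noteq> 0" by auto
    have "a powi \<lfloor>k v\<rfloor> * 0 powi \<lfloor>k (v + v')\<rfloor> = a' powi \<lfloor>k v'\<rfloor> * 0 powi \<lfloor>k (v + v')\<rfloor>"
      if k: "k \<in> dual_lattice N" for k
    proof (cases "\<lfloor>k (v + v')\<rfloor> = 0")
      case True
      hence "\<lfloor>k v'\<rfloor> = - \<lfloor>k v\<rfloor>" using fl[OF k] by simp
      moreover have "a' = inverse a" using aa nz by (simp add: field_simps)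
      ultimately have "a' powi \<lfloor>k v'\<rfloor> = a powi \<lfloor>k v\<rfloor>"
        by (simp add: power_int_minus power_int_inverse)
      thus ?thesis by simp
    qed simp
    thus "toric_param N v (v + v') (a, 0) = toric_param N v' (v + v') (a', 0)"
      unfolding toric_param_def using nz by (auto simp: fun_eq_iff)
  }
qed

context lattice_plane
begin

lemma toric_point_in_chart:
  assumes "dual_pair N u v m n" "{u, v} \<in> E" "y \<in> points (toric_surface N (fan_of E))"
    and "S \<subseteq> {u, v}" "fst y = pos S"
  shows "y \<in> range (toric_param N u v)"
proof -
  have "cone_face (pos S) (pos {u, v})" using pos_face_iff[OF assms(1) subset_refl] assms(4) by blast
  thus ?thesis unfolding toric_surface_chart(2)[OF assms(1,2)] using assms(3,5) by (cases y) simp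
qed

end

section \<open>The blow-down map on orbits and in charts\<close>

context contraction
begin

abbreviation "blown_down \<equiv> contracted E D"
abbreviation "Y \<equiv> toric_surface N (fan_of E)"
abbreviation "X \<equiv> toric_surface N (fan_of blown_down)"
abbreviation "proj \<equiv> toric_morphism N (fan_of blown_down) id"

definition centres :: "'a toric_point set" where
  "centres = {fixed_point {v, v'} | d v v'. d \<in> D \<and> blow_down_pair E d v v'}"

lemma blow_down_pair_dual_pairs:
  assumes "blow_down_pair E d v v'"
  obtains m n where "dual_pair N v v' m n" "dual_pair N v d (\<lambda>x. m x - n x) n" "d = v + v'"
    "{v, d} \<in> E" "v \<noteq> d"
proof -
  obtain m n where c: "dual_pair N v v' m n" using blow_down_pair_dual_pair[OF assms] .
  have d: "d = v + v'" "{v, d} \<in> E" using assms unfolding blow_down_pair_def by (auto simp: insert_commute)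
  have "dual_pair N v d (\<lambda>x. m x - n x) n" using dual_pair_change[OF c, of 1 1] d by simp
  thus thesis using that c d dual_pairD(9) by blast
qed

lemma blow_down_pair_not_subset:
  assumes "d \<in> D" "blow_down_pair E d v v'" "e \<in> E"
  shows "\<not> {v, v'} \<subseteq> e"
proof (cases "d \<in> e")
  case True
  obtain m n where "dual_pair N v v' m n" using blow_down_pair_dual_pair[OF assms(2)] .
  hence "v \<noteq> v'" by (rule dual_pairD)
  moreover have "v \<noteq> d" "v' \<noteq> d" using blow_down_pair_notin[OF assms(2,1)] assms(1) by auto
  ultimately show ?thesis using blow_down_pair_edges[OF assms(2,3) True] by blast
qed (rule blow_down_pair_Int(2)[OF assms(2,3)])

lemma blow_down_pair_contracted:
  "d \<in> D \<Longrightarrow> blow_down_pair E d v v' \<Longrightarrow> {v, v'} \<in> blown_down"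
  unfolding contracted_def by blast

lemma pos_in_contracted:
  assumes "S \<subseteq> e" "e \<in> E" "S \<inter> D = {}"
  shows "pos S \<in> fan_of blown_down"
  using contracted_subset[OF assms] fan_ofI by metis

lemma proj_id:
  assumes "\<tau> \<in> fan_of blown_down" "x \<in> orbit_of_cone N \<tau>"
  shows "proj (\<tau>, x) = (\<tau>, x)"
proof -
  have "\<Inter>{\<sigma> \<in> fan_of blown_down. id ` \<tau> \<subseteq> \<sigma>} = \<tau>" using assms(1) by auto
  moreover have "(\<lambda>m. if m \<in> cone_semigroup N \<tau> then x (m \<circ> id) else 0) = x"
    using assms(2) unfolding orbit_of_cone_def by auto
  ultimately show ?thesis unfolding toric_morphism_def by simp
qed

text \<open>As d = v + v' is interior to the merged cone, that cone is the smallest one containing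
  it. A character nonnegative at \<open>v\<close> and \<open>v'\<close> that vanishes at
  \<open>d\<close> vanishes at both and is zero. So every other character of the merged cone is 0 at
  \<open>x\<close>, which describes the fixed point.\<close>

lemma proj_exceptional:
  assumes d: "d \<in> D" "blow_down_pair E d v v'" and S: "S \<subseteq> e" "e \<in> E" "d \<in> S"
    and x: "x \<in> orbit_of_cone N (pos S)"
  shows "proj (pos S, x) = fixed_point {v, v'}"
proof -
  obtain m n where c: "dual_pair N v v' m n" "d = v + v'" using blow_down_pair_dual_pairs[OF d(2)] by metis
  note vE = blow_down_pair_contracted[OF d]
  note cb = complete_bases_contracted
  have mn: "m d = 1" "n d = 1" using dual_pairD(1-6)[OF c(1)] unfolding c(2) by (simp_all add: linear_add)
  have "e = {d, v} \<or> e = {d, v'}" using blow_down_pair_edges[OF d(2) S(2)] S(1,3) by blast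
  hence "pos e \<subseteq> pos {v, v'}" unfolding pos_blow_down_pair[OF d(2)] by auto
  hence sub: "pos S \<subseteq> pos {v, v'}" using hull_mono[OF S(1), of convex_cone] by blast
  have "\<Inter>{\<sigma> \<in> fan_of blown_down. id ` pos S \<subseteq> \<sigma>} = pos {v, v'}"
  proof (intro equalityI Inter_greatest)
    show "\<Inter>{\<sigma> \<in> fan_of blown_down. id ` pos S \<subseteq> \<sigma>} \<subseteq> pos {v, v'}"
      using sub fan_ofI[OF vE subset_refl] by (intro Inter_lower) simp
    fix \<sigma> assume "\<sigma> \<in> {\<sigma> \<in> fan_of blown_down. id ` pos S \<subseteq> \<sigma>}"
    hence \<sigma>: "\<sigma> \<in> fan_of blown_down" "d \<in> \<sigma>" using S(3) hull_inc[of d S convex_cone] by auto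
    obtain f T where f: "f \<in> blown_down" "T \<subseteq> f" "\<sigma> = pos T" using fan_ofE[OF \<sigma>(1)] .
    have "d \<in> pos {v, v'}" using mem_pos_pair(1)[OF c(1)] mn by simp
    hence "d \<in> pos ({v, v'} \<inter> T)"
      using complete_bases_pos_Int[OF cb vE f(1) subset_refl f(2)] \<sigma>(2) f(3) by blast
    hence "{v, v'} \<subseteq> T" unfolding pos_dual_pair[OF c(1) Int_lower1] using mn by (auto split: if_splits)
    thus "pos {v, v'} \<subseteq> \<sigma>" unfolding f(3) by (rule hull_mono)
  qed
  moreover have "(\<lambda>k. if k \<in> cone_semigroup N (pos {v, v'}) then x (k \<circ> id) else 0) = (\<lambda>k. if k = (\<lambda>w. 0) then 1 else 0)"
  proof
    fix k
    note X = x[unfolded orbit_of_cone_pos]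
    show "(if k \<in> cone_semigroup N (pos {v, v'}) then x (k \<circ> id) else 0) = (if k = (\<lambda>w. 0) then 1 else 0)"
    proof (cases "k \<in> cone_semigroup N (pos {v, v'})")
      case True
      hence k: "k \<in> dual_lattice N" "k v \<ge> 0" "k v' \<ge> 0" unfolding cone_semigroup_pos by auto
      have kS: "k \<in> cone_semigroup N (pos S)" using True sub unfolding cone_semigroup_def by auto
      show ?thesis
      proof (cases "k = (\<lambda>w. 0)")
        case True thus ?thesis using X \<open>k \<in> cone_semigroup N (pos {v, v'})\<close> by (simp add: o_def)
      next
        case False
        have "k d \<noteq> 0"
        proof
          assume "k d = 0"
          hence "k v = 0" "k v' = 0" using k dual_latticeD(1)[OF k(1)] unfolding c(2) by (auto simp: linear_add)
          hence "k = (\<lambda>w. 0)" using dual_lattice_expand(1)[OF c(1) k(1)] by simp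
          thus False using False by simp
        qed
        hence "x k = 0" using X kS S(3) by blast
        thus ?thesis using False by simp
      qed
    next
      case False
      hence "k \<noteq> (\<lambda>w. 0)" unfolding cone_semigroup_pos using zero_dual_lattice by auto
      thus ?thesis using False by simp
    qed
  qed
  ultimately show ?thesis unfolding toric_morphism_def fixed_point_def by (simp only: prod.case Let_def)
qed

lemma proj_toric_param:
  assumes d: "d \<in> D" "blow_down_pair E d v v'"
  shows "proj (toric_param N v d (a, b)) = toric_param N v v' (a * b, b)"
proof -
  obtain m n where c: "dual_pair N v v' m n" "dual_pair N v d (\<lambda>x. m x - n x) n" "d = v + v'"
    "{v, d} \<in> E" "v \<noteq> d" using blow_down_pair_dual_pairs[OF d(2)] .
  define S where "S = (if a = 0 then {v} else {}) \<union> (if b = 0 then {d} else {})"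
  define x where "x = snd (toric_param N v d (a, b))"
  have y: "toric_param N v d (a, b) = (pos S, x)" unfolding x_def S_def toric_param_def by simp
  have x: "x \<in> orbit_of_cone N (pos S)" using toric_param_orbit[OF c(2), of "(a, b)"] unfolding y by simp
  have S: "S \<subseteq> {v, d}" unfolding S_def by auto
  show ?thesis
  proof (cases "b = 0")
    case True
    hence "d \<in> S" unfolding S_def by simp
    from proj_exceptional[OF d S c(4) this x] show ?thesis
      unfolding y fixed_point_toric_param[OF c(1)] using True by simp
  next
    case False
    hence "S \<inter> D = {}" using blow_down_pair_notin[OF d(2,1)] unfolding S_def by auto
    from proj_id[OF pos_in_contracted[OF S c(4) this] x] show ?thesis
      unfolding y using toric_param_blow_up[OF c(1) False, of a] y c(3) by simp
  qed
qed

lemma toric_param_in_centres: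
  assumes d: "d \<in> D" "blow_down_pair E d v v'"
  shows "toric_param N v v' (a, b) \<in> centres \<longleftrightarrow> a = 0 \<and> b = 0"
proof
  obtain m n where c: "dual_pair N v v' m n" using blow_down_pair_dual_pair[OF d(2)] .
  show "toric_param N v v' (a, b) \<in> centres" if "a = 0 \<and> b = 0"
    unfolding centres_def using that fixed_point_toric_param[OF c, symmetric] d
    by (intro CollectI exI[of _ d] exI[of _ v] exI[of _ v']) simp
  assume "toric_param N v v' (a, b) \<in> centres"
  then obtain t w w' where t: "t \<in> D" "blow_down_pair E t w w'" "toric_param N v v' (a, b) = fixed_point {w, w'}"
    unfolding centres_def by blast
  obtain m' n' where c': "dual_pair N w w' m' n'" using blow_down_pair_dual_pair[OF t(2)] .
  let ?S = "(if a = 0 then {v} else {}) \<union> (if b = 0 then {v'} else {})"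
  have "pos ?S = pos {w, w'}" using t(3) unfolding toric_param_def fixed_point_def by simp
  moreover have "?S \<subseteq> {v, v'}" by auto
  ultimately have "?S = {w, w'}" using pos_eq_imp_eq[OF c c' _ subset_refl] by blast
  moreover have "w \<noteq> w'" using c' by (rule dual_pairD)
  ultimately show "a = 0 \<and> b = 0" by (auto split: if_splits)
qed

lemma proj_cases:
  assumes y: "y \<in> points Y"
  obtains "fst y \<in> fan_of blown_down" "proj y = y" "proj y \<notin> centres"
  | d v v' where "d \<in> D" "blow_down_pair E d v v'" "y \<in> range (toric_param N v d)"
     "proj y = fixed_point {v, v'}" "proj y \<in> centres"
proof -
  obtain \<tau> x where yx: "y = (\<tau>, x)" "\<tau> \<in> fan_of E" "x \<in> orbit_of_cone N \<tau>"
    using y by (cases y) (simp add: points_toric_surface)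
  obtain e S where e: "e \<in> E" "S \<subseteq> e" "\<tau> = pos S" using fan_ofE[OF yx(2)] .
  show thesis
  proof (cases "S \<inter> D = {}")
    case True
    have f: "pos S \<in> fan_of blown_down" using pos_in_contracted[OF e(2,1) True] .
    have p: "proj y = y" using proj_id[OF f] yx e(3) by simp
    moreover have "y \<notin> centres"
    proof
      assume "y \<in> centres"
      then obtain t w w' where t: "t \<in> D" "blow_down_pair E t w w'" "pos S = pos {w, w'}"
        unfolding centres_def fixed_point_def using yx(1) e(3) by auto
      obtain m' n' where c': "dual_pair N w w' m' n'" using blow_down_pair_dual_pair[OF t(2)] .
      have "S = {w, w'}"
        by (rule lattice_basis_pos_inj[OF complete_basesD(2)[OF E e(1)] e(2) dual_pair_lattice_basis[OF c'] subset_refl t(3)])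
      thus False using blow_down_pair_not_subset[OF t(1,2) e(1)] e(2) by simp
    qed
    ultimately show thesis using that(1) f yx(1) e(3) by simp
  next
    case False
    have "e \<inter> D \<noteq> {}" using e(2) False by blast
    then obtain d v v' where b: "d \<in> D" "blow_down_pair E d v v'" "e = {v, d}"
      using blow_down_edge[OF e(1)] by blast
    have d: "d \<in> D" "d \<in> S" using b blow_down_pair_notin[OF b(2,1)] False e(2) by auto
    note b = b(2,3)
    obtain m n where c: "dual_pair N v d (\<lambda>x. m x - n x) n" "{v, d} \<in> E"
      using blow_down_pair_dual_pairs[OF b(1)] .
    have "y \<in> range (toric_param N v d)"
      by (rule toric_point_in_chart[OF c y, of S]) (use e b(2) yx(1) in auto)
    moreover have p: "proj y = fixed_point {v, v'}"
      using proj_exceptional[OF d(1) b(1) e(2,1) d(2)] yx e(3) by simp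
    moreover have "proj y \<in> centres" unfolding p centres_def using d(1) b(1) by blast
    ultimately show thesis using that(2) d(1) b(1) by blast
  qed
qed

text \<open>Points are tagged with their cone, so off the centres the two surfaces have literally
  the same points. The only cones of the contracted fan that are missing from \<open>E\<close> are
  the merged ones, and by \<open>full_orbit\<close> the orbit of each is a single centre.\<close>

lemma off_centres:
  "{y \<in> points Y. proj y \<notin> centres} = points X - centres"
  (is "?W = _")
proof (intro equalityI subsetI)
  fix y assume y: "y \<in> ?W"
  hence "y \<in> points Y" by simp
  then show "y \<in> points X - centres"
  proof (cases rule: proj_cases)
    case 1
    obtain \<tau> x where yx: "y = (\<tau>, x)" by (cases y)
    show ?thesis using 1 y unfolding yx by (simp add: points_toric_surface)
  qed (use y in simp)
next
  fix y assume y: "y \<in> points X - centres"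
  obtain \<tau> x where yx: "y = (\<tau>, x)" "\<tau> \<in> fan_of blown_down" "x \<in> orbit_of_cone N \<tau>"
    using y by (cases y) (simp add: points_toric_surface)
  obtain f S where f: "f \<in> blown_down" "S \<subseteq> f" "\<tau> = pos S" using fan_ofE[OF yx(2)] .
  have "\<tau> \<in> fan_of E"
    using f(1)
  proof (cases rule: contractedE)
    case 1 thus ?thesis using fan_ofI[OF 1(1) f(2)] f(3) by simp
  next
    case (2 d v v')
    obtain m n where c: "dual_pair N v v' m n" using blow_down_pair_dual_pair[OF 2(2)] .
    have e: "{d, v} \<in> E" "{d, v'} \<in> E" using 2(2) unfolding blow_down_pair_def by auto
    have "S \<noteq> {v, v'}"
    proof
      assume S: "S = {v, v'}"
      have "y = fixed_point {v, v'}" using full_orbit[OF c] yx f(3) S by simp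
      thus False using y 2(1,2) unfolding centres_def by blast
    qed
    hence "S \<subseteq> {d, v} \<or> S \<subseteq> {d, v'}" using f(2) 2(3) by auto
    thus ?thesis using fan_ofI[OF e(1), of S] fan_ofI[OF e(2), of S] f(3) by auto
  qed
  hence "y \<in> points Y" using yx by (simp add: points_toric_surface)
  moreover have "proj y = y" using proj_id yx by simp
  ultimately show "y \<in> ?W" using y by simp
qed

end

lemma fst_toric_param:
  obtains S where "S \<subseteq> {u, v}" "fst (toric_param N u v z) = pos S"
proof (rule that)
  show "(if fst z = 0 then {u} else {}) \<union> (if snd z = 0 then {v} else {}) \<subseteq> {u, v}" by auto
qed (simp add: toric_param_def case_prod_beta)

context contraction
begin

lemma off_centresD:
  assumes "y \<in> points X - centres"
  shows "y \<in> points Y" "y \<in> points X" "proj y = y"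
proof -
  have "y \<in> {y \<in> points Y. proj y \<notin> centres}" using assms off_centres by blast
  hence y: "y \<in> points Y" "proj y \<notin> centres" by auto
  thus "y \<in> points Y" by simp
  show "y \<in> points X" using assms by simp
  show "proj y = y" using y(1) by (cases rule: proj_cases) (use y(2) in auto)
qed

text \<open>A cone avoiding \<open>D\<close> gives one and the same chart on both surfaces, in which
  the blow-down map is the identity.\<close>

lemma undisturbed_chart:
  assumes d: "dual_pair N u v m n" and e: "{u, v} \<in> E" "{u, v} \<inter> D = {}"
  shows "{u, v} \<in> blown_down" "toric_param N u v z \<in> points X - centres"
proof -
  show uv: "{u, v} \<in> blown_down" using e unfolding contracted_def by blast
  have k: "toric_param N u v z \<in> points Y" "toric_param N u v z \<in> points X"
    using parametrization_toric_param[OF d e(1)] parametrization_toric_param[OF d uv]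
    unfolding parametrization_def by blast+
  have "fst (toric_param N u v z) \<in> fan_of blown_down"
    using fst_toric_param[of u v N z] fan_ofI[OF uv] by metis
  hence "proj (toric_param N u v z) = toric_param N u v z"
    using proj_id toric_param_orbit[OF d] by (metis prod.collapse)
  moreover have "toric_param N u v z \<notin> centres"
  proof
    assume "toric_param N u v z \<in> centres"
    then obtain t w w' where t: "t \<in> D" "blow_down_pair E t w w'" "toric_param N u v z = fixed_point {w, w'}"
      unfolding centres_def by blast
    obtain m' n' where c': "dual_pair N w w' m' n'" using blow_down_pair_dual_pair[OF t(2)] .
    obtain S where S: "S \<subseteq> {u, v}" "fst (toric_param N u v z) = pos S" using fst_toric_param .
    have "pos S = pos {w, w'}" using t(3) S(2) unfolding fixed_point_def by simp
    hence "S = {w, w'}" by (rule pos_eq_imp_eq[OF d c' S(1) subset_refl])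
    thus False using blow_down_pair_not_subset[OF t(1,2) e(1)] S(1) by blast
  qed
  ultimately show "toric_param N u v z \<in> points X - centres" using k by simp
qed

lemma proj_holomorphic: "holomorphic_map_on Y (points Y) X proj"
proof (rule holomorphic_map_onI[OF subset_refl])
  fix y assume y: "y \<in> points Y"
  obtain S u v m n z where p: "{u, v} \<in> E" "dual_pair N u v m n" "S \<subseteq> {u, v}" "fst y = pos S"
    "y = toric_param N u v z" using toric_point_param[OF E y] .
  show "holomorphic_near Y (points Y) X proj y"
  proof (cases "{u, v} \<inter> D = {}")
    case True
    note u = undisturbed_chart[OF p(2,1) True]
    show ?thesis
      using parametrization_toric_param[OF p(2,1)] parametrization_toric_param[OF p(2) u(1)]
        off_centresD(1,3)[OF u(2)] holomorphic2_on_id p(5)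
      by (intro holomorphic_nearI[of _ "toric_param N u v" _ "toric_param N u v" UNIV "\<lambda>z. z" z]) auto
  next
    case False
    then obtain d t t' where d: "d \<in> D" and b: "blow_down_pair E d t t'" "{u, v} = {t, d}"
      using blow_down_edge[OF p(1)] by blast
    obtain i j where c: "dual_pair N t d i j" "{t, d} \<in> E" using blow_down_pair_dual_pairs[OF b(1)] by metis
    obtain i' j' where c': "dual_pair N t t' i' j'" using blow_down_pair_dual_pair[OF b(1)] .
    have "y \<in> range (toric_param N t d)"
      by (rule toric_point_in_chart[OF c y _ p(4)]) (use p(3) b(2) in simp)
    then obtain z' where z': "y = toric_param N t d z'" by blast
    have k: "parametrization Y (toric_param N t d)" by (rule parametrization_toric_param[OF c])
    have l: "parametrization X (toric_param N t t')"
      by (rule parametrization_toric_param[OF c' blow_down_pair_contracted[OF d b(1)]])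
    have "range (toric_param N t d) \<subseteq> points Y" using k unfolding parametrization_def by blast
    moreover have "proj (toric_param N t d w) = toric_param N t t' (fst w * snd w, snd w)" for w
      using proj_toric_param[OF d b(1), of "fst w" "snd w"] by simp
    ultimately show ?thesis using k l holomorphic2_on_mult[of UNIV] z'
      by (intro holomorphic_nearI[of _ "toric_param N t d" _ "toric_param N t t'" UNIV "\<lambda>z. (fst z * snd z, snd z)" z']) auto
  qed
qed

lemma blow_down_chart:
  assumes d: "d \<in> D" "blow_down_pair E d v v'" and b: "b \<noteq> 0"
  shows "toric_param N v v' (a * b, b) = toric_param N v d (a, b)"
    "toric_param N v v' (a, b) \<in> points X - centres"
proof -
  obtain m n where c: "dual_pair N v v' m n" "d = v + v'" using blow_down_pair_dual_pairs[OF d(2)] by metis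
  show "toric_param N v v' (a * b, b) = toric_param N v d (a, b)"
    using toric_param_blow_up[OF c(1) b] c(2) by simp
  have "toric_param N v v' (a, b) \<in> points X"
    using parametrization_toric_param[OF c(1) blow_down_pair_contracted[OF d]] unfolding parametrization_def by blast
  thus "toric_param N v v' (a, b) \<in> points X - centres" using toric_param_in_centres[OF d] b by simp
qed

lemma open_snd_nonzero: "open {z :: complex \<times> complex. snd z \<noteq> 0}"
  by (intro open_Collect_neq continuous_intros)

text \<open>Set-theoretically the map is the identity; holomorphy has to be checked because the
  charts differ. Near a contracted ray one works where the second coordinate is nonzero, where
  multiplication by it and division by it are mutually inverse.\<close>

lemma proj_biholomorphic_off_centres:
  "biholomorphic_on Y {y \<in> points Y. proj y \<notin> centres} X (points X - centres) proj"
  unfolding off_centres biholomorphic_on_def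
proof (intro conjI)
  let ?W = "points X - centres"
  have id: "proj y = y" if "y \<in> ?W" for y using off_centresD(3)[OF that] .
  have inj: "inj_on proj ?W" using id by (intro inj_onI) metis
  moreover have "proj ` ?W = (\<lambda>y. y) ` ?W" by (rule image_cong) (use id in auto)
  hence "proj ` ?W = ?W" by simp
  ultimately show "bij_betw proj ?W ?W" unfolding bij_betw_def by simp
  have inv: "inv_into ?W proj y = y" if "y \<in> ?W" for y
    using inv_into_f_f[OF inj that] id[OF that] by simp
  show "holomorphic_map_on Y ?W X proj"
  proof (rule holomorphic_map_onI)
    show "?W \<subseteq> points Y" using off_centresD(1) by blast
    fix y assume y: "y \<in> ?W"
    obtain S u v m n z where p: "{u, v} \<in> E" "dual_pair N u v m n" "S \<subseteq> {u, v}" "fst y = pos S"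
      "y = toric_param N u v z" using toric_point_param[OF E off_centresD(1)[OF y]] .
    show "holomorphic_near Y ?W X proj y"
    proof (cases "{u, v} \<inter> D = {}")
      case True
      note u = undisturbed_chart[OF p(2,1) True]
      show ?thesis
        using parametrization_toric_param[OF p(2,1)] parametrization_toric_param[OF p(2) u(1)] u(2) id[OF u(2)]
          holomorphic2_on_id p(5)
        by (intro holomorphic_nearI[of _ "toric_param N u v" _ "toric_param N u v" UNIV "\<lambda>z. z" z]) auto
    next
      case False
      then obtain d t t' where d: "d \<in> D" and b: "blow_down_pair E d t t'" "{u, v} = {t, d}"
        using blow_down_edge[OF p(1)] by blast
      obtain i j where c: "dual_pair N t d i j" "{t, d} \<in> E" using blow_down_pair_dual_pairs[OF b(1)] by metis
      obtain i' j' where c': "dual_pair N t t' i' j'" using blow_down_pair_dual_pair[OF b(1)] .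
      have "y \<in> range (toric_param N t d)"
        by (rule toric_point_in_chart[OF c off_centresD(1)[OF y] _ p(4)]) (use p(3) b(2) in simp)
      then obtain z' where z': "y = toric_param N t d z'" by blast
      have pr: "proj (toric_param N t d z) = toric_param N t t' (fst z * snd z, snd z)" for z
        using proj_toric_param[OF d b(1), of "fst z" "snd z"] by simp
      have "snd z' \<noteq> 0"
      proof
        assume "snd z' = 0"
        hence "y \<in> centres"
          using pr[of z'] id[OF y] z' toric_param_in_centres[OF d b(1), of 0 0] by simp
        thus False using y by simp
      qed
      moreover have "toric_param N t d z \<in> ?W" if "snd z \<noteq> 0" for z
        using blow_down_chart[OF d b(1) that, of "fst z"] blow_down_chart(2)[OF d b(1) that, of "fst z * snd z"] by simp
      ultimately show ?thesis
        using parametrization_toric_param[OF c]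
          parametrization_toric_param[OF c' blow_down_pair_contracted[OF d b(1)]]
          holomorphic2_on_mult[of "{z. snd z \<noteq> 0}"] z' pr open_snd_nonzero
        by (intro holomorphic_nearI[of _ "toric_param N t d" _ "toric_param N t t'" "{z. snd z \<noteq> 0}" "\<lambda>z. (fst z * snd z, snd z)" z']) auto
    qed
  qed
  show "holomorphic_map_on X ?W Y (inv_into ?W proj)"
  proof (rule holomorphic_map_onI)
    show "?W \<subseteq> points X" by blast
    fix y assume y: "y \<in> ?W"
    obtain S u v m n z where p: "{u, v} \<in> blown_down" "dual_pair N u v m n" "S \<subseteq> {u, v}" "fst y = pos S"
      "y = toric_param N u v z" using toric_point_param[OF complete_bases_contracted off_centresD(2)[OF y]] .
    show "holomorphic_near X ?W Y (inv_into ?W proj) y"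
      using p(1)
    proof (cases rule: contractedE)
      case 1
      note u = undisturbed_chart[OF p(2) 1]
      show ?thesis
        using parametrization_toric_param[OF p(2) 1(1)] parametrization_toric_param[OF p(2) u(1)] u(2) inv[OF u(2)]
          holomorphic2_on_id p(5)
        by (intro holomorphic_nearI[of _ "toric_param N u v" _ "toric_param N u v" UNIV "\<lambda>z. z" z]) auto
    next
      case (2 d w w')
      obtain i j where cw: "dual_pair N w w' i j" using blow_down_pair_dual_pair[OF 2(2)] .
      have "y \<in> range (toric_param N w w')"
        by (rule toric_point_in_chart[OF cw _ off_centresD(2)[OF y] _ p(4)]) (use p(1,3) 2(3) in simp_all)
      then obtain a b where ab: "y = toric_param N w w' (a, b)" by auto
      \<comment> \<open>The only centre in this chart is the origin. Exchanging \<open>w\<close> and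
        \<open>w'\<close> if necessary makes the second coordinate nonzero.\<close>
      have "a \<noteq> 0 \<or> b \<noteq> 0" using y toric_param_in_centres[OF 2(1,2), of a b] ab by blast
      then obtain t t' z' where t: "blow_down_pair E d t t'" "y = toric_param N t t' z'" "snd z' \<noteq> 0"
        using 2(2) blow_down_pair_sym[OF 2(2)] ab toric_param_swap[of N w w' a b] by (metis snd_conv)
      obtain i j where c: "dual_pair N t d i j" "{t, d} \<in> E" using blow_down_pair_dual_pairs[OF t(1)] by metis
      obtain i' j' where c': "dual_pair N t t' i' j'" using blow_down_pair_dual_pair[OF t(1)] .
      have W: "toric_param N t t' z \<in> ?W" "toric_param N t t' z = toric_param N t d (fst z / snd z, snd z)"
        if "snd z \<noteq> 0" for z
        using blow_down_chart(2)[OF 2(1) t(1) that, of "fst z"] blow_down_chart(1)[OF 2(1) t(1) that, of "fst z / snd z"] that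
        by simp_all
      show ?thesis
        using parametrization_toric_param[OF c]
          parametrization_toric_param[OF c' blow_down_pair_contracted[OF 2(1) t(1)]]
          holomorphic2_on_divide t(2,3) W inv[OF W(1)] open_snd_nonzero
        by (intro holomorphic_nearI[of _ "toric_param N t t'" _ "toric_param N t d" "{z. snd z \<noteq> 0}" "\<lambda>z. (fst z / snd z, snd z)" z']) auto
    qed
  qed
qed

text \<open>A point outside the exceptional curves keeps its cone, which cannot have both
  \<open>v\<close> and \<open>v'\<close> as generators and is therefore a face of one half. A point
  over a centre of this chart lies over the one of \<open>d\<close>, since the pair of generators
  determines its sum.\<close>

lemma preimage_of_chart:
  assumes d: "d \<in> D" "blow_down_pair E d v v'"
  shows "{y \<in> points Y. proj y \<in> range (toric_param N v v')} =
    range (toric_param N v d) \<union> range (toric_param N v' d)"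
proof -
  note b' = blow_down_pair_sym[OF d(2)]
  obtain m n where c: "dual_pair N v d m n" "{v, d} \<in> E" using blow_down_pair_dual_pairs[OF d(2)] by metis
  obtain m' n' where c': "dual_pair N v' d m' n'" "{v', d} \<in> E" using blow_down_pair_dual_pairs[OF b'] by metis
  obtain i j where cv: "dual_pair N v v' i j" using blow_down_pair_dual_pair[OF d(2)] .
  have rs: "range (toric_param N v' v) = range (toric_param N v v')"
    using toric_param_swap[of N v' v] toric_param_swap[of N v v'] by (auto simp: image_iff) (metis+)
  show ?thesis
  proof (intro equalityI subsetI)
    fix y assume "y \<in> range (toric_param N v d) \<union> range (toric_param N v' d)"
    moreover have "range (toric_param N v d) \<subseteq> points Y" "range (toric_param N v' d) \<subseteq> points Y"
      using parametrization_toric_param[OF c] parametrization_toric_param[OF c'] unfolding parametrization_def by auto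
    moreover have "proj (toric_param N v d z) \<in> range (toric_param N v v')"
      "proj (toric_param N v' d z) \<in> range (toric_param N v v')" for z
      using proj_toric_param[OF d, of "fst z" "snd z"] proj_toric_param[OF d(1) b', of "fst z" "snd z"] rs by auto
    ultimately show "y \<in> {y \<in> points Y. proj y \<in> range (toric_param N v v')}" by blast
  next
    fix y assume "y \<in> {y \<in> points Y. proj y \<in> range (toric_param N v v')}"
    hence y: "y \<in> points Y" and py: "proj y \<in> range (toric_param N v v')" by auto
    obtain z where z: "proj y = toric_param N v v' z" using py by blast
    obtain T where T: "T \<subseteq> {v, v'}" "fst (proj y) = pos T"
      using fst_toric_param[of v v' N z] unfolding z .
    show "y \<in> range (toric_param N v d) \<union> range (toric_param N v' d)"
      using y
    proof (cases rule: proj_cases)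
      case 1
      obtain S p q k l z where p: "{p, q} \<in> E" "dual_pair N p q k l" "S \<subseteq> {p, q}" "fst y = pos S"
        using toric_point_param[OF E y] by metis
      have "pos S = pos T" using p(4) T(2) 1 by simp
      hence ST: "S = T" by (rule pos_eq_imp_eq[OF p(2) cv p(3) T(1)])
      have "\<not> {v, v'} \<subseteq> {p, q}" by (rule blow_down_pair_not_subset[OF d p(1)])
      hence "S \<subseteq> {v} \<or> S \<subseteq> {v'}" using T(1) ST p(3) by blast
      thus ?thesis
        using toric_point_in_chart[OF c y _ p(4)] toric_point_in_chart[OF c' y _ p(4)] by blast
    next
      case (2 t w w')
      obtain k l where cw: "dual_pair N w w' k l" using blow_down_pair_dual_pair[OF 2(2)] .
      have "pos {w, w'} = pos T" using 2(4) T(2) unfolding fixed_point_def by simp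
      hence "{w, w'} = T" by (rule pos_eq_imp_eq[OF cw cv subset_refl T(1)])
      moreover have "w \<noteq> w'" using cw by (rule dual_pairD)
      ultimately have ww: "w = v \<and> w' = v' \<or> w = v' \<and> w' = v" using T(1) by auto
      have "t = w + w'" "d = v + v'" using 2(2) d(2) unfolding blow_down_pair_def by auto
      hence "t = d" using ww by (auto simp: add.commute)
      thus ?thesis using 2(3) ww by auto
    qed
  qed
qed

text \<open>\<open>U\<close> is the whole affine chart of the merged cone and \<open>B\<close> the
  whole plane. The preimage of \<open>U\<close> consists of the charts of the two halves, matched
  with the two charts of \<open>Bl0_C2\<close>. The transitions agree off the exceptional curve
  because both blow-down maps are injective there, and on it by
  \<open>toric_param_exceptional_eq\<close>.\<close>

lemma proj_local_blow_up:
  assumes d: "d \<in> D" "blow_down_pair E d v v'"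
  shows "\<exists>U B \<phi> \<psi>. open_in_surface X U \<and> U \<inter> centres = {fixed_point {v, v'}} \<and> open B \<and>
        biholomorphic_on X U C2 B \<phi> \<and> \<phi> (fixed_point {v, v'}) = (0, 0) \<and>
        biholomorphic_on Y {y \<in> points Y. proj y \<in> U} Bl0_C2 {q \<in> points Bl0_C2. fst q \<in> B} \<psi> \<and>
        (\<forall>y\<in>points Y. proj y \<in> U \<longrightarrow> fst (\<psi> y) = \<phi> (proj y))"
proof -
  note b' = blow_down_pair_sym[OF d(2)]
  obtain m n where cv: "dual_pair N v v' m n" "dual_pair N v d (\<lambda>x. m x - n x) n" "d = v + v'" "{v, d} \<in> E"
    using blow_down_pair_dual_pairs[OF d(2)] by metis
  obtain m' n' where cv': "dual_pair N v' d m' n'" "{v', d} \<in> E"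
    using blow_down_pair_dual_pairs[OF b'] by metis
  note vE = blow_down_pair_contracted[OF d]
  define \<phi> where "\<phi> = (\<lambda>(\<tau> :: 'a set, x :: ('a \<Rightarrow> real) \<Rightarrow> complex). (x m, x n))"
  have \<phi>: "\<phi> (toric_param N v v' z) = z" for z unfolding \<phi>_def by (rule toric_param_coords[OF cv(1)])
  have sw: "toric_param N v' v z = toric_param N v v' (prod.swap z)" for z
    using toric_param_swap[of N v' v "fst z" "snd z"] by (simp add: prod.swap_def)
  have pr: "proj (toric_param N v d z) = toric_param N v v' (fst z * snd z, snd z)"
    "proj (toric_param N v' d z) = toric_param N v v' (snd z, fst z * snd z)" for z
    using proj_toric_param[OF d, of "fst z" "snd z"] proj_toric_param[OF d(1) b', of "fst z" "snd z"] sw by simp_all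
  have glue: "toric_param N v d z = toric_param N v' d w \<longleftrightarrow> bl0_chart2 z = bl0_chart1 (prod.swap w)" for z w
  proof (cases z; cases w)
    fix a b a' b' assume zw: "z = (a, b)" "w = (a', b')"
    have R: "bl0_chart2 z = bl0_chart1 (prod.swap w) \<longleftrightarrow> a * b = b' \<and> b = b' * a' \<and> a * a' = 1"
      unfolding zw by (simp add: bl0_chart_eq)
    \<comment> \<open>Equal points have equal images under \<open>proj\<close>, and
      \<open>\<phi>\<close> recovers the coordinates of the image.\<close>
    have L: "a * b = b' \<and> b = a' * b'" if "toric_param N v d z = toric_param N v' d w"
    proof -
      have "toric_param N v v' (a * b, b) = toric_param N v v' (b', a' * b')"
        using arg_cong[OF that, of proj] pr zw by simp
      thus ?thesis using \<phi> by (metis prod.inject)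
    qed
    show "toric_param N v d z = toric_param N v' d w \<longleftrightarrow> bl0_chart2 z = bl0_chart1 (prod.swap w)"
    proof (cases "b = 0 \<or> b' = 0")
      case True
      have ex: "toric_param N v d (a, 0) = toric_param N v' d (a', 0) \<longleftrightarrow> a * a' = 1"
        using toric_param_exceptional_eq[OF cv(1)] cv(3) by simp
      show ?thesis
      proof (cases "b = 0 \<and> b' = 0")
        case True thus ?thesis unfolding R using ex zw by simp
      next
        case False
        thus ?thesis unfolding R using L True by auto
      qed
    next
      case False
      have "toric_param N v d z = toric_param N v v' (a * b, b)"
        using blow_down_chart(1)[OF d, of b a] False zw by simp
      moreover have "toric_param N v' d w = toric_param N v v' (b', a' * b')"
        using blow_down_chart(1)[OF d(1) b', of b' a'] False zw sw by simp
      ultimately have "toric_param N v d z = toric_param N v' d w \<longleftrightarrow> a * b = b' \<and> b = a' * b'"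
        using \<phi> by (metis prod.inject)
      also have "\<dots> \<longleftrightarrow> a * b = b' \<and> b = b' * a' \<and> a * a' = 1"
      proof -
        have "a * a' = 1" if "a * b = b'" "b = a' * b'"
        proof -
          have "b * (a * a') = b * 1" using that by (simp add: algebra_simps)
          thus ?thesis using False by (metis mult_left_cancel)
        qed
        thus ?thesis by (auto simp: mult.commute)
      qed
      finally show ?thesis unfolding R .
    qed
  qed
  obtain \<psi> where \<psi>: "biholomorphic_on Y (range (toric_param N v d) \<union> range (toric_param N v' d)) Bl0_C2
      (range bl0_chart2 \<union> range bl0_chart1) \<psi>"
    "\<And>z. \<psi> (toric_param N v d z) = bl0_chart2 z" "\<And>z. \<psi> (toric_param N v' d z) = bl0_chart1 (prod.swap z)"
    using biholomorphic_on_glue[OF parametrization_toric_param[OF cv(2,4)] parametrization_toric_param[OF cv']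
      parametrization_bl0_chart2 parametrization_bl0_chart1 glue] by blast
  let ?U = "range (toric_param N v v')"
  have "open_in_surface X ?U" by (rule open_toric_chart[OF complete_bases_contracted vE cv(1)])
  moreover have "?U \<inter> centres = {fixed_point {v, v'}}"
    using toric_param_in_centres[OF d] fixed_point_toric_param[OF cv(1)] by auto
  moreover have "biholomorphic_on X ?U C2 UNIV \<phi>"
    by (rule biholomorphic_on_parametrization[OF parametrization_toric_param[OF cv(1) vE] \<phi>])
  moreover have "\<phi> (fixed_point {v, v'}) = (0, 0)" using \<phi> fixed_point_toric_param[OF cv(1)] by simp
  moreover have "biholomorphic_on Y {y \<in> points Y. proj y \<in> ?U} Bl0_C2 {q \<in> points Bl0_C2. fst q \<in> UNIV} \<psi>"
    using \<psi>(1) unfolding preimage_of_chart[OF d] points_Bl0_C2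
    by (simp only: Un_commute UNIV_I simp_thms Collect_mem_eq)
  moreover have "fst (\<psi> y) = \<phi> (proj y)" if "y \<in> points Y" "proj y \<in> ?U" for y
  proof -
    have "y \<in> range (toric_param N v d) \<union> range (toric_param N v' d)"
      using that preimage_of_chart[OF d] by blast
    thus ?thesis
    proof (elim UnE rangeE)
      fix z assume "y = toric_param N v d z"
      thus ?thesis using \<psi>(2) pr(1) \<phi> by (simp add: bl0_chart2_def)
    next
      fix z assume "y = toric_param N v' d z"
      thus ?thesis using \<psi>(3) pr(2) \<phi> by (simp add: bl0_chart1_def mult.commute)
    qed
  qed
  ultimately show ?thesis by (intro exI[of _ ?U] exI[of _ UNIV] exI[of _ \<phi>] exI[of _ \<psi>]) auto
qed

theorem toric_blow_up_contracted:
  "toric_blow_up N (fan_of blown_down) centres (fan_of E)"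
  unfolding toric_blow_up_def blow_up_along_def
proof (intro conjI ballI)
  show "complete_smooth_fan N (fan_of blown_down)" by (rule complete_smooth_fan_fan_of[OF complete_bases_contracted])
  show "complete_smooth_fan N (fan_of E)" by (rule complete_smooth_fan_fan_of[OF E])
  show "centres \<subseteq> points X"
  proof
    fix a assume "a \<in> centres"
    then obtain d v v' where d: "d \<in> D" "blow_down_pair E d v v'" "a = fixed_point {v, v'}"
      unfolding centres_def by blast
    obtain m n where c: "dual_pair N v v' m n" using blow_down_pair_dual_pair[OF d(2)] .
    show "a \<in> points X"
      using parametrization_toric_param[OF c blow_down_pair_contracted[OF d(1,2)]] d(3) fixed_point_toric_param[OF c]
      unfolding parametrization_def by auto
  qed
  show "holomorphic_map_on Y (points Y) X proj" by (rule proj_holomorphic)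
  show "biholomorphic_on Y {y \<in> points Y. proj y \<notin> centres} X (points X - centres) proj"
    by (rule proj_biholomorphic_off_centres)
next
  fix a assume "a \<in> centres"
  then obtain d v v' where d: "d \<in> D" "blow_down_pair E d v v'" "a = fixed_point {v, v'}"
    unfolding centres_def by blast
  show "\<exists>U B \<phi> \<psi>. open_in_surface X U \<and> U \<inter> centres = {a} \<and> open B \<and>
        biholomorphic_on X U C2 B \<phi> \<and> \<phi> a = (0, 0) \<and>
        biholomorphic_on Y {y \<in> points Y. proj y \<in> U} Bl0_C2 {q \<in> points Bl0_C2. fst q \<in> B} \<psi> \<and>
        (\<forall>y\<in>points Y. proj y \<in> U \<longrightarrow> fst (\<psi> y) = \<phi> (proj y))"
    unfolding d(3) by (rule proj_local_blow_up[OF d(1,2)])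
next
  fix \<tau> assume "\<tau> \<in> fan_of E"
  then obtain e S where e: "e \<in> E" "S \<subseteq> e" "\<tau> = pos S" by (rule fan_ofE)
  have "pos S \<subseteq> pos e" using e(2) by (rule hull_mono)
  moreover have "\<exists>\<sigma>\<in>fan_of blown_down. pos e \<subseteq> \<sigma>"
  proof (cases "e \<inter> D = {}")
    case True thus ?thesis using pos_in_contracted[OF subset_refl e(1)] by blast
  next
    case False
    then obtain d v v' where d: "d \<in> D" and b: "blow_down_pair E d v v'" "e = {v, d}"
      using blow_down_edge[OF e(1)] by blast
    have "pos e \<subseteq> pos {v, v'}" unfolding pos_blow_down_pair[OF b(1)] b(2) by (simp add: insert_commute)
    thus ?thesis using fan_ofI[OF blow_down_pair_contracted[OF d b(1)] subset_refl] by blast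
  qed
  ultimately show "\<exists>\<sigma>\<in>fan_of blown_down. \<tau> \<subseteq> \<sigma>" using e(3) by blast
qed

end

section \<open>Groups of automorphisms\<close>

lemma Aut_fanD:
  assumes "g \<in> carrier (Aut_fan N \<Sigma>)"
  shows "linear g" "bij g" "g ` N = N" "bij_betw (\<lambda>\<sigma>. g ` \<sigma>) \<Sigma> \<Sigma>" "\<sigma> \<in> \<Sigma> \<Longrightarrow> g ` \<sigma> \<in> \<Sigma>"
  using assms unfolding Aut_fan_def by (auto simp: bij_betw_def)

lemma Aut_fan_simps:
  "monoid.mult (Aut_fan N \<Sigma>) = (\<lambda>g h. g \<circ> h)" "one (Aut_fan N \<Sigma>) = id"
  by (simp_all add: Aut_fan_def)

lemma Aut_fan_inv_closed:
  assumes g: "g \<in> carrier (Aut_fan N \<Sigma>)"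
  shows "inv_into UNIV g \<in> carrier (Aut_fan N \<Sigma>)"
proof -
  note G = Aut_fanD[OF g]
  let ?i = "inv_into UNIV g"
  have gi: "g (?i x) = x" "?i (g x) = x" for x using G(2) by (auto simp: bij_def surj_f_inv_f)
  have "linear ?i" using inj_linear_imp_inv_linear[OF G(1)] G(2) by (simp add: bij_def)
  moreover have "bij ?i" using G(2) by (rule bij_imp_bij_inv)
  moreover have "?i ` N = N"
  proof -
    have "?i ` (g ` N) = N" unfolding image_image gi by simp
    thus ?thesis using G(3) by simp
  qed
  moreover have "bij_betw (\<lambda>\<sigma>. ?i ` \<sigma>) \<Sigma> \<Sigma>"
  proof (rule bij_betw_byWitness[where f' = "\<lambda>\<sigma>. g ` \<sigma>"])
    show "\<forall>\<sigma>\<in>\<Sigma>. g ` (?i ` \<sigma>) = \<sigma>" "\<forall>\<sigma>\<in>\<Sigma>. ?i ` (g ` \<sigma>) = \<sigma>" by (simp_all add: image_image gi)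
    show "(\<lambda>\<sigma>. g ` \<sigma>) ` \<Sigma> \<subseteq> \<Sigma>" using G(5) by auto
    show "(\<lambda>\<sigma>. ?i ` \<sigma>) ` \<Sigma> \<subseteq> \<Sigma>"
    proof
      fix \<tau> assume "\<tau> \<in> (\<lambda>\<sigma>. ?i ` \<sigma>) ` \<Sigma>"
      then obtain \<sigma> where "\<sigma> \<in> \<Sigma>" "\<tau> = ?i ` \<sigma>" by blast
      moreover from this obtain \<rho> where "\<rho> \<in> \<Sigma>" "\<sigma> = g ` \<rho>" using G(4) unfolding bij_betw_def by blast
      ultimately show "\<tau> \<in> \<Sigma>" by (simp add: image_image gi)
    qed
  qed
  ultimately show ?thesis unfolding Aut_fan_def by simp
qed

lemma group_Aut_fan: "group (Aut_fan N \<Sigma>)"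
proof (rule groupI)
  fix g h assume "g \<in> carrier (Aut_fan N \<Sigma>)" "h \<in> carrier (Aut_fan N \<Sigma>)"
  note G = Aut_fanD[OF this(1)] and H = Aut_fanD[OF this(2)]
  have "bij_betw ((\<lambda>\<sigma>. g ` \<sigma>) \<circ> (\<lambda>\<sigma>. h ` \<sigma>)) \<Sigma> \<Sigma>" by (rule bij_betw_trans[OF H(4) G(4)])
  moreover have "(\<lambda>\<sigma>. g ` \<sigma>) \<circ> (\<lambda>\<sigma>. h ` \<sigma>) = (\<lambda>\<sigma>. (g \<circ> h) ` \<sigma>)" by (auto simp: fun_eq_iff)
  ultimately have "bij_betw (\<lambda>\<sigma>. (g \<circ> h) ` \<sigma>) \<Sigma> \<Sigma>" by (simp only:)
  moreover have "(g \<circ> h) ` N = N" using G(3) H(3) by (metis image_comp)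
  moreover have "linear (g \<circ> h)" "bij (g \<circ> h)" using G H by (auto intro: linear_compose bij_comp)
  ultimately show "g \<otimes>\<^bsub>Aut_fan N \<Sigma>\<^esub> h \<in> carrier (Aut_fan N \<Sigma>)" by (simp add: Aut_fan_def del: o_apply image_comp)
next
  show "\<one>\<^bsub>Aut_fan N \<Sigma>\<^esub> \<in> carrier (Aut_fan N \<Sigma>)"
    unfolding Aut_fan_def by (simp add: linear_id)
next
  fix g assume g: "g \<in> carrier (Aut_fan N \<Sigma>)"
  have "inv_into UNIV g \<circ> g = id" using Aut_fanD(2)[OF g] by (simp add: bij_def)
  thus "\<exists>h\<in>carrier (Aut_fan N \<Sigma>). h \<otimes>\<^bsub>Aut_fan N \<Sigma>\<^esub> g = \<one>\<^bsub>Aut_fan N \<Sigma>\<^esub>"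
    using Aut_fan_inv_closed[OF g] by (auto simp: Aut_fan_simps)
qed (auto simp: Aut_fan_def o_assoc)

lemma Aut_fan_m_inv:
  assumes "g \<in> carrier (Aut_fan N \<Sigma>)"
  shows "m_inv (Aut_fan N \<Sigma>) g = inv_into UNIV g"
  using group.inv_equality[OF group_Aut_fan _ assms Aut_fan_inv_closed[OF assms]] Aut_fanD(2)[OF assms]
  by (simp add: Aut_fan_simps bij_def)

lemma subgroup_Aut_fanD:
  assumes "subgroup G (Aut_fan N \<Sigma>)"
  shows "g \<in> G \<Longrightarrow> g \<in> carrier (Aut_fan N \<Sigma>)" "id \<in> G" "g \<in> G \<Longrightarrow> h \<in> G \<Longrightarrow> g \<circ> h \<in> G"
    "g \<in> G \<Longrightarrow> inv_into UNIV g \<in> G"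
    "g \<in> G \<Longrightarrow> g (inv_into UNIV g x) = x" "g \<in> G \<Longrightarrow> inv_into UNIV g (g x) = x"
proof -
  interpret subgroup G "Aut_fan N \<Sigma>" by fact
  show c: "g \<in> carrier (Aut_fan N \<Sigma>)" if "g \<in> G" for g using that subset by blast
  show "id \<in> G" using one_closed by (simp add: Aut_fan_simps)
  show "g \<in> G \<Longrightarrow> h \<in> G \<Longrightarrow> g \<circ> h \<in> G" using m_closed[of g h] by (simp add: Aut_fan_simps)
  show "g \<in> G \<Longrightarrow> inv_into UNIV g \<in> G" using m_inv_closed[of g] Aut_fan_m_inv[OF c] by simp
  show "g \<in> G \<Longrightarrow> g (inv_into UNIV g x) = x" "g \<in> G \<Longrightarrow> inv_into UNIV g (g x) = x"
    using Aut_fanD(2)[OF c[of g]] by (auto simp: bij_def surj_f_inv_f)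
qed

text \<open>Product, unit and inverse do not depend on the fan. Only the preservation of the new fan
  has to be rechecked.\<close>

lemma subgroup_Aut_fan_transfer:
  assumes "subgroup G (Aut_fan N \<Sigma>)" and "G \<subseteq> carrier (Aut_fan N \<Sigma>')"
  shows "subgroup G (Aut_fan N \<Sigma>')"
proof
  note S = subgroup_Aut_fanD[OF assms(1)]
  show "G \<subseteq> carrier (Aut_fan N \<Sigma>')" by fact
  show "g \<otimes>\<^bsub>Aut_fan N \<Sigma>'\<^esub> h \<in> G" if "g \<in> G" "h \<in> G" for g h using S(3)[OF that] by (simp add: Aut_fan_simps)
  show "\<one>\<^bsub>Aut_fan N \<Sigma>'\<^esub> \<in> G" using S(2) by (simp add: Aut_fan_simps)
  show "inv\<^bsub>Aut_fan N \<Sigma>'\<^esub> g \<in> G" if "g \<in> G" for g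
    using S(4)[OF that] Aut_fan_m_inv[of g N \<Sigma>'] assms(2) that by auto
qed

text \<open>The generator is the preimage of the class of 1 under the isomorphism. Afterwards only
  its powers are used.\<close>

lemma cyclic_Aut_subgroup_generator:
  assumes "cyclic_Aut_subgroup N \<Sigma> p G" and p: "p \<ge> 2"
  obtains g where "\<And>k. g ^^ k \<in> G" "G = {g ^^ k | k. k < p}" "g ^^ p = id" "\<And>k. 0 < k \<Longrightarrow> k < p \<Longrightarrow> g ^^ k \<noteq> id"
proof -
  have sub: "subgroup G (Aut_fan N \<Sigma>)"
    and iso: "(Aut_fan N \<Sigma>)\<lparr>carrier := G\<rparr> \<cong> integer_mod_group p"
    using assms unfolding cyclic_Aut_subgroup_def by auto
  note S = subgroup_Aut_fanD[OF sub]
  obtain f where f: "f \<in> iso ((Aut_fan N \<Sigma>)\<lparr>carrier := G\<rparr>) (integer_mod_group p)"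
    using iso unfolding is_iso_def by blast
  have bij: "bij_betw f G {0..<int p}"
    using f p unfolding iso_def by (simp add: carrier_integer_mod_group)
  have mult: "f (g \<circ> h) = (f g + f h) mod int p" if "g \<in> G" "h \<in> G" for g h
    using f that unfolding iso_def hom_def by (simp add: Aut_fan_simps)
  have rg: "0 \<le> f g \<and> f g < int p" if "g \<in> G" for g using bij that unfolding bij_betw_def by auto
  have inj: "g = h" if "f g = f h" "g \<in> G" "h \<in> G" for g h
    using bij that unfolding bij_betw_def inj_on_def by blast
  have f1: "f id = 0"
  proof -
    have "f id = (f id + f id) mod int p" using mult[OF S(2) S(2)] by simp
    hence "f id mod int p = (f id + f id) mod int p" by (metis mod_mod_trivial)
    hence "int p dvd f id" by (metis add_diff_cancel_left' mod_eq_dvd_iff)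
    thus ?thesis using rg[OF S(2)] zdvd_not_zless by (metis order.not_eq_order_implies_strict)
  qed
  \<comment> \<open>p \<ge> 2 ensures that 1 is one of the representatives 0, ..., p - 1.\<close>
  obtain g where g: "g \<in> G" "f g = 1"
    using bij p unfolding bij_betw_def by (metis (no_types, lifting) atLeastLessThan_iff image_iff of_nat_1 of_nat_less_iff
        less_le_trans one_less_numeral_iff semiring_norm(76) zero_le_one)
  have gk: "g ^^ k \<in> G \<and> f (g ^^ k) = int k mod int p" for k
  proof (induction k)
    case (Suc k)
    have "f (g \<circ> g ^^ k) = (1 + int k mod int p) mod int p" using mult[of g "g ^^ k"] g Suc by simp
    hence "f (g \<circ> g ^^ k) = int (Suc k) mod int p" by (simp add: mod_simps add.commute)
    moreover have "g \<circ> g ^^ k \<in> G" using S(3)[OF g(1)] Suc by blast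
    ultimately show ?case unfolding funpow.simps(2) by blast
  qed (use S(2) f1 in \<open>simp add: id_def\<close>)
  show thesis
  proof (rule that)
    show "g ^^ k \<in> G" for k using gk by blast
    show "G = {g ^^ k | k. k < p}"
    proof (intro equalityI subsetI)
      fix x assume x: "x \<in> G"
      have "f x = f (g ^^ nat (f x))" using gk[of "nat (f x)"] rg[OF x] by simp
      hence "x = g ^^ nat (f x)" using inj x gk by blast
      moreover have "nat (f x) < p" using rg[OF x] by linarith
      ultimately show "x \<in> {g ^^ k | k. k < p}" by blast
    qed (use gk in auto)
    show "g ^^ p = id" using inj[of "g ^^ p" id] gk[of p] f1 S(2) by simp
    show "g ^^ k \<noteq> id" if k: "0 < k" "k < p" for k
    proof
      assume "g ^^ k = id"
      hence "int k mod int p = 0" using gk[of k] f1 by simp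
      thus False using k by simp
    qed
  qed
qed

section \<open>Quadratic relations of linear maps of order three, four and six (t is the trace, c
  the determinant)\<close>

lemma (in lattice_plane) cayley_hamilton:
  assumes d: "dual_pair N u v m n" and g: "linear g"
  obtains t c where "\<And>x. g (g x) = t *\<^sub>R g x - c *\<^sub>R (x :: 'a)"
proof -
  note D = dual_pairD[OF d]
  define A B C F where "A = m (g u)" "B = n (g u)" "C = m (g v)" "F = n (g v)"
  have gu: "g u = A *\<^sub>R u + B *\<^sub>R v" and gv: "g v = C *\<^sub>R u + F *\<^sub>R v"
    unfolding A_B_C_F_def by (rule D(7))+
  have ggu: "g (g u) = (A + F) *\<^sub>R g u - (A * F - B * C) *\<^sub>R u"
  proof -
    have "g (g u) = A *\<^sub>R g u + B *\<^sub>R g v" using arg_cong[OF gu, of g] g by (simp add: linear_add linear_cmul)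
    thus ?thesis unfolding gu gv by (simp add: algebra_simps)
  qed
  have ggv: "g (g v) = (A + F) *\<^sub>R g v - (A * F - B * C) *\<^sub>R v"
  proof -
    have "g (g v) = C *\<^sub>R g u + F *\<^sub>R g v" using arg_cong[OF gv, of g] g by (simp add: linear_add linear_cmul)
    thus ?thesis unfolding gu gv by (simp add: algebra_simps)
  qed
  have "g (g x) = (A + F) *\<^sub>R g x - (A * F - B * C) *\<^sub>R x" for x
  proof -
    obtain a b where x: "x = a *\<^sub>R u + b *\<^sub>R v" using D(7)[of x] by blast
    show ?thesis unfolding x by (simp add: linear_add[OF g] linear_cmul[OF g] ggu ggv algebra_simps)
  qed
  thus thesis using that by blast
qed

text \<open>This permits comparing coefficients: a map that is not a multiple of the identity is
  linearly independent of it. The last disjunct accounts for the zero space.\<close>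

lemma linear_scalar_or_independent:
  fixes g :: "'a::real_vector \<Rightarrow> 'a"
  obtains c where "\<And>x. g x = c *\<^sub>R x"
    | "\<And>a b. (\<And>x. a *\<^sub>R g x + b *\<^sub>R x = 0) \<Longrightarrow> a = 0 \<and> (b = 0 \<or> (\<forall>x::'a. x = 0))"
proof (cases "\<exists>c. \<forall>x. g x = c *\<^sub>R x")
  case False
  show thesis
  proof (rule that(2))
    fix a b assume h: "\<And>x. a *\<^sub>R g x + b *\<^sub>R x = 0"
    have "a = 0"
    proof (rule ccontr)
      assume a: "a \<noteq> 0"
      have "g x = (- b / a) *\<^sub>R x" for x
      proof -
        have "(1 / a) *\<^sub>R (a *\<^sub>R g x + b *\<^sub>R x) = 0" using h by simp
        hence "g x + (b / a) *\<^sub>R x = 0" using a by (simp add: scaleR_right_distrib)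
        thus ?thesis by (simp add: eq_neg_iff_add_eq_0)
      qed
      thus False using False by blast
    qed
    thus "a = 0 \<and> (b = 0 \<or> (\<forall>x::'a. x = 0))" using h by auto
  qed
qed (use that in blast)

context
  fixes g :: "'a::real_vector \<Rightarrow> 'a" and t c :: real
  assumes ch: "\<And>x. g (g x) = t *\<^sub>R g x - c *\<^sub>R x"
    and nz: "\<exists>x::'a. x \<noteq> 0" and lin: "linear g"
begin

lemma third_power: "g (g (g x)) = (t * t - c) *\<^sub>R g x - (t * c) *\<^sub>R x"
proof -
  have "t *\<^sub>R g (g x) - c *\<^sub>R g x = (t * t - c) *\<^sub>R g x - (t * c) *\<^sub>R x"
    unfolding ch[of x] by (simp add: algebra_simps)
  with ch[of "g x"] show ?thesis by (rule trans)
qed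

lemma fourth_power: "g (g (g (g x))) = (t * (t * t - 2 * c)) *\<^sub>R g x + (c * c - t * t * c) *\<^sub>R x"
proof -
  have gen: "t *\<^sub>R (a *\<^sub>R y - b *\<^sub>R x) - c *\<^sub>R (t *\<^sub>R y - c *\<^sub>R x) =
      (t * a - c * t) *\<^sub>R y + (c * c - t * b) *\<^sub>R x" for a b :: real and x y :: 'a
    by (simp add: algebra_simps)
  have "t *\<^sub>R g (g (g x)) - c *\<^sub>R g (g x) = (t * (t * t - c) - c * t) *\<^sub>R g x + (c * c - t * (t * c)) *\<^sub>R x"
    unfolding third_power[of x] unfolding ch[of x]
    by (rule gen)
  moreover have "t * (t * t - c) - c * t = t * (t * t - 2 * c)" by (simp add: algebra_simps)
  ultimately have "t *\<^sub>R g (g (g x)) - c *\<^sub>R g (g x) =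
      (t * (t * t - 2 * c)) *\<^sub>R g x + (c * c - t * t * c) *\<^sub>R x" by (simp add: mult.assoc)
  with ch[of "g (g x)"] show ?thesis by (rule trans)
qed

text \<open>A real scalar with cube 1 is 1, which \<open>ne\<close> excludes. Otherwise comparing
  coefficients gives t^2 = c and t c = -1, so t^3 = -1, whose only real solution is t = -1, with c =
  1.\<close>

lemma order_three:
  assumes "\<And>x. g (g (g x)) = x" and ne: "\<exists>x. g x \<noteq> x"
  shows "g (g x) = - g x - x"
proof (rule linear_scalar_or_independent[of g])
  fix k assume k: "\<And>x. g x = k *\<^sub>R x"
  obtain z :: 'a where z: "z \<noteq> 0" using nz by blast
  have "(k * k * k) *\<^sub>R z = 1 *\<^sub>R z" using assms(1)[of z] k by (simp add: mult.assoc)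
  hence "k * k * k = 1" using z by (metis scaleR_cancel_right)
  hence "(k - 1) * (k * k + k + 1) = 0" by (simp add: algebra_simps)
  moreover have "k * k + k + 1 > 0" using zero_le_square[of "k + 1/2"] by (simp add: algebra_simps)
  ultimately have "k = 1" by simp
  thus ?thesis using k ne by simp
next
  assume ind: "\<And>a b. (\<And>x. a *\<^sub>R g x + b *\<^sub>R x = 0) \<Longrightarrow> a = 0 \<and> (b = 0 \<or> (\<forall>x::'a. x = 0))"
  have "(t * t - c) *\<^sub>R g x + (- t * c - 1) *\<^sub>R x = 0" for x
    using assms(1)[of x] third_power[of x] by (simp add: algebra_simps)
  from ind[OF this] nz have e: "t * t = c" "t * c = - 1" by auto
  hence "(t + 1) * (t * t - t + 1) = 0" by (simp add: algebra_simps)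
  moreover have "t * t - t + 1 > 0" using zero_le_square[of "t - 1/2"] by (simp add: algebra_simps)
  ultimately have "t = -1" by simp
  thus ?thesis using ch[of x] e by simp
qed

text \<open>A scalar would have square 1. Otherwise t (t^2 - 2 c) = 0 and c^2 - t^2 c = 1; a nonzero
  t would give -(c^2) = 1, so t = 0 and c is 1 or -1. The value -1 means that the square is the
  identity.\<close>

lemma order_four:
  assumes "\<And>x. g (g (g (g x))) = x" and ne: "\<exists>x. g (g x) \<noteq> x"
  shows "g (g x) = - x"
proof (rule linear_scalar_or_independent[of g])
  fix k assume k: "\<And>x. g x = k *\<^sub>R x"
  obtain z :: 'a where z: "z \<noteq> 0" using nz by blast
  have "(k * k * k * k) *\<^sub>R z = 1 *\<^sub>R z" using assms(1)[of z] k by (simp add: mult.assoc)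
  hence "k * k * k * k = 1" using z by (metis scaleR_cancel_right)
  hence "(k * k - 1) * (k * k + 1) = 0" by (simp add: algebra_simps)
  moreover have "k * k + 1 > 0" by (smt (verit) zero_le_square)
  ultimately have "k * k = 1" by simp
  thus ?thesis using k ne by simp
next
  assume ind: "\<And>a b. (\<And>x. a *\<^sub>R g x + b *\<^sub>R x = 0) \<Longrightarrow> a = 0 \<and> (b = 0 \<or> (\<forall>x::'a. x = 0))"
  have "(t * (t * t - 2 * c)) *\<^sub>R g x + (c * c - t * t * c - 1) *\<^sub>R x = 0" for x
  proof -
    have "(t * (t * t - 2 * c)) *\<^sub>R g x + (c * c - t * t * c) *\<^sub>R x = x"
      using assms(1)[of x] fourth_power[of x] by simp
    thus ?thesis by (simp add: scaleR_left_diff_distrib add_diff_eq)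
  qed
  from ind[OF this] nz have e: "t * (t * t - 2 * c) = 0" "c * c - t * t * c = 1" by auto
  have "t = 0"
  proof (rule ccontr)
    assume "t \<noteq> 0"
    hence "t * t = 2 * c" using e(1) by simp
    hence "- (c * c) = 1" using e(2) by (simp add: algebra_simps)
    thus False by (smt (verit) zero_le_square)
  qed
  hence "c = 1 \<or> c = -1" using e(2) by (simp add: square_eq_1_iff)
  moreover have "c \<noteq> -1" using ch ne \<open>t = 0\<close> by auto
  ultimately show ?thesis using ch[of x] \<open>t = 0\<close> by simp
qed

text \<open>The assumption \<open>s\<close> says that the square satisfies the relation of order
  three. Since X^4 + X^2 + 1 = (X^2 + X + 1)(X^2 - X + 1), two quadratic relations are possible; the
  first would make the cube the identity and is excluded by \<open>ne\<close>.\<close>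

lemma order_six:
  assumes s: "\<And>x. g (g (g (g x))) = - g (g x) - x" and ne: "\<exists>x. g (g (g x)) \<noteq> x"
  shows "g (g x) = g x - x"
proof (rule linear_scalar_or_independent[of g])
  fix k assume k: "\<And>x. g x = k *\<^sub>R x"
  obtain z :: 'a where z: "z \<noteq> 0" using nz by blast
  have "(k * k * k * k) *\<^sub>R z = - ((k * k) *\<^sub>R z) - z" using s[of z] k by (simp add: mult.assoc)
  hence "(k * k * k * k + k * k + 1) *\<^sub>R z = 0" by (simp add: scaleR_left_distrib)
  hence "k * k * k * k + k * k + 1 = 0" using z by simp
  moreover have "(k * k) * (k * k) \<ge> 0" "k * k \<ge> 0" by simp_all
  ultimately show ?thesis by (simp add: mult.assoc)
next
  assume ind: "\<And>a b. (\<And>x. a *\<^sub>R g x + b *\<^sub>R x = 0) \<Longrightarrow> a = 0 \<and> (b = 0 \<or> (\<forall>x::'a. x = 0))"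
  have "(t * (t * t - 2 * c) + t) *\<^sub>R g x + (c * c - t * t * c - c + 1) *\<^sub>R x = 0" for x
  proof -
    have "(t * (t * t - 2 * c)) *\<^sub>R g x + (c * c - t * t * c) *\<^sub>R x = - (t *\<^sub>R g x - c *\<^sub>R x) - x"
      using s[of x] fourth_power[of x] by (simp only: ch[of x])
    thus ?thesis by (simp add: algebra_simps)
  qed
  from ind[OF this] nz have e: "t * (t * t - 2 * c + 1) = 0" "c * c - t * t * c - c + 1 = 0"
    by (auto simp: algebra_simps)
  have "t \<noteq> 0"
  proof
    assume "t = 0"
    hence "c * c - c + 1 = 0" using e(2) by simp
    moreover have "c * c - c + 1 > 0" using zero_le_square[of "c - 1/2"] by (simp add: algebra_simps)
    ultimately show False by simp
  qed
  hence tt: "t * t = 2 * c - 1" using e(1) by simp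
  have "c * c = 1" using e(2) unfolding tt by (simp add: algebra_simps)
  hence "c = 1 \<or> c = -1" by (simp add: square_eq_1_iff)
  moreover have "c \<noteq> -1" using tt by (smt (verit) zero_le_square)
  ultimately have c: "c = 1" by simp
  hence "t = 1 \<or> t = -1" using tt by (simp add: square_eq_1_iff)
  moreover have "t \<noteq> -1"
  proof
    assume "t = -1"
    hence "g (g x) = - g x - x" for x using ch[of x] c by simp
    hence "g (g (g x)) = x" for x using third_power[of x] c \<open>t = -1\<close> by simp
    thus False using ne by blast
  qed
  ultimately show ?thesis using ch[of x] c by simp
qed

end

section \<open>Equivariant contractions and minimal fans\<close>

context lattice_plane
begin

text \<open>Automorphisms are given as acting on cones. As a cone determines its basis, they also
  permute the encoding.\<close>

lemma Aut_fan_edge: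
  assumes E: "complete_bases N E" and g: "g \<in> carrier (Aut_fan N (fan_of E))" and e: "e \<in> E"
  shows "g ` e \<in> E"
proof -
  note G = Aut_fanD[OF g]
  obtain u v m n where uv: "e = {u, v}" and d: "dual_pair N u v m n"
    using lattice_basis_pair[OF dim2 complete_basesD(2)[OF E e]] .
  have "lattice_basis N (g ` e)"
    using dual_pair_lattice_basis[OF dual_pair_image[OF d G(1-3)]] uv by simp
  moreover have "pos (g ` e) \<in> fan_of E"
    using G(5)[OF fan_ofI[OF e subset_refl]] convex_cone_hull_linear_image[OF G(1), of e] by simp
  ultimately have "g ` e \<in> maximal_bases N (fan_of E)" unfolding maximal_bases_def by simp
  thus ?thesis using maximal_bases_fan_of[OF E] by simp
qed

lemma torus_mult:
  "t \<in> torus N \<Longrightarrow> k \<in> dual_lattice N \<Longrightarrow> l \<in> dual_lattice N \<Longrightarrow> t (\<lambda>v. k v + l v) = t k * t l"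
  unfolding torus_def by blast

text \<open>In an affine chart, the torus can double each coordinate separately, so a fixed point is
  the origin of the chart. Conversely a fixed point of a cone sees only the zero character, where
  every torus element is 1.\<close>

lemma torus_fixed_points_fan_of:
  assumes E: "complete_bases N E"
  shows "torus_fixed_points N (fan_of E) = fixed_point ` E"
proof (intro equalityI subsetI)
  fix y assume y: "y \<in> torus_fixed_points N (fan_of E)"
  hence yp: "y \<in> points (toric_surface N (fan_of E))" and inv: "\<And>t. t \<in> torus N \<Longrightarrow> torus_act t y = y"
    unfolding torus_fixed_points_def by auto
  obtain S u v m n z where p: "{u, v} \<in> E" "dual_pair N u v m n" "y = toric_param N u v z"
    using toric_point_param[OF E yp] by metis
  note D = dual_pairD[OF p(2)] and L = dual_pair_dual_lattice[OF p(2)]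
  \<comment> \<open>The value at 2 of the one-parameter subgroup of \<open>w\<close>. Below, w = u
    doubles the first coordinate and w = v the second.\<close>
  have tor: "(\<lambda>k. 2 powi \<lfloor>k w\<rfloor>) \<in> torus N" if w: "w \<in> N" for w
  proof -
    have "\<lfloor>k w + l w\<rfloor> = \<lfloor>k w\<rfloor> + \<lfloor>l w\<rfloor>" if "k \<in> dual_lattice N" "l \<in> dual_lattice N" for k l
      using dual_latticeD(2)[OF that(1) w] dual_latticeD(2)[OF that(2) w] by (metis Ints_cases floor_add_int floor_of_int)
    thus ?thesis unfolding torus_def by (auto simp: power_int_add)
  qed
  have eq: "2 powi \<lfloor>k w\<rfloor> * snd y k = snd y k" if "w \<in> N" for w k
    using arg_cong[OF inv[OF tor[OF that]], of "\<lambda>y. snd y k"] unfolding torus_act_def by (simp add: case_prod_beta)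
  have "snd y m = fst z" "snd y n = snd z"
    using toric_param_coords[OF p(2), of z] p(3) by (auto simp: case_prod_beta prod_eq_iff)
  hence "z = (0, 0)"
    using eq[OF L(3), of m] eq[OF L(4), of n] D(3,6) by (cases z) simp
  hence "y = fixed_point {u, v}" using fixed_point_toric_param[OF p(2)] p(3) by simp
  thus "y \<in> fixed_point ` E" using p(1) by blast
next
  fix y assume "y \<in> fixed_point ` E"
  then obtain e where e: "e \<in> E" "y = fixed_point e" by blast
  obtain u v m n where uv: "e = {u, v}" and d: "dual_pair N u v m n"
    using lattice_basis_pair[OF dim2 complete_basesD(2)[OF E e(1)]] .
  have "y \<in> points (toric_surface N (fan_of E))"
    using parametrization_toric_param[OF d, of E] e uv fixed_point_toric_param[OF d] unfolding parametrization_def by auto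
  moreover have "torus_act t y = y" if t: "t \<in> torus N" for t
  proof -
    let ?z = "\<lambda>w. 0 :: real"
    have "t (\<lambda>w. ?z w + ?z w) = t ?z * t ?z" by (rule torus_mult[OF t zero_dual_lattice zero_dual_lattice])
    moreover have "t ?z \<noteq> 0" using t zero_dual_lattice[of N] unfolding torus_def by blast
    ultimately have "t ?z = 1" by simp
    hence "(\<lambda>k. t k * (if k = ?z then 1 else 0)) = (\<lambda>k. if k = ?z then 1 else 0)" by auto
    thus ?thesis unfolding e(2) torus_act_def fixed_point_def by simp
  qed
  ultimately show "y \<in> torus_fixed_points N (fan_of E)" unfolding torus_fixed_points_def by blast
qed

lemma toric_morphism_fixed_point:
  assumes E: "complete_bases N E" and g: "g \<in> carrier (Aut_fan N (fan_of E))" and e: "e \<in> E"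
  shows "toric_morphism N (fan_of E) g (fixed_point e) = fixed_point (g ` e)"
proof -
  note G = Aut_fanD[OF g]
  have im: "g ` pos e = pos (g ` e)" using convex_cone_hull_linear_image[OF G(1), of e] by simp
  have "pos (g ` e) \<in> fan_of E" using fan_ofI[OF Aut_fan_edge[OF E g e] subset_refl] .
  hence "\<Inter>{\<sigma> \<in> fan_of E. g ` pos e \<subseteq> \<sigma>} = pos (g ` e)" unfolding im by auto
  moreover have "k \<circ> g = (\<lambda>w. 0) \<longleftrightarrow> k = (\<lambda>w. 0)" for k :: "'a \<Rightarrow> real"
  proof
    assume h: "k \<circ> g = (\<lambda>w. 0)"
    show "k = (\<lambda>w. 0)"
    proof
      fix w obtain x where "w = g x" using G(2) unfolding bij_def surj_def by blast
      thus "k w = 0" using fun_cong[OF h, of x] by simp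
    qed
  qed auto
  moreover have "(\<lambda>w. 0) \<in> cone_semigroup N (pos (g ` e))" unfolding cone_semigroup_pos using zero_dual_lattice by auto
  ultimately have "(\<lambda>k. if k \<in> cone_semigroup N (pos (g ` e)) then if k \<circ> g = (\<lambda>w. 0) then 1 else 0 else 0)
      = (\<lambda>k. if k = (\<lambda>w. 0) then 1 else (0::complex))"
    and "\<Inter>{\<sigma> \<in> fan_of E. g ` pos e \<subseteq> \<sigma>} = pos (g ` e)" by auto
  thus ?thesis unfolding toric_morphism_def fixed_point_def by (simp only: prod.case Let_def)
qed

section \<open>Contraction of an orbit of rays\<close>

context
  fixes E :: "'a set set" and G :: "('a \<Rightarrow> 'a) set"
  assumes E: "complete_bases N E" and G: "subgroup G (Aut_fan N (fan_of E))"
begin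

lemma group_edge:
  assumes "g \<in> G" "{u, v} \<in> E"
  shows "{g u, g v} \<in> E"
  using Aut_fan_edge[OF E subgroup_Aut_fanD(1)[OF G assms(1)] assms(2)] by simp

lemma group_ray: "g \<in> G \<Longrightarrow> u \<in> \<Union>E \<Longrightarrow> g u \<in> \<Union>E"
  using Aut_fan_edge[OF E subgroup_Aut_fanD(1)[OF G]] by blast

lemma group_edge_iff:
  assumes "g \<in> G"
  shows "{g u, w} \<in> E \<longleftrightarrow> {u, inv_into UNIV g w} \<in> E"
  using group_edge[OF assms, of u "inv_into UNIV g w"]
    group_edge[OF subgroup_Aut_fanD(4)[OF G assms], of "g u" w] subgroup_Aut_fanD(5,6)[OF G assms] by auto

lemma group_blow_down_pair:
  assumes g: "g \<in> G" and b: "blow_down_pair E d v v'"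
  shows "blow_down_pair E (g d) (g v) (g v')"
proof -
  have "linear g" using Aut_fanD(1)[OF subgroup_Aut_fanD(1)[OF G g]] .
  moreover have "w = g v \<or> w = g v'" if "{g d, w} \<in> E" for w
  proof -
    have "inv_into UNIV g w = v \<or> inv_into UNIV g w = v'"
      using that b unfolding group_edge_iff[OF g] blow_down_pair_def by blast
    thus ?thesis using subgroup_Aut_fanD(5)[OF G g, of w] by auto
  qed
  moreover have "{g d, g v} \<in> E" "{g d, g v'} \<in> E"
    using b group_edge[OF g] unfolding blow_down_pair_def by blast+
  moreover have "d = v + v'" using b unfolding blow_down_pair_def by blast
  ultimately show ?thesis unfolding blow_down_pair_def by (simp add: linear_add)
qed

text \<open>\<open>D\<close> is the orbit of \<open>u\<close>. Adjacency between two of its members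
  could be moved by the group to adjacency of \<open>u\<close> with some h u, which is excluded, so
  \<open>D\<close> is contractible. The pairs of neighbours are permuted along with
  \<open>D\<close>, so the centres form the orbit of the single fixed point over
  \<open>u\<close>.\<close>

lemma equivariant_contraction:
  assumes b: "blow_down_pair E u v v'" and nonadj: "\<forall>h\<in>G. {u, h u} \<notin> E"
  obtains E' where "complete_bases N E'" "\<Union>E' \<subset> \<Union>E" "subgroup G (Aut_fan N (fan_of E'))"
    "equivariant_blow_up N G (fan_of E') (fan_of E)"
proof -
  note GD = subgroup_Aut_fanD[OF G]
  define D where "D = {h u | h. h \<in> G}"
  have notD: "h w \<notin> D" if h: "h \<in> G" and w: "{u, w} \<in> E" for h w
  proof
    assume "h w \<in> D"
    then obtain k where k: "k \<in> G" "h w = k u" unfolding D_def by blast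
    hence "w = (inv_into UNIV h \<circ> k) u" using GD(6)[OF h, of w] by simp
    thus False using bspec[OF nonadj GD(3)[OF GD(4)[OF h] k(1)]] w by simp
  qed
  have con: "contractible_rays E D"
    unfolding contractible_rays_def
  proof
    fix d assume "d \<in> D"
    then obtain h where h: "h \<in> G" "d = h u" unfolding D_def by blast
    have "{u, v} \<in> E" "{u, v'} \<in> E" using b unfolding blow_down_pair_def by auto
    thus "\<exists>v v'. blow_down_pair E d v v' \<and> v \<notin> D \<and> v' \<notin> D"
      using group_blow_down_pair[OF h(1) b] notD[OF h(1)] h(2) by blast
  qed
  interpret contraction N E D by unfold_locales (rule E, rule con)
  have uD: "u \<in> D" unfolding D_def by (intro CollectI exI[of _ id]) (simp add: GD(2))
  have uE: "u \<in> \<Union>E" using b unfolding blow_down_pair_def by blast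
  have hD: "h d \<in> D" if hd: "h \<in> G" "d \<in> D" for h d
  proof -
    obtain k where k: "k \<in> G" "d = k u" using hd(2) unfolding D_def by blast
    have "h d = (h \<circ> k) u" using k(2) by simp
    thus ?thesis unfolding D_def using GD(3)[OF hd(1) k(1)] by blast
  qed
  have inv: "h ` f \<in> blown_down" if h: "h \<in> G" and f: "f \<in> blown_down" for h f
    using f
  proof (cases rule: contractedE)
    case 1
    have "h ` f \<inter> D = {}"
    proof (rule ccontr)
      assume "h ` f \<inter> D \<noteq> {}"
      then obtain w where w: "w \<in> f" "h w \<in> D" by blast
      hence "w \<in> D" using hD[OF GD(4)[OF h] w(2)] GD(6)[OF h] by simp
      thus False using 1 w by blast
    qed
    moreover have "h ` f \<in> E" using Aut_fan_edge[OF E GD(1)[OF h] 1(1)] .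
    ultimately show ?thesis unfolding contracted_def by blast
  next
    case (2 d w w')
    have "blow_down_pair E (h d) (h w) (h w')" by (rule group_blow_down_pair[OF h 2(2)])
    thus ?thesis using blow_down_pair_contracted[OF hD[OF h 2(1)]] 2(3) by simp
  qed
  have "G \<subseteq> carrier (Aut_fan N (fan_of blown_down))"
  proof
    fix h assume h: "h \<in> G"
    note H = Aut_fanD[OF GD(1)[OF h]]
    have "h ` \<sigma> \<in> fan_of blown_down" if \<sigma>: "\<sigma> \<in> fan_of blown_down" for \<sigma>
    proof -
      obtain e S where e: "e \<in> blown_down" "S \<subseteq> e" "\<sigma> = pos S" using fan_ofE[OF \<sigma>] .
      have "h ` \<sigma> = pos (h ` S)" unfolding e(3) using convex_cone_hull_linear_image[OF H(1), of S] by simp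
      thus ?thesis using fan_ofI[OF inv[OF h e(1)], of "h ` S"] e(2) by auto
    qed
    hence "(\<lambda>\<sigma>. h ` \<sigma>) ` fan_of blown_down \<subseteq> fan_of blown_down" by blast
    \<comment> \<open>The contracted fan is finite, so an injective self-map of it is
      bijective.\<close>
    moreover have "inj_on (\<lambda>\<sigma>. h ` \<sigma>) (fan_of blown_down)"
      using H(2) by (auto intro!: inj_onI simp: bij_def inj_image_eq_iff)
    moreover have "finite (fan_of blown_down)"
      using complete_smooth_fan_fan_of[OF complete_bases_contracted]
      unfolding complete_smooth_fan_def smooth_fan_def fan_def by blast
    ultimately have "bij_betw (\<lambda>\<sigma>. h ` \<sigma>) (fan_of blown_down) (fan_of blown_down)"
      unfolding bij_betw_def using endo_inj_surj by blast
    thus "h \<in> carrier (Aut_fan N (fan_of blown_down))" using H(1-3) unfolding Aut_fan_def by simp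
  qed
  note sub = subgroup_Aut_fan_transfer[OF G this]
  have vv: "{v, v'} \<in> blown_down" by (rule blow_down_pair_contracted[OF uD b])
  have "{toric_morphism N (fan_of blown_down) g (fixed_point {v, v'}) | g. g \<in> G} = centres"
  proof (intro equalityI subsetI)
    fix a assume "a \<in> {toric_morphism N (fan_of blown_down) g (fixed_point {v, v'}) | g. g \<in> G}"
    then obtain g where g: "g \<in> G" "a = toric_morphism N (fan_of blown_down) g (fixed_point {v, v'})" by blast
    hence "a = fixed_point {g v, g v'}"
      using toric_morphism_fixed_point[OF complete_bases_contracted subgroup_Aut_fanD(1)[OF sub g(1)] vv] by simp
    moreover have "g u \<in> D" using g(1) unfolding D_def by blast
    ultimately show "a \<in> centres" unfolding centres_def using group_blow_down_pair[OF g(1) b] by blast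
  next
    fix a assume "a \<in> centres"
    then obtain d w w' where d: "d \<in> D" "blow_down_pair E d w w'" "a = fixed_point {w, w'}"
      unfolding centres_def by blast
    then obtain g where g: "g \<in> G" "d = g u" unfolding D_def by blast
    have "{w, w'} = {g v, g v'}" using blow_down_pair_unique[OF d(2)] group_blow_down_pair[OF g(1) b] g(2) by simp
    hence "a = toric_morphism N (fan_of blown_down) g (fixed_point {v, v'})"
      using toric_morphism_fixed_point[OF complete_bases_contracted subgroup_Aut_fanD(1)[OF sub g(1)] vv] d(3) by simp
    thus "a \<in> {toric_morphism N (fan_of blown_down) g (fixed_point {v, v'}) | g. g \<in> G}" using g(1) by blast
  qed
  moreover have "fixed_point {v, v'} \<in> torus_fixed_points N (fan_of blown_down)"
    unfolding torus_fixed_points_fan_of[OF complete_bases_contracted] using vv by blast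
  ultimately have "equivariant_blow_up N G (fan_of blown_down) (fan_of E)"
    unfolding equivariant_blow_up_def using sub toric_blow_up_contracted
    by (intro conjI bexI[of _ "fixed_point {v, v'}"]) simp_all
  moreover have "\<Union>blown_down \<subset> \<Union>E" using Union_contracted uD uE by blast
  ultimately show thesis using that complete_bases_contracted sub by blast
qed

end

text \<open>\<open>Q\<close> stands for being the minimal model. The hypothesis \<open>step\<close>
  ranges over all fans on which \<open>G\<close> acts, because it is reapplied after every
  contraction; the number of rays decreases each time, so the process ends with
  \<open>Q\<close>.\<close>

lemma successive_contractions:
  assumes E: "complete_bases N E" and G: "subgroup G (Aut_fan N (fan_of E))"
    and step: "\<And>E. complete_bases N E \<Longrightarrow> subgroup G (Aut_fan N (fan_of E)) \<Longrightarrow>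
      Q (fan_of E) \<or> (\<exists>u v v'. blow_down_pair E u v v' \<and> (\<forall>h\<in>G. {u, h u} \<notin> E))"
  shows "\<exists>\<Sigma>\<^sub>0. Q \<Sigma>\<^sub>0 \<and> successive_equivariant_blow_ups N G \<Sigma>\<^sub>0 (fan_of E)"
  using E G
proof (induction "card (\<Union>E)" arbitrary: E rule: less_induct)
  case (less E)
  show ?case
  proof (cases "Q (fan_of E)")
    case True
    thus ?thesis unfolding successive_equivariant_blow_ups_def by blast
  next
    case False
    then obtain u v v' where b: "blow_down_pair E u v v'" "\<forall>h\<in>G. {u, h u} \<notin> E"
      using step[OF less.prems] by blast
    obtain E' where E': "complete_bases N E'" "\<Union>E' \<subset> \<Union>E" "subgroup G (Aut_fan N (fan_of E'))"
      "equivariant_blow_up N G (fan_of E') (fan_of E)"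
      using equivariant_contraction[OF less.prems b] by blast
    have "finite (\<Union>E)"
      using complete_basesD(1,2)[OF less.prems(1)] card_lattice_basis(2) by blast
    hence "card (\<Union>E') < card (\<Union>E)" using E'(2) by (rule psubset_card_mono)
    then obtain \<Sigma>\<^sub>0 where "Q \<Sigma>\<^sub>0" "successive_equivariant_blow_ups N G \<Sigma>\<^sub>0 (fan_of E')"
      using less.hyps E'(1,3) by blast
    thus ?thesis using E'(4) unfolding successive_equivariant_blow_ups_def
      by (meson rtranclp.rtrancl_into_rtrancl)
  qed
qed

text \<open>By the parallelogram law, \<open>v + v' = a u\<close> with \<open>\<bar>a\<bar> < 2\<close> for a longest ray generator \<open>u\<close>.\<close>

lemma longest_ray:
  assumes E: "complete_bases N E"
  obtains u v v' where "blow_down_pair E u v v'"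
    | u v where "{u, v} \<in> E" "{u, - v} \<in> E"
    | u v v' where "{u, v} \<in> E" "{u, v'} \<in> E" "u + v + v' = 0"
proof -
  have fin: "finite (\<Union>E)" using complete_basesD(1,2)[OF E] card_lattice_basis(2) by blast
  obtain e where e: "e \<in> E" using complete_basesD(4)[OF E] by blast
  obtain p q i j where "e = {p, q}" "dual_pair N p q i j"
    using lattice_basis_pair[OF dim2 complete_basesD(2)[OF E e]] .
  hence ne: "\<Union>E \<noteq> {}" using e by blast
  have "Max (norm ` \<Union>E) \<in> norm ` \<Union>E" by (rule Max_in) (use fin ne in blast)+
  then obtain u where u: "u \<in> \<Union>E" "norm u = Max (norm ` \<Union>E)" by (metis imageE)
  have mx: "norm w \<le> norm u" if "w \<in> \<Union>E" for w
    unfolding u(2) using that fin by (intro Max_ge) auto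
  obtain v v' m n a where nb: "dual_pair N u v m n" "{u, v} \<in> E" "{u, v'} \<in> E" "a \<in> \<int>"
    "v + v' = a *\<^sub>R u" "v \<noteq> v'" "\<And>w. {u, w} \<in> E \<Longrightarrow> w = v \<or> w = v'"
    by (rule neighbours[OF E u(1)]) blast
  have u0: "u \<noteq> 0" using dual_pairD(3)[OF nb(1)] linear_0[OF dual_pairD(1)[OF nb(1)]] by auto
  have "v \<in> \<Union>E" "v' \<in> \<Union>E" using nb(2,3) by blast+
  hence "(norm v)\<^sup>2 \<le> (norm u)\<^sup>2" "(norm v')\<^sup>2 \<le> (norm u)\<^sup>2"
    using mx by (auto intro!: power_mono)
  moreover have "(norm (v + v'))\<^sup>2 + (norm (v - v'))\<^sup>2 = 2 * (norm v)\<^sup>2 + 2 * (norm v')\<^sup>2"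
    by (simp add: power2_norm_eq_inner inner_add_left inner_add_right inner_diff_left inner_diff_right inner_commute)
  \<comment> \<open>Here the strictness enters: distinct neighbours exclude |a| = 2.\<close>
  moreover have "(norm (v - v'))\<^sup>2 > 0" using nb(6) by simp
  moreover have "(norm (v + v'))\<^sup>2 = a\<^sup>2 * (norm u)\<^sup>2" unfolding nb(5) by (simp add: power_mult_distrib)
  ultimately have "a\<^sup>2 * (norm u)\<^sup>2 < 4 * (norm u)\<^sup>2" by linarith
  hence a4: "a\<^sup>2 < 2\<^sup>2" using u0 by simp
  hence "\<bar>a\<bar> < 2" using power2_less_imp_less[of "\<bar>a\<bar>" 2] by simp
  moreover obtain k :: int where k: "a = of_int k" using nb(4) by (auto elim: Ints_cases)
  ultimately have "\<bar>k\<bar> < 2" by linarith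
  hence "k = 1 \<or> k = 0 \<or> k = -1" by presburger
  hence "a = 1 \<or> a = 0 \<or> a = -1" using k by auto
  thus thesis
  proof (elim disjE)
    assume "a = 1"
    hence "u = v + v'" using nb(5) by simp
    hence "blow_down_pair E u v v'" unfolding blow_down_pair_def using nb(2,3,7) by blast
    thus thesis by (rule that(1))
  next
    assume "a = 0"
    hence "v' = - v" using nb(5) by (simp add: add_eq_0_iff)
    hence "{u, - v} \<in> E" using nb(3) by simp
    thus thesis by (rule that(2)[OF nb(2)])
  next
    assume "a = -1"
    hence "u + v + v' = 0" using nb(5) by (simp add: add.assoc)
    thus thesis by (rule that(3)[OF nb(2,3)])
  qed
qed

lemma two_neighbours:
  assumes E: "complete_bases N E" and "{u, p} \<in> E" "{u, q} \<in> E" "p \<noteq> q" "{u, w} \<in> E"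
  shows "w = p \<or> w = q"
proof -
  have "u \<in> \<Union>E" using assms(2) by blast
  then obtain v v' m n a where "dual_pair N u v m n" "{u, v} \<in> E" "{u, v'} \<in> E" "a \<in> \<int>"
    "v + v' = a *\<^sub>R u" "v \<noteq> v'" and nb: "\<And>w. {u, w} \<in> E \<Longrightarrow> w = v \<or> w = v'"
    by (rule neighbours[OF E]) blast
  show ?thesis using nb[OF assms(2)] nb[OF assms(3)] nb[OF assms(5)] assms(4) by auto
qed

lemma blow_down_pair_sum:
  assumes "blow_down_pair E u v v'" "{u, p} \<in> E" "{u, q} \<in> E" "p \<noteq> q"
  shows "p + q = u"
  using assms unfolding blow_down_pair_def by (metis add.commute)

lemma edge_nonzero:
  assumes E: "complete_bases N E" and e: "{u, v} \<in> E"
  shows "u \<noteq> 0" "v \<noteq> 0" "u \<noteq> v" "u \<noteq> - v"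
proof -
  obtain m n where d: "dual_pair N u v m n" using complete_bases_dual_pair[OF E e] .
  note D = dual_pairD[OF d]
  show "u \<noteq> 0" "v \<noteq> 0" "u \<noteq> v" "u \<noteq> - v"
    using D(3-6,9) linear_0[OF D(1)] linear_0[OF D(2)] linear_neg[OF D(1), of v] by auto
qed

text \<open>By symmetry -v = u + v' would be a ray, but it lies inside the cone over
  \<open>u\<close> and \<open>v'\<close>.\<close>

lemma no_triangle_if_symmetric:
  assumes E: "complete_bases N E" and neg: "\<And>w. w \<in> \<Union>E \<Longrightarrow> - w \<in> \<Union>E"
    and t: "{u, v} \<in> E" "{u, v'} \<in> E" "u + v + v' = 0"
  shows False
proof -
  have "u + v' = - v" using t(3) by (simp add: eq_neg_iff_add_eq_0 ac_simps)
  hence "- v = u + v'" by simp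
  hence "- v \<in> pos {u, v'}" by (simp add: convex_cone_hull_add hull_inc)
  hence "- v \<in> {u, v'}" using ray_mem_pos[OF E t(2), of "- v"] neg t(1) by blast
  moreover have "- v \<noteq> u" using edge_nonzero(4)[OF E t(1)] by auto
  moreover have "- v \<noteq> v'" using t(3) edge_nonzero(1)[OF E t(1)] by (auto simp: algebra_simps)
  ultimately show False by blast
qed

section \<open>Recognising the fans of the product of two projective lines and of the projective
  plane\<close>

lemma linear_bij_coordinates:
  assumes d: "dual_pair N u v m n"
  shows "linear (\<lambda>x. (m x, n x))" "bij (\<lambda>x. (m x, n x))" "(\<lambda>x. (m x, n x)) ` N = \<int> \<times> \<int>"
proof -
  note D = dual_pairD[OF d]
  have inv: "(m (a *\<^sub>R u + b *\<^sub>R v), n (a *\<^sub>R u + b *\<^sub>R v)) = (a, b)" for a b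
    using dual_pair_unique[OF d refl] by simp
  show "linear (\<lambda>x. (m x, n x))" using D(1,2) by (auto intro!: linearI simp: linear_add linear_cmul)
  have "inj (\<lambda>x. (m x, n x))" by (rule injI) (use dual_pair_eqI[OF d] in auto)
  moreover have "surj (\<lambda>x. (m x, n x))"
    by (rule surjI[of _ "\<lambda>y. fst y *\<^sub>R u + snd y *\<^sub>R v"]) (simp add: inv)
  ultimately show "bij (\<lambda>x. (m x, n x))" by (simp add: bij_def)
  show "(\<lambda>x. (m x, n x)) ` N = \<int> \<times> \<int>"
  proof (intro equalityI subsetI)
    fix y :: "real \<times> real" assume "y \<in> \<int> \<times> \<int>"
    hence "fst y *\<^sub>R u + snd y *\<^sub>R v \<in> N" unfolding D(8) using inv[of "fst y" "snd y"] by auto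
    thus "y \<in> (\<lambda>x. (m x, n x)) ` N" by (rule rev_image_eqI) (simp add: inv)
  qed (use D(8) in auto)
qed

text \<open>Negation supplies the two opposite quadrants, and the four quadrants already cover the
  plane, so there are no further maximal cones.\<close>

lemma quadrants_P1xP1:
  assumes E: "complete_bases N E" and neg: "\<And>a b. {a, b} \<in> E \<Longrightarrow> {- a, - b} \<in> E"
    and q: "{u, v} \<in> E" "{u, - v} \<in> E"
  shows "is_P1xP1 N (fan_of E)"
proof -
  obtain m n where d: "dual_pair N u v m n" using complete_bases_dual_pair[OF E q(1)] .
  have ds: "dual_pair N (s *\<^sub>R u) (t *\<^sub>R v) (\<lambda>x. s * m x) (\<lambda>x. t * n x)" if "s \<in> {1, -1}" "t \<in> {1, -1}" for s t
  proof -
    have "dual_pair N u (t *\<^sub>R v) m (\<lambda>x. t * n x)" using dual_pair_change[OF d that(2), of 0] by simp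
    from dual_pair_change[OF dual_pair_sym[OF this] that(1), of 0] show ?thesis by (intro dual_pair_sym[of N "t *\<^sub>R v"]) simp
  qed
  let ?E = "{{s *\<^sub>R u, t *\<^sub>R v} | s t. s \<in> {1, -1} \<and> t \<in> {1, -1::real}}"
  have "?E = E"
  proof (rule complete_bases_cover_eq[OF E])
    have "{u, v} \<in> E" "{u, - v} \<in> E" "{- u, v} \<in> E" "{- u, - v} \<in> E"
      using q neg[OF q(1)] neg[OF q(2)] by simp_all
    thus "?E \<subseteq> E" by auto
    fix x
    define s t where "s = (if m x \<ge> 0 then 1 else -1 :: real)" and "t = (if n x \<ge> 0 then 1 else -1 :: real)"
    have st: "s \<in> {1, -1}" "t \<in> {1, -1}" unfolding s_def t_def by auto
    have "s * m x \<ge> 0" "t * n x \<ge> 0" unfolding s_def t_def by auto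
    hence "x \<in> pos {s *\<^sub>R u, t *\<^sub>R v}" using mem_pos_pair(1)[OF ds[OF st]] by simp
    thus "\<exists>e\<in>?E. x \<in> pos e" using st by blast
  qed
  define T where "T = (\<lambda>x. (m x, n x))"
  \<comment> \<open>The half-line of sign \<open>s\<close> if \<open>P\<close> holds, and the origin
    otherwise. This parallels \<open>pos_dual_pair\<close>, so every face of a quadrant becomes a
    product of two such sets.\<close>
  define I where "I P s = {a::real. if P then s * a \<ge> 0 else a = 0}" for P s
  have P1: "P1_fan = {I P s | P s. s \<in> {1, -1}}"
  proof -
    have I: "I True 1 = {0..}" "I True (-1) = {..0}" "I False s = {0}" for s unfolding I_def by auto
    show ?thesis
    proof (intro equalityI subsetI)
      fix \<sigma> assume "\<sigma> \<in> P1_fan"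
      hence "\<sigma> = I False 1 \<or> \<sigma> = I True 1 \<or> \<sigma> = I True (-1)" unfolding I P1_fan_def by blast
      thus "\<sigma> \<in> {I P s | P s. s \<in> {1, -1}}" by blast
    next
      fix \<sigma> assume "\<sigma> \<in> {I P s | P s. s \<in> {1, -1}}"
      then obtain P s where "\<sigma> = I P s" "s = 1 \<or> s = -1" by blast
      thus "\<sigma> \<in> P1_fan" unfolding P1_fan_def using I by (cases P) auto
    qed
  qed
  have img: "T ` pos S = I (s *\<^sub>R u \<in> S) s \<times> I (t *\<^sub>R v \<in> S) t"
    if st: "s \<in> {1, -1}" "t \<in> {1, -1}" and S: "S \<subseteq> {s *\<^sub>R u, t *\<^sub>R v}" for s t S
  proof -
    have "s \<noteq> 0" "t \<noteq> 0" using st by auto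
    hence "pos S = T -` (I (s *\<^sub>R u \<in> S) s \<times> I (t *\<^sub>R v \<in> S) t)"
      unfolding pos_dual_pair[OF ds[OF st] S] T_def I_def by auto
    moreover have "surj T" using linear_bij_coordinates(2)[OF d] unfolding T_def bij_def by blast
    ultimately show ?thesis by (simp add: surj_image_vimage_eq)
  qed
  have "(\<lambda>\<sigma>. T ` \<sigma>) ` fan_of E = {\<sigma> \<times> \<tau> | \<sigma> \<tau>. \<sigma> \<in> P1_fan \<and> \<tau> \<in> P1_fan}"
  proof (intro equalityI subsetI)
    fix \<rho> assume "\<rho> \<in> (\<lambda>\<sigma>. T ` \<sigma>) ` fan_of E"
    then obtain \<sigma> where \<sigma>: "\<rho> = T ` \<sigma>" "\<sigma> \<in> fan_of E" by (rule imageE)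
    obtain e S where eS: "e \<in> E" "S \<subseteq> e" "\<sigma> = pos S" using fan_ofE[OF \<sigma>(2)] .
    note e = eS(1,2) \<sigma>(1)[unfolded eS(3)]
    then obtain s t where st: "s \<in> {1, -1}" "t \<in> {1, -1}" "e = {s *\<^sub>R u, t *\<^sub>R v}"
      unfolding \<open>?E = E\<close>[symmetric] by blast
    show "\<rho> \<in> {\<sigma> \<times> \<tau> | \<sigma> \<tau>. \<sigma> \<in> P1_fan \<and> \<tau> \<in> P1_fan}"
      unfolding e(3) img[OF st(1,2) e(2)[unfolded st(3)]] P1 using st(1,2) by blast
  next
    fix \<rho> assume "\<rho> \<in> {\<sigma> \<times> \<tau> | \<sigma> \<tau>. \<sigma> \<in> P1_fan \<and> \<tau> \<in> P1_fan}"
    then obtain P s Q t where st: "s \<in> {1, -1}" "t \<in> {1, -1}" and \<rho>: "\<rho> = I P s \<times> I Q t"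
      unfolding P1 by blast
    let ?S = "(if P then {s *\<^sub>R u} else {}) \<union> (if Q then {t *\<^sub>R v} else {})"
    have S: "?S \<subseteq> {s *\<^sub>R u, t *\<^sub>R v}" by auto
    have "s *\<^sub>R u \<noteq> t *\<^sub>R v" using dual_pairD(9)[OF ds[OF st]] .
    hence "s *\<^sub>R u \<in> ?S \<longleftrightarrow> P" "t *\<^sub>R v \<in> ?S \<longleftrightarrow> Q" by auto
    hence "\<rho> = T ` pos ?S" using img[OF st S] \<rho> by simp
    moreover have "{s *\<^sub>R u, t *\<^sub>R v} \<in> E" unfolding \<open>?E = E\<close>[symmetric] using st by blast
    ultimately show "\<rho> \<in> (\<lambda>\<sigma>. T ` \<sigma>) ` fan_of E" using fan_ofI[OF _ S] by blast
  qed
  thus ?thesis unfolding is_P1xP1_def toric_isomorphic_def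
    using linear_bij_coordinates[OF d] unfolding T_def by (intro exI[of _ "\<lambda>x. (m x, n x)"]) simp
qed

text \<open>The three cones cover the plane, so they are the whole fan; the coordinates with respect
  to \<open>u\<close> and \<open>v\<close> carry it to the standard one.\<close>

lemma triangle_P2:
  assumes E: "complete_bases N E" and t: "{u, v} \<in> E" "{v, w} \<in> E" "{w, u} \<in> E" and sum: "u + v + w = 0"
  shows "E = {{u, v}, {v, w}, {w, u}}" "is_P2 N (fan_of E)"
proof -
  obtain m n where d: "dual_pair N u v m n" using complete_bases_dual_pair[OF E t(1)] .
  have w: "w = (-1) *\<^sub>R u + (-1) *\<^sub>R v" using sum by (simp add: algebra_simps eq_neg_iff_add_eq_0)
  hence w': "w = (-1) *\<^sub>R v + (-1) *\<^sub>R u" by simp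
  have du: "dual_pair N u w (\<lambda>x. m x - n x) (\<lambda>x. - n x)" using dual_pair_change[OF d, of "-1" "-1"] w by simp
  have dv: "dual_pair N v w (\<lambda>x. n x - m x) (\<lambda>x. - m x)"
    using dual_pair_change[OF dual_pair_sym[OF d], of "-1" "-1"] w' by simp
  have "{{u, v}, {v, w}, {w, u}} = E"
  proof (rule complete_bases_cover_eq[OF E])
    fix x
    \<comment> \<open>The three cones correspond to which of 0, \<open>m x\<close> and
      \<open>n x\<close> is the smallest.\<close>
    have "x \<in> pos {u, v} \<or> x \<in> pos {v, w} \<or> x \<in> pos {w, u}"
      using mem_pos_pair(1)[OF d, of x] mem_pos_pair(1)[OF dv, of x] mem_pos_pair(1)[OF du, of x]
      by (auto simp: insert_commute)
    thus "\<exists>e\<in>{{u, v}, {v, w}, {w, u}}. x \<in> pos e" by auto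
  qed (use t in auto)
  thus EE: "E = {{u, v}, {v, w}, {w, u}}" by simp
  have dist: "u \<noteq> v" "v \<noteq> w" "u \<noteq> w" using dual_pairD(9)[OF d] dual_pairD(9)[OF dv] dual_pairD(9)[OF du] by auto
  define T where "T = (\<lambda>x. (m x, n x))"
  note D = dual_pairD[OF d]
  note T = linear_bij_coordinates[OF d, folded T_def]
  have Tim: "T ` {u, v, w} = {(1, 0), (0, 1), (-1, -1)}"
    unfolding T_def using D(1-6) w by (simp add: linear_add linear_cmul linear_neg linear_diff)
  have fan: "fan_of E = {pos S | S. S \<subset> {u, v, w}}"
  proof (intro equalityI subsetI)
    fix \<sigma> assume "\<sigma> \<in> fan_of E"
    then obtain e S where "e \<in> E" "S \<subseteq> e" "\<sigma> = pos S" by (rule fan_ofE)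
    moreover from this have "S \<subset> {u, v, w}" unfolding EE using dist by auto
    ultimately show "\<sigma> \<in> {pos S | S. S \<subset> {u, v, w}}" by blast
  next
    fix \<sigma> assume "\<sigma> \<in> {pos S | S. S \<subset> {u, v, w}}"
    then obtain S where S: "S \<subset> {u, v, w}" "\<sigma> = pos S" by blast
    hence "S \<subseteq> {u, v} \<or> S \<subseteq> {v, w} \<or> S \<subseteq> {w, u}" by auto
    thus "\<sigma> \<in> fan_of E" using fan_ofI[OF t(1), of S] fan_ofI[OF t(2), of S] fan_ofI[OF t(3), of S] S(2) by auto
  qed
  have Tpos: "T ` pos S = pos (T ` S)" for S using convex_cone_hull_linear_image[OF T(1), of S] by simp
  have injT: "inj T" using T(2) by (simp add: bij_def)
  have "(\<lambda>\<sigma>. T ` \<sigma>) ` fan_of E = P2_fan"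
  proof (intro equalityI subsetI)
    fix \<rho> assume "\<rho> \<in> (\<lambda>\<sigma>. T ` \<sigma>) ` fan_of E"
    then obtain S where S: "S \<subset> {u, v, w}" "\<rho> = pos (T ` S)" unfolding fan using Tpos by blast
    have "T ` S \<subset> T ` {u, v, w}" using S(1) injT by (metis image_mono inj_image_eq_iff psubset_eq)
    thus "\<rho> \<in> P2_fan" unfolding P2_fan_def Tim using S(2) by blast
  next
    fix \<rho> assume "\<rho> \<in> P2_fan"
    then obtain R where R: "R \<subset> T ` {u, v, w}" "\<rho> = pos R" unfolding P2_fan_def Tim by blast
    then obtain S where S: "S \<subseteq> {u, v, w}" "R = T ` S" by (metis psubset_imp_subset subset_image_iff)
    hence "S \<subset> {u, v, w}" using R(1) by blast
    thus "\<rho> \<in> (\<lambda>\<sigma>. T ` \<sigma>) ` fan_of E" unfolding fan using S(2) R(2) Tpos by blast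
  qed
  thus "is_P2 N (fan_of E)" unfolding is_P2_def toric_isomorphic_def using T by blast
qed

end

section \<open>Rays under a symmetry of order three\<close>

lemma real_vector_eq_minus:
  fixes x :: "'a::real_vector"
  assumes "x = - x"
  shows "x = 0"
proof -
  have "2 *\<^sub>R x = 0" unfolding scaleR_2 using assms by (simp only: eq_neg_iff_add_eq_0)
  thus ?thesis by simp
qed

text \<open>The two cones fill the half-plane m \<ge> 0, so \<open>u\<close> is the only ray with m
  > 0. As \<open>v\<close> and -v are rays, so are their images under \<open>s\<close> and its
  square, and m (s (s v)) = - m (s v). If this is nonzero, two of these images equal
  \<open>u\<close>, which forces v = 0. If it vanishes, \<open>s v\<close> is a real multiple b of
  \<open>v\<close> with b^2 + b + 1 = 0, which is impossible.\<close>

lemma (in lattice_plane) order_three_no_opposite: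
  assumes E: "complete_bases N E" and e: "{u, v} \<in> E" "{u, - v} \<in> E"
    and s: "linear s" "\<And>x. s (s x) = - s x - x" "\<And>w. w \<in> \<Union>E \<Longrightarrow> s w \<in> \<Union>E"
  shows False
proof -
  obtain m n where d: "dual_pair N u v m n" using complete_bases_dual_pair[OF E e(1)] .
  note D = dual_pairD[OF d]
  have d': "dual_pair N u (- v) m (\<lambda>x. - n x)" using dual_pair_change[OF d, of "-1" 0] by simp
  have mv: "m (- w) = - m w" for w using linear_neg[OF D(1)] .
  have v0: "v \<noteq> 0" using edge_nonzero[OF E e(1)] by simp
  have half: "r = u" if r: "r \<in> \<Union>E" "m r > 0" for r
  proof -
    have "r \<in> pos {u, v} \<or> r \<in> pos {u, - v}"
      using mem_pos_pair(1)[OF d] mem_pos_pair(1)[OF d'] r(2) by auto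
    hence "r \<in> {u, v, - v}" using ray_mem_pos[OF E e(1) r(1)] ray_mem_pos[OF E e(2) r(1)] by blast
    thus ?thesis using r(2) D(4) mv[of v] by auto
  qed
  have V: "v \<in> \<Union>E" "- v \<in> \<Union>E" using e by blast+
  have sn: "s (- w) = - s w" for w using linear_neg[OF s(1)] .
  have R: "s v \<in> \<Union>E" "- s v \<in> \<Union>E" "s (s v) \<in> \<Union>E" "- s (s v) \<in> \<Union>E"
    using s(3)[OF V(1)] s(3)[OF V(2)] s(3)[OF s(3)[OF V(1)]] s(3)[OF s(3)[OF V(2)]] unfolding sn by auto
  have mss: "m (s (s v)) = - m (s v)"
    unfolding s(2) using linear_diff[OF D(1)] mv D(4) by simp
  consider "m (s v) = 0" | "m (s v) > 0" | "m (s v) < 0" by linarith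
  thus False
  proof cases
    case 1
    define b where "b = n (s v)"
    have b: "s v = b *\<^sub>R v" using D(7)[of "s v"] 1 unfolding b_def by simp
    hence "(b * b) *\<^sub>R v = - (b *\<^sub>R v) - v" using s(2)[of v] linear_cmul[OF s(1)] by simp
    hence "(b * b + b + 1) *\<^sub>R v = 0" by (simp add: scaleR_left_distrib)
    hence "b * b + b + 1 = 0" using v0 by simp
    thus False using zero_le_square[of "b + 1/2"] by (simp add: algebra_simps)
  next
    case 2
    have "s v = u" using half[OF R(1)] 2 by simp
    moreover have "- s (s v) = u" using half[OF R(4)] mss mv 2 by simp
    ultimately show False using s(2)[of v] v0 by simp
  next
    case 3
    have "- s v = u" using half[OF R(2)] mv 3 by simp
    moreover have "s (s v) = u" using half[OF R(3)] mss 3 by simp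
    ultimately show False using s(2)[of v] v0 by simp
  qed
qed

text \<open>Write points in the basis \<open>v\<close>, \<open>v'\<close>. Any ray other than
  \<open>u\<close>, \<open>v\<close>, \<open>v'\<close> lies strictly inside the remaining sector
  and, by integrality, has first coordinate at least 1. If \<open>s u\<close> is not a neighbour,
  this applies to both \<open>s u\<close> and \<open>s (s u)\<close>, but their sum is -u, with
  first coordinate 1.\<close>

lemma (in lattice_plane) order_three_triangle:
  assumes E: "complete_bases N E" and e: "{u, v} \<in> E" "{u, v'} \<in> E" "u + v + v' = 0"
    and s: "linear s" "\<And>x. s (s x) = - s x - x" "\<And>w. w \<in> \<Union>E \<Longrightarrow> s w \<in> \<Union>E"
  shows "s u = v \<or> s u = v'"
proof (rule ccontr)
  assume ne: "\<not> (s u = v \<or> s u = v')"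
  obtain m n where d0: "dual_pair N u v m n" using complete_bases_dual_pair[OF E e(1)] .
  have v': "v' = (-1) *\<^sub>R v + (-1) *\<^sub>R u" using e(3) by (simp add: eq_neg_iff_add_eq_0 algebra_simps)
  define i j where "i = (\<lambda>x. n x - m x)" and "j = (\<lambda>x. - m x)"
  have d: "dual_pair N v v' i j"
    using dual_pair_change[OF dual_pair_sym[OF d0], of "-1" "-1"] v' unfolding i_def j_def by simp
  have u: "u = (-1) *\<^sub>R v + (-1) *\<^sub>R v'" using v' by simp
  have d1: "dual_pair N v u (\<lambda>x. i x - j x) (\<lambda>x. - j x)" using dual_pair_change[OF d, of "-1" "-1"] u by simp
  have d2: "dual_pair N v' u (\<lambda>x. j x - i x) (\<lambda>x. - i x)"
    using dual_pair_change[OF dual_pair_sym[OF d], of "-1" "-1"] u by (simp add: add.commute)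
  note D = dual_pairD[OF d]
  have u0: "u \<noteq> 0" using edge_nonzero[OF E e(1)] by simp
  have big: "i r \<ge> 1" if r: "r \<in> \<Union>E" "r \<notin> {u, v, v'}" for r
  proof -
    have "r \<notin> pos {u, v}" "r \<notin> pos {u, v'}"
      using ray_mem_pos[OF E e(1) r(1)] ray_mem_pos[OF E e(2) r(1)] r(2) by blast+
    hence "\<not> (i r - j r \<ge> 0 \<and> - j r \<ge> 0)" "\<not> (j r - i r \<ge> 0 \<and> - i r \<ge> 0)"
      using mem_pos_pair(1)[OF d1, of r] mem_pos_pair(1)[OF d2, of r] by (simp_all add: insert_commute)
    hence pos: "i r > 0" by linarith
    obtain f where f: "f \<in> E" "r \<in> f" using r(1) by blast
    obtain p q k l where "f = {p, q}" "dual_pair N p q k l"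
      using lattice_basis_pair[OF dim2 complete_basesD(2)[OF E f(1)]] .
    hence "r \<in> N" using f(2) dual_pair_dual_lattice by blast
    hence "i r \<in> \<int>" using D(8) by blast
    then obtain z where "i r = of_int z" by (auto elim: Ints_cases)
    thus ?thesis using pos by simp
  qed
  have uR: "u \<in> \<Union>E" using e(1) by blast
  have "s u \<noteq> u"
  proof
    assume h: "s u = u"
    hence "u = - u - u" using s(2)[of u] by simp
    hence "1 *\<^sub>R u = (- 2) *\<^sub>R u" by (simp add: scaleR_2)
    thus False using u0 unfolding scaleR_cancel_right by simp
  qed
  hence 1: "i (s u) \<ge> 1" using big[OF s(3)[OF uR]] ne by blast
  have ss: "s u = - s (s u) - u" using s(2)[of u] by simp
  have "s (s u) \<noteq> u"
  proof
    assume h: "s (s u) = u"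
    hence "s (s (s u)) = s u" by simp
    moreover have "s (s (s u)) = u"
      using s(2)[of "s u"] s(2)[of u] by simp
    ultimately show False using \<open>s u \<noteq> u\<close> by simp
  qed
  moreover have "v' = - v - u" "v = - v' - u" using v' by simp_all
  \<comment> \<open>The relations u + s u + s (s u) = 0 and u + v + v' = 0 show that if
    \<open>s (s u)\<close> were one neighbour, \<open>s u\<close> would be the other.\<close>
  hence "s (s u) \<noteq> v" "s (s u) \<noteq> v'" using ss ne by auto
  ultimately have 2: "i (s (s u)) \<ge> 1" using big[OF s(3)[OF s(3)[OF uR]]] by blast
  have "i (s (s u)) = - i (s u) - i u" unfolding s(2) using linear_diff[OF D(1)] linear_neg[OF D(1)] by simp
  moreover have "i u = -1" using dual_pair_unique(1)[OF d u] .
  ultimately show False using 1 2 by simp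
qed

section \<open>Either a minimal model or an equivariant contraction, for each group\<close>

context lattice_plane
begin

lemma uminus_ray:
  assumes "complete_bases N E" "subgroup G (Aut_fan N (fan_of E))" "uminus \<in> G"
  shows "w \<in> \<Union>E \<Longrightarrow> - w \<in> \<Union>E" "{a, b} \<in> E \<Longrightarrow> {- a, - b} \<in> E"
  using group_ray[OF assms, of w] group_edge[OF assms, of a b] by simp_all

text \<open>Shared by orders two and four, which differ only in the reason why an orbit contains no
  neighbours of \<open>u\<close>; that reason is supplied as \<open>nonadj\<close>.\<close>

lemma step_symmetric:
  assumes E: "complete_bases N E" and G: "subgroup G (Aut_fan N (fan_of E))" and m: "uminus \<in> G"
    and nonadj: "\<And>u v v' h. blow_down_pair E u v v' \<Longrightarrow> h \<in> G \<Longrightarrow> {u, h u} \<notin> E"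
  shows "is_P1xP1 N (fan_of E) \<or> (\<exists>u v v'. blow_down_pair E u v v' \<and> (\<forall>h\<in>G. {u, h u} \<notin> E))"
proof (rule longest_ray[OF E])
  fix u v v' assume "blow_down_pair E u v v'"
  thus ?thesis using nonadj by blast
next
  fix u v assume "{u, v} \<in> E" "{u, - v} \<in> E"
  thus ?thesis using quadrants_P1xP1[OF E uminus_ray(2)[OF E G m]] by blast
next
  fix u v v' assume "{u, v} \<in> E" "{u, v'} \<in> E" "u + v + v' = 0"
  thus ?thesis using no_triangle_if_symmetric[OF E uminus_ray(1)[OF E G m]] by blast
qed

lemma nonadjacent_self:
  assumes "complete_bases N E"
  shows "{u, u} \<notin> E" "{u, - u} \<notin> E"
  using edge_nonzero(3)[OF assms, of u u] edge_nonzero(4)[OF assms, of u "- u"] by auto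

text \<open>A neighbour of \<open>u\<close> in its orbit must be g u or -g u, and turning this edge
  around by \<open>g\<close> makes both of them neighbours. Their sum is 0, whereas a contractible
  ray is the sum of its neighbours.\<close>

lemma step_four:
  assumes E: "complete_bases N E" and G: "subgroup G (Aut_fan N (fan_of E))"
    and g: "g \<in> G" "\<And>x. g (g x) = - x" and Gg: "\<forall>h\<in>G. \<forall>x. h x \<in> {x, - x, g x, - g x}"
    and b: "blow_down_pair E u v v'" and h: "h \<in> G"
  shows "{u, h u} \<notin> E"
proof
  assume uh: "{u, h u} \<in> E"
  have lin: "linear g" using Aut_fanD(1)[OF subgroup_Aut_fanD(1)[OF G g(1)]] .
  have "h u \<noteq> u" "h u \<noteq> - u" using nonadjacent_self[OF E, of u] uh by metis+
  hence "h u = g u \<or> h u = - g u" using spec[OF bspec[OF Gg h], of u] by blast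
  hence "{u, g u} \<in> E \<and> {u, - g u} \<in> E"
  proof
    assume "h u = g u"
    hence *: "{u, g u} \<in> E" using uh by simp
    from group_edge[OF E G g(1) this] have "{g u, - u} \<in> E" using g(2) by simp
    from group_edge[OF E G g(1) this] have "{- u, - g u} \<in> E" using g(2) lin by (simp add: linear_neg)
    from group_edge[OF E G g(1) this] have "{- g u, u} \<in> E" using g(2) lin by (simp add: linear_neg)
    thus ?thesis using * by (simp add: insert_commute)
  next
    assume "h u = - g u"
    hence *: "{u, - g u} \<in> E" using uh by simp
    from group_edge[OF E G g(1) this] have "{g u, u} \<in> E" using g(2) lin by (simp add: linear_neg)
    thus ?thesis using * by (simp add: insert_commute)
  qed
  note adj = this
  have "g u \<noteq> - g u"
  proof
    assume "g u = - g u"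
    hence "g u = 0" by (rule real_vector_eq_minus)
    hence "u = 0" using g(2)[of u] lin by (simp add: linear_0)
    thus False using edge_nonzero(1)[OF E uh] by simp
  qed
  thus False using blow_down_pair_sum[OF b] adj edge_nonzero(1)[OF E uh] by force
qed

text \<open>If one of g u and g (g u) is a neighbour of \<open>u\<close>, so is the other, and their
  sum -u is not \<open>u\<close>. In the case u + v + v' = 0, one neighbour lies in the orbit by
  \<open>order_three_triangle\<close>, so the orbit is a triangle and the whole fan.\<close>

lemma step_three:
  assumes E: "complete_bases N E" and G: "subgroup G (Aut_fan N (fan_of E))"
    and g: "g \<in> G" "\<And>x. g (g x) = - g x - x" and Gg: "\<forall>h\<in>G. \<forall>x. h x \<in> {x, g x, g (g x)}"
  shows "is_P2 N (fan_of E) \<or> (\<exists>u v v'. blow_down_pair E u v v' \<and> (\<forall>h\<in>G. {u, h u} \<notin> E))"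
proof -
  have lin: "linear g" using Aut_fanD(1)[OF subgroup_Aut_fanD(1)[OF G g(1)]] .
  have ggg: "g (g (g x)) = x" for x using g(2)[of "g x"] g(2)[of x] by simp
  note ray = group_ray[OF E G g(1)] and edge = group_edge[OF E G g(1)]
  have adj: "{u, g u} \<in> E \<and> {u, g (g u)} \<in> E" if "h \<in> G" "{u, h u} \<in> E" for u h
  proof -
    have "h u \<noteq> u" using nonadjacent_self(1)[OF E, of u] that(2) by metis
    hence "h u = g u \<or> h u = g (g u)" using spec[OF bspec[OF Gg that(1)], of u] by blast
    thus ?thesis
    proof
      assume "h u = g u"
      hence 1: "{u, g u} \<in> E" using that(2) by simp
      from edge[OF edge[OF 1]] have "{g (g u), u} \<in> E" by (simp add: ggg)
      thus ?thesis using 1 by (simp add: insert_commute)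
    next
      assume "h u = g (g u)"
      hence 1: "{u, g (g u)} \<in> E" using that(2) by simp
      from edge[OF this] have "{g u, u} \<in> E" by (simp add: ggg)
      thus ?thesis using 1 by (simp add: insert_commute)
    qed
  qed
  show ?thesis
  proof (rule longest_ray[OF E])
    fix u v v' assume b: "blow_down_pair E u v v'"
    have "{u, h u} \<notin> E" if h: "h \<in> G" for h
    proof
      assume uh: "{u, h u} \<in> E"
      note a = adj[OF h uh]
      have u0: "u \<noteq> 0" using edge_nonzero(1)[OF E uh] .
      have ne: "g u \<noteq> g (g u)" using edge_nonzero(3)[OF E edge[of u "g u"]] a by blast
      have "u = g u + g (g u)" using blow_down_pair_sum[OF b _ _ ne] a by simp
      hence "u = - u" using g(2)[of u] by simp
      thus False using u0 real_vector_eq_minus by blast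
    qed
    thus ?thesis using b by blast
  next
    fix u v assume "{u, v} \<in> E" "{u, - v} \<in> E"
    thus ?thesis using order_three_no_opposite[OF E _ _ lin g(2) ray] by blast
  next
    fix u v v' assume t: "{u, v} \<in> E" "{u, v'} \<in> E" "u + v + v' = 0"
    have "{u, g u} \<in> E" using order_three_triangle[OF E t lin g(2) ray] t(1,2) by auto
    moreover from edge[OF this] have 2: "{g u, g (g u)} \<in> E" .
    moreover from edge[OF this] have "{g (g u), u} \<in> E" by (simp add: ggg)
    moreover have "u + g u + g (g u) = 0" using g(2)[of u] by simp
    ultimately have "is_P2 N (fan_of E)" by (rule triangle_P2(2)[OF E])
    thus ?thesis ..
  qed
qed

text \<open>Applying \<open>g\<close> repeatedly to the edge gives the hexagon u, w, w - u, -u, -w,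
  u - w. Every second ray is contracted; the remaining w, u - w, -u sum to 0 and form the fan of the
  projective plane. \<open>D\<close> is an orbit of the square of \<open>g\<close> only, which fits
  \<open>is_Bl3_P2\<close>, a statement about a plain blow-up at all fixed points.\<close>

lemma hexagon_Bl3_P2:
  assumes E: "complete_bases N E" and G: "subgroup G (Aut_fan N (fan_of E))"
    and g: "g \<in> G" "\<And>x. g (g x) = g x - x" and a: "{u, g u} \<in> E"
  shows "is_Bl3_P2 N (fan_of E)"
proof -
  have lin: "linear g" using Aut_fanD(1)[OF subgroup_Aut_fanD(1)[OF G g(1)]] .
  note edge = group_edge[OF E G g(1)]
  note gs = linear_diff[OF lin] linear_neg[OF lin] g(2)
  define w where "w = g u"
  have gw: "g u = w" "g w = w - u" unfolding w_def using g(2) by simp_all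
  have e1: "{u, w} \<in> E" using a gw by simp
  have e2: "{w, w - u} \<in> E" using edge[OF e1] gw by simp
  have e3: "{w - u, - u} \<in> E" using edge[OF e2] gw gs by simp
  have e4: "{- u, - w} \<in> E" using edge[OF e3] gw gs by simp
  have e5: "{- w, u - w} \<in> E" using edge[OF e4] gw gs by simp
  have e6: "{u - w, u} \<in> E" using edge[OF e5] gw gs by simp
  obtain m n where d: "dual_pair N u w m n" using complete_bases_dual_pair[OF E e1] .
  have u0: "u \<noteq> 0" and w0: "w \<noteq> 0" using edge_nonzero[OF E e1] by auto
  have ne: "w \<noteq> u - w"
  proof
    assume "w = u - w"
    hence "u = 0 *\<^sub>R u + 2 *\<^sub>R w" by (simp add: scaleR_2 algebra_simps)
    from dual_pair_unique(1)[OF d this] show False using dual_pairD(3)[OF d] by simp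
  qed
  have b1: "blow_down_pair E u w (u - w)"
    unfolding blow_down_pair_def using e1 e6 two_neighbours[OF E e1 _ ne] by (auto simp: insert_commute)
  have b2: "blow_down_pair E (w - u) (- u) w"
    using group_blow_down_pair[OF E G g(1) group_blow_down_pair[OF E G g(1) b1]] gw gs by simp
  have b3: "blow_down_pair E (- w) (u - w) (- u)"
    using group_blow_down_pair[OF E G g(1) group_blow_down_pair[OF E G g(1) b2]] gw gs by simp
  define D where "D = {u, w - u, - w}"
  have mn: "m u = 1" "n u = 0" "m w = 0" "n w = 1" "m (- u) = - 1" "n (- u) = 0" "m (- w) = 0" "n (- w) = - 1"
    "m (w - u) = - 1" "n (w - u) = 1" "m (u - w) = 1" "n (u - w) = - 1"
    using dual_pairD(1-6)[OF d] by (simp_all add: linear_diff linear_neg)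
  \<comment> \<open>The six rays are told apart by their coordinates in the basis \<open>u\<close>,
    \<open>w\<close>.\<close>
  have neq: "x \<noteq> y" if "m x \<noteq> m y \<or> n x \<noteq> n y" for x y using that by auto
  have nD: "w \<notin> D" "- u \<notin> D" "u - w \<notin> D"
    unfolding D_def by (simp_all only: insert_iff empty_iff de_Morgan_disj simp_thms; intro conjI neq; simp add: mn)+
  have con: "contractible_rays E D"
    unfolding contractible_rays_def D_def[symmetric] using b1 b2 b3 nD unfolding D_def by blast
  interpret contraction N E D by unfold_locales (rule E, rule con)
  have uD: "u \<in> D" "w - u \<in> D" "- w \<in> D" unfolding D_def by simp_all
  have f: "{w, u - w} \<in> blown_down" "{u - w, - u} \<in> blown_down" "{- u, w} \<in> blown_down"
    using blow_down_pair_contracted[OF uD(1) b1] blow_down_pair_contracted[OF uD(2) b2]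
      blow_down_pair_contracted[OF uD(3) b3] by auto
  note P2 = triangle_P2[OF complete_bases_contracted f]
  have "w + (u - w) + - u = 0" by simp
  note P2 = P2[OF this]
  have "centres = torus_fixed_points N (fan_of blown_down)"
    unfolding torus_fixed_points_fan_of[OF complete_bases_contracted]
  proof (intro equalityI subsetI)
    fix a assume "a \<in> centres"
    thus "a \<in> fixed_point ` blown_down" unfolding centres_def using blow_down_pair_contracted by blast
  next
    fix a assume "a \<in> fixed_point ` blown_down"
    hence "a = fixed_point {w, u - w} \<or> a = fixed_point {u - w, - u} \<or> a = fixed_point {- u, w}"
      unfolding P2(1) by blast
    thus "a \<in> centres" unfolding centres_def using uD b1 b2 b3 by blast
  qed
  thus ?thesis unfolding is_Bl3_P2_def using P2(2) toric_blow_up_contracted by metis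
qed

text \<open>-Id excludes the triangle, and the square of \<open>g\<close>, of order three, excludes
  opposite neighbours. So there is a contractible ray \<open>u\<close>, and only adjacency within
  its orbit can prevent the contraction.\<close>

lemma step_six:
  assumes E: "complete_bases N E" and G: "subgroup G (Aut_fan N (fan_of E))" and m: "uminus \<in> G"
    and g: "g \<in> G" "\<And>x. g (g x) = g x - x"
    and Gg: "\<forall>h\<in>G. \<forall>x. h x \<in> {x, - x, g x, - g x, g x - x, x - g x}"
  shows "is_Bl3_P2 N (fan_of E) \<or> (\<exists>u v v'. blow_down_pair E u v v' \<and> (\<forall>h\<in>G. {u, h u} \<notin> E))"
proof -
  have lin: "linear g" using Aut_fanD(1)[OF subgroup_Aut_fanD(1)[OF G g(1)]] .
  note gs = linear_diff[OF lin] linear_neg[OF lin] g(2)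
  note edge = group_edge[OF E G g(1)]
  define s where "s = g \<circ> g"
  have s: "linear s" "\<And>x. s (s x) = - s x - x" "\<And>w. w \<in> \<Union>E \<Longrightarrow> s w \<in> \<Union>E"
    using linear_compose[OF lin lin] group_ray[OF E G g(1) group_ray[OF E G g(1)]] unfolding s_def
    by (simp_all only: o_apply) (simp add: gs)
  show ?thesis
  proof (rule longest_ray[OF E])
    fix u v assume "{u, v} \<in> E" "{u, - v} \<in> E"
    thus ?thesis using order_three_no_opposite[OF E _ _ s] by blast
  next
    fix u v v' assume "{u, v} \<in> E" "{u, v'} \<in> E" "u + v + v' = 0"
    thus ?thesis using no_triangle_if_symmetric[OF E uminus_ray(1)[OF E G m]] by blast
  next
    fix u v v' assume b: "blow_down_pair E u v v'"
    show ?thesis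
    proof (cases "\<exists>h\<in>G. {u, h u} \<in> E")
      case False thus ?thesis using b by blast
    next
      case True
      then obtain h where h: "h \<in> G" "{u, h u} \<in> E" by blast
      have u0: "u \<noteq> 0" using edge_nonzero(1)[OF E h(2)] .
      have "h u \<noteq> u" "h u \<noteq> - u" using nonadjacent_self[OF E, of u] h(2) by metis+
      hence "h u = g u \<or> h u = - g u \<or> h u = g u - u \<or> h u = u - g u"
        using spec[OF bspec[OF Gg h(1)], of u] by blast
      note hu = this
      \<comment> \<open>These neighbours are the images of \<open>u\<close> under the fourth and
        second powers of \<open>g\<close>. Their sum is -u instead of \<open>u\<close>.\<close>
      have key: False if 1: "{u, - g u} \<in> E" and 2: "{u, g u - u} \<in> E"
      proof -
        have "- g u \<noteq> g u - u"
        proof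
          assume h: "- g u = g u - u"
          hence "g (- g u) = g (g u - u)" by simp
          hence "u - g u = - u" by (simp add: gs)
          hence g2: "g u = 2 *\<^sub>R u" by (simp add: scaleR_2 algebra_simps)
          hence "(- 2) *\<^sub>R u = 1 *\<^sub>R u" using h by (simp add: scaleR_2)
          thus False using u0 unfolding scaleR_cancel_right by simp
        qed
        hence "u = - u" using blow_down_pair_sum[OF b 1 2] by simp
        thus False using u0 real_vector_eq_minus by blast
      qed
      have "h u \<noteq> - g u"
      proof
        assume "h u = - g u"
        hence 1: "{u, - g u} \<in> E" using h(2) by simp
        from edge[OF edge[OF this]] have "{g u - u, u} \<in> E" by (simp add: gs)
        hence 2: "{u, g u - u} \<in> E" by (simp add: insert_commute)
        show False by (rule key[OF 1 2])
      qed
      moreover have "h u \<noteq> g u - u"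
      proof
        assume "h u = g u - u"
        hence 1: "{u, g u - u} \<in> E" using h(2) by simp
        from edge[OF edge[OF edge[OF edge[OF this]]]] have "{- g u, u} \<in> E" by (simp add: gs)
        hence 2: "{u, - g u} \<in> E" by (simp add: insert_commute)
        show False by (rule key[OF 2 1])
      qed
      ultimately have "h u = g u \<or> h u = u - g u" using hu by blast
      \<comment> \<open>u - g u is the inverse image of \<open>u\<close> under \<open>g\<close>, so
        applying \<open>g\<close> to the edge yields the neighbour \<open>g u\<close>.\<close>
      hence "{u, g u} \<in> E"
      proof
        assume "h u = u - g u"
        hence "{u, u - g u} \<in> E" using h(2) by simp
        from edge[OF this] have "{g u, u} \<in> E" by (simp add: gs)
        thus ?thesis by (simp add: insert_commute)
      qed (use h in auto)
      thus ?thesis using hexagon_Bl3_P2[OF E G g] by blast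
    qed
  qed
qed

end

theorem proposition3p12:
  fixes N :: "'a::euclidean_space set" and \<Sigma> :: "'a set set"
    and p :: nat and G :: "('a \<Rightarrow> 'a) set"
  assumes "DIM('a) = 2" and "full_lattice N"
    and "foldable N \<Sigma>"
    and "p \<ge> 2" and "cyclic_Aut_subgroup N \<Sigma> p G"
  shows "(p \<in> {2, 4} \<longrightarrow>
            (\<exists>\<Sigma>\<^sub>0. is_P1xP1 N \<Sigma>\<^sub>0 \<and> successive_equivariant_blow_ups N G \<Sigma>\<^sub>0 \<Sigma>)) \<and>
         (p = 3 \<longrightarrow>
            (\<exists>\<Sigma>\<^sub>0. is_P2 N \<Sigma>\<^sub>0 \<and> successive_equivariant_blow_ups N G \<Sigma>\<^sub>0 \<Sigma>)) \<and>
         (p = 6 \<longrightarrow>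
            (\<exists>\<Sigma>\<^sub>0. is_Bl3_P2 N \<Sigma>\<^sub>0 \<and> successive_equivariant_blow_ups N G \<Sigma>\<^sub>0 \<Sigma>))"
proof -
  interpret lattice_plane N by unfold_locales (rule assms(1))
  have cs: "complete_smooth_fan N \<Sigma>" using assms(3) unfolding foldable_def by blast
  define E where "E = maximal_bases N \<Sigma>"
  have E: "complete_bases N E" and \<Sigma>: "fan_of E = \<Sigma>"
    using complete_bases_maximal_bases[OF cs] unfolding E_def by auto
  have sub: "subgroup G (Aut_fan N (fan_of E))" using assms(5) unfolding cyclic_Aut_subgroup_def \<Sigma> by blast
  obtain g where gk: "\<And>k. g ^^ k \<in> G" and Gk: "G = {g ^^ k | k. k < p}" and gp: "g ^^ p = id"
    and gne: "\<And>k. 0 < k \<Longrightarrow> k < p \<Longrightarrow> g ^^ k \<noteq> id"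
    by (rule cyclic_Aut_subgroup_generator[OF assms(5,4)]) blast
  have gG: "g \<in> G" using gk[of 1] by simp
  have lin: "linear g" using Aut_fanD(1)[OF subgroup_Aut_fanD(1)[OF sub gG]] .
  obtain e where e: "e \<in> E" using complete_basesD(4)[OF E] by blast
  obtain u v m n where d: "dual_pair N u v m n" by (rule lattice_basis_pair[OF dim2 complete_basesD(2)[OF E e]])
  have nz: "\<exists>x::'a. x \<noteq> 0" using dual_pairD(3)[OF d] linear_0[OF dual_pairD(1)[OF d]] by (intro exI[of _ u]) auto
  obtain t c where ch: "\<And>x. g (g x) = t *\<^sub>R g x - c *\<^sub>R x" by (rule cayley_hamilton[OF d lin]) blast
  have pt: "(g ^^ p) x = x" for x using gp by simp
  have ne: "\<exists>x. (g ^^ k) x \<noteq> x" if "0 < k" "k < p" for k using gne[OF that] by (auto simp: fun_eq_iff)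
  have pow: "(g ^^ 2) x = g (g x)" "(g ^^ 3) x = g (g (g x))" "(g ^^ 4) x = g (g (g (g x)))"
    "(g ^^ 5) x = g (g (g (g (g x))))" "(g ^^ 6) x = g (g (g (g (g (g x)))))" for x
    by (simp_all add: numeral_eq_Suc)
  have less: "k < 3 \<Longrightarrow> k = 0 \<or> k = 1 \<or> k = 2" "k < 4 \<Longrightarrow> k = 0 \<or> k = 1 \<or> k = 2 \<or> k = 3"
    "k < 6 \<Longrightarrow> k = 0 \<or> k = 1 \<or> k = 2 \<or> k = 3 \<or> k = 4 \<or> k = 5" for k :: nat by auto
  have 2: "\<exists>\<Sigma>\<^sub>0. is_P1xP1 N \<Sigma>\<^sub>0 \<and> successive_equivariant_blow_ups N G \<Sigma>\<^sub>0 \<Sigma>" if p: "p = 2"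
  proof -
    \<comment> \<open>Here the convention on order two enters; the group generated by a reflection
      does not contain -Id.\<close>
    have G2: "G = {id, uminus}" using assms(5) p unfolding cyclic_Aut_subgroup_def by blast
    show ?thesis
      unfolding \<Sigma>[symmetric]
    proof (rule successive_contractions[OF E sub])
      fix E assume E: "complete_bases N E" and sub: "subgroup G (Aut_fan N (fan_of E))"
      have "{u, h u} \<notin> E" if "h \<in> G" for u h using that nonadjacent_self[OF E] unfolding G2 by auto
      thus "is_P1xP1 N (fan_of E) \<or> (\<exists>u v v'. blow_down_pair E u v v' \<and> (\<forall>h\<in>G. {u, h u} \<notin> E))"
        using step_symmetric[OF E sub] G2 by blast
    qed
  qed
  have 4: "\<exists>\<Sigma>\<^sub>0. is_P1xP1 N \<Sigma>\<^sub>0 \<and> successive_equivariant_blow_ups N G \<Sigma>\<^sub>0 \<Sigma>" if p: "p = 4"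
  proof -
    have gg: "g (g x) = - x" for x
      by (rule order_four[OF ch nz lin]) (use pt ne[of 2] pow p in auto)
    hence um: "uminus \<in> G" using gk[of 2] pow(1) by (metis ext)
    have Gg: "\<forall>h\<in>G. \<forall>x. h x \<in> {x, - x, g x, - g x}"
    proof
      fix h assume h: "h \<in> G"
      obtain k where k: "h = g ^^ k" "k < 4" using h Gk p by blast
      show "\<forall>x. h x \<in> {x, - x, g x, - g x}" using less(2)[OF k(2)] unfolding k(1) by (auto simp: pow gg linear_neg[OF lin])
    qed
    show ?thesis
      unfolding \<Sigma>[symmetric]
    proof (rule successive_contractions[OF E sub])
      fix E assume E: "complete_bases N E" and sub: "subgroup G (Aut_fan N (fan_of E))"
      show "is_P1xP1 N (fan_of E) \<or> (\<exists>u v v'. blow_down_pair E u v v' \<and> (\<forall>h\<in>G. {u, h u} \<notin> E))"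
        by (rule step_symmetric[OF E sub um]) (rule step_four[OF E sub gG gg Gg])
    qed
  qed
  have 3: "\<exists>\<Sigma>\<^sub>0. is_P2 N \<Sigma>\<^sub>0 \<and> successive_equivariant_blow_ups N G \<Sigma>\<^sub>0 \<Sigma>" if p: "p = 3"
  proof -
    have gg: "g (g x) = - g x - x" for x
      by (rule order_three[OF ch nz lin]) (use pt ne[of 1] pow p in auto)
    have Gg: "\<forall>h\<in>G. \<forall>x. h x \<in> {x, g x, g (g x)}"
    proof
      fix h assume h: "h \<in> G"
      obtain k where k: "h = g ^^ k" "k < 3" using h Gk p by blast
      show "\<forall>x. h x \<in> {x, g x, g (g x)}" using less(1)[OF k(2)] unfolding k(1) by (auto simp: pow)
    qed
    show ?thesis
      unfolding \<Sigma>[symmetric] by (rule successive_contractions[OF E sub]) (rule step_three[OF _ _ gG gg Gg])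
  qed
  have 6: "\<exists>\<Sigma>\<^sub>0. is_Bl3_P2 N \<Sigma>\<^sub>0 \<and> successive_equivariant_blow_ups N G \<Sigma>\<^sub>0 \<Sigma>" if p: "p = 6"
  proof -
    \<comment> \<open>The square of \<open>g\<close> has order three. Its relation, obtained from a
      Cayley-Hamilton equation of its own, is the input for the relation of
      \<open>g\<close>.\<close>
    define s where "s = g \<circ> g"
    have sl: "linear s" unfolding s_def using lin lin by (rule linear_compose)
    obtain t' c' where ch': "\<And>x. s (s x) = t' *\<^sub>R s x - c' *\<^sub>R x" by (rule cayley_hamilton[OF d sl]) blast
    have "s (s x) = - s x - x" for x
      by (rule order_three[OF ch' nz sl]) (use pt ne[of 2] pow p in \<open>auto simp: s_def\<close>)
    hence s4: "g (g (g (g x))) = - g (g x) - x" for x by (simp add: s_def)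
    have gg: "g (g x) = g x - x" for x
      by (rule order_six[OF ch nz lin s4]) (use ne[of 3] pow p in auto)
    note gs = linear_diff[OF lin] linear_neg[OF lin] gg
    have um: "uminus \<in> G"
    proof -
      \<comment> \<open>From g^2 = g - 1 one gets g^3 = g^2 - g = -1, so the group contains
        -Id.\<close>
      have "(g ^^ 3) x = - x" for x by (simp add: pow gs)
      thus ?thesis using gk[of 3] by (metis ext)
    qed
    have Gg: "\<forall>h\<in>G. \<forall>x. h x \<in> {x, - x, g x, - g x, g x - x, x - g x}"
    proof
      fix h assume h: "h \<in> G"
      obtain k where k: "h = g ^^ k" "k < 6" using h Gk p by blast
      show "\<forall>x. h x \<in> {x, - x, g x, - g x, g x - x, x - g x}" using less(3)[OF k(2)] unfolding k(1) by (auto simp: pow gs)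
    qed
    show ?thesis
      unfolding \<Sigma>[symmetric] by (rule successive_contractions[OF E sub]) (rule step_six[OF _ _ um gG gg Gg])
  qed
  show ?thesis using 2 3 4 6 by blast
qed

end
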